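(* Let $0\le\sigma<\tau\le\infty$. (i) Let $n=2$. If $\lambda,\mu\in\mathcal P_2$ and $\lambda\succcurlyeq\mu$, then $$\frac{P_\lambda(x;\tau)}{P_\lambda(\mathbf 1;\tau)}-\frac{P_\mu(x;\tau)}{P_\mu(\mathbf 1;\tau)}\in\mathcal J_S^{\sigma}(\mathbb R_{\ge0}).$$ (ii) Let $n\ge3$, $\lambda=(2,1^{n-2},0)$ and $\mu=(1^n)$. Then, in $n$ variables, $$\frac{P_\lambda(x;\tau)}{P_\lambda(\mathbf 1;\tau)}-\frac{P_\mu(x;\tau)}{P_\mu(\mathbf 1;\tau)}\in\mathcal J_S^{\sigma}(\mathbb R_{\ge0}).$$
   Context: $\mathcal P_n$ is the set of partitions $\lambda=(\lambda_1\ge\dots\ge\lambda_n\ge0)$ of length at most $n$ (integer entries, padded by zeros); $|\lambda|=\sum_i\lambda_i$; exponents denote repeated parts. $\mathbf 1=(1,\dots,1)\in\mathbb R^n$. For $\lambda,\mu\in\mathcal P_n$, $\lambda$ majorizes $\mu$ ($\lambda\succcurlyeq\mu$) if $|\lambda|=|\mu|$ and $\sum_{i=1}^k\lambda_i\ge\sum_{i=1}^k\mu_i$ for $k=1,\dots,n$. Jack polynomials: let $\theta$ be an indeterminate. On the ring of symmetric functions over $\mathbb Q(\theta)$ in infinitely many variables define $\langle p_\lambda,p_\mu\rangle=\delta_{\lambda\mu}z_\lambda\theta^{-\ell(\lambda)}$, where $p_\lambda$ are power sums, $\ell(\lambda)$ is the number of nonzero parts, $z_\lambda=\prod_{i}i^{m_i}m_i!$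 with $m_i$ the number of parts equal to $i$. The Jack symmetric functions $P_\lambda$ are the unique pairwise orthogonal family of the form $P_\lambda=m_\lambda+\sum_{\mu\ne\lambda,\ \lambda\succcurlyeq\mu}K_{\lambda\mu}(\theta)m_\mu$ ($m_\mu$ the monomial symmetric functions), and $P_\lambda(x;\theta)$ is the restriction of $P_\lambda$ to $n$ variables $x=(x_1,\dots,x_n)$ (Macdonald's $P_\lambda^{(\alpha)}$ with $\alpha=1/\theta$). For $\tau_0\in[0,\infty]$, $P_\lambda(x;\tau_0)$ is the coefficientwise specialization $\theta=\tau_0$ (limit $\theta\to\infty$ if $\tau_0=\infty$); thus $\tau_0=0,1,\infty$ give the monomial symmetric polynomial $m_\lambda$, the Schur polynomial $s_\lambda$, and the elementary symmetric polynomial $e_{\lambda'}$ ($\lambda'$ the conjugate partition) respectively. Jack semiring: for a fixed parameter $\sigma$ (and fixed $n$), $\mathcal J_S^{\sigma}(\mathbb R_{\ge0})$ is the set of (finite) $\mathbb R_{\ge0}$-linear combinations of products of polynomials from $$\Big\{\tfrac{P_\lambda(x;\sigma)}{P_\lambda(\mathbf 1;\sigma)}-\tfrac{P_\mu(x;\sigma)}{P_\mu(\mathbf 1;\sigma)} : \lambda,\mu\in\mathcal P_n,\ \lambda\succcurlyeq\mu\Big\}\cup\Big\{\tfrac{P_\lambda(x;\sigma)}{P_\lambda(\mathbf 1;\sigma)} : \lambda\in\mathcal P_n\Big\}.$$ *)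

theory Defs
  imports
    Complex_Main
    "HOL-Library.Poly_Mapping"
    "HOL-Library.Extended_Real"
    "HOL-Computational_Algebra.Computational_Algebra"
begin

text \<open>
  Finitely supported functions from naturals to naturals serve both as exponent vectors of
  monomials in the variables \<open>x\<^sub>0, x\<^sub>1, \<dots>\<close> and, when weakly decreasing, as partitions padded
  by zeros. All indices start at 0, so the part written \<open>\<lambda>\<^sub>i\<close> in the literature is
  \<open>Poly_Mapping.lookup lam (i - 1)\<close>.
\<close>

type_synonym expo = "nat \<Rightarrow>\<^sub>0 nat"

definition is_partition :: "expo \<Rightarrow> bool" where
  "is_partition lam \<longleftrightarrow> antimono (Poly_Mapping.lookup lam)"

definition Parts :: "nat \<Rightarrow> expo set" where
  "Parts n = {lam. is_partition lam \<and> Poly_Mapping.keys lam \<subseteq> {..<n}}"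

definition psize :: "expo \<Rightarrow> nat" where
  "psize lam = (\<Sum>i\<in>Poly_Mapping.keys lam. Poly_Mapping.lookup lam i)"

definition plength :: "expo \<Rightarrow> nat" where
  "plength lam = card (Poly_Mapping.keys lam)"

text \<open>
  For partitions of length at most \<open>n\<close>, the partial sum conditions with \<open>k > n\<close> follow from the
  equality of sizes, so no bound on \<open>k\<close> is needed.
\<close>

definition majorizes :: "expo \<Rightarrow> expo \<Rightarrow> bool" (infix "\<succcurlyeq>" 50) where
  "lam \<succcurlyeq> mu \<longleftrightarrow> psize lam = psize mu \<and>
     (\<forall>k. (\<Sum>i<k. Poly_Mapping.lookup mu i) \<le> (\<Sum>i<k. Poly_Mapping.lookup lam i))"

definition part_mult :: "nat \<Rightarrow> expo \<Rightarrow> nat" where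
  "part_mult i lam = card {j. Poly_Mapping.lookup lam j = i}"

definition zpart :: "expo \<Rightarrow> nat" where
  "zpart lam = (\<Prod>i\<in>Poly_Mapping.lookup lam ` Poly_Mapping.keys lam.
     i ^ part_mult i lam * fact (part_mult i lam))"


section \<open>Symmetric functions in infinitely many variables over the rational function field\<close>

type_synonym ratfun = "rat poly fract"

definition theta :: ratfun where
  "theta = Fract [:0, 1:] 1"

text \<open>
  A formal series in infinitely many variables is given by its coefficients; the product is the
  Cauchy product, in which every coefficient is a finite sum.
\<close>

type_synonym symfun = "expo \<Rightarrow> ratfun"

definition sf_one :: symfun where
  "sf_one a = (if a = 0 then 1 else 0)"

definition sf_mult :: "symfun \<Rightarrow> symfun \<Rightarrow> symfun" where
  "sf_mult f g a = (\<Sum>(b, c)\<in>{(b, c). b + c = a}. f b * g c)"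

definition rearrangement :: "expo \<Rightarrow> expo \<Rightarrow> bool" where
  "rearrangement a b \<longleftrightarrow>
     (\<exists>\<pi>. bij \<pi> \<and> Poly_Mapping.lookup b = Poly_Mapping.lookup a \<circ> \<pi>)"

definition monomial_sf :: "expo \<Rightarrow> symfun" where
  "monomial_sf lam a = (if rearrangement lam a then 1 else 0)"

definition power_sum :: "nat \<Rightarrow> symfun" where
  "power_sum k a = (if \<exists>i. a = Poly_Mapping.single i k then 1 else 0)"

definition power_sf :: "expo \<Rightarrow> symfun" where
  "power_sf lam =
     foldr sf_mult (map (\<lambda>i. power_sum (Poly_Mapping.lookup lam i)) [0..<plength lam]) sf_one"

text \<open>
  The power sums of partitions form a basis of the symmetric functions; \<open>power_coeffs f\<close> is the
  coordinate family of \<open>f\<close> in this basis, and the scalar product is the bilinear extension of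
  \<open>power_pairing\<close>.
\<close>

definition power_expansion :: "symfun \<Rightarrow> (expo \<Rightarrow> ratfun) \<Rightarrow> bool" where
  "power_expansion f c \<longleftrightarrow>
     finite {lam. c lam \<noteq> 0} \<and> {lam. c lam \<noteq> 0} \<subseteq> Collect is_partition \<and>
     (\<forall>a. f a = (\<Sum>lam | c lam \<noteq> 0. c lam * power_sf lam a))"

definition power_coeffs :: "symfun \<Rightarrow> expo \<Rightarrow> ratfun" where
  "power_coeffs f = (THE c. power_expansion f c)"

definition power_pairing :: "expo \<Rightarrow> expo \<Rightarrow> ratfun" where
  "power_pairing lam mu = (if lam = mu then of_nat (zpart lam) / theta ^ plength lam else 0)"

definition jack_inner :: "symfun \<Rightarrow> symfun \<Rightarrow> ratfun" where
  "jack_inner f g =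
     (\<Sum>lam | power_coeffs f lam \<noteq> 0. \<Sum>mu | power_coeffs g mu \<noteq> 0.
        power_coeffs f lam * power_coeffs g mu * power_pairing lam mu)"


section \<open>Jack polynomials\<close>

definition jack_family :: "(expo \<Rightarrow> symfun) \<Rightarrow> bool" where
  "jack_family P \<longleftrightarrow>
     (\<forall>lam. is_partition lam \<longrightarrow>
        (\<exists>K. \<forall>a. P lam a = monomial_sf lam a +
           (\<Sum>mu | is_partition mu \<and> mu \<noteq> lam \<and> lam \<succcurlyeq> mu. K mu * monomial_sf mu a))) \<and>
     (\<forall>lam mu. is_partition lam \<longrightarrow> is_partition mu \<longrightarrow> lam \<noteq> mu \<longrightarrow>
        jack_inner (P lam) (P mu) = 0)"

text \<open>
  \<open>jack_family\<close> constrains only the values at partitions, and there it determines them uniquely.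
\<close>

definition jack_sf :: "expo \<Rightarrow> symfun" where
  "jack_sf lam = (THE f. \<exists>P. jack_family P \<and> f = P lam)"

text \<open>
  The value at \<open>t\<close> of a rational function without pole at \<open>t\<close>; it does not depend on the chosen
  representation with nonvanishing denominator.
\<close>

definition ratfun_eval :: "ratfun \<Rightarrow> real \<Rightarrow> real" where
  "ratfun_eval f t = (THE v. \<exists>p q. f = Fract p q \<and> poly (map_poly of_rat q) t \<noteq> 0 \<and>
     v = poly (map_poly of_rat p) t / poly (map_poly of_rat q) t)"

definition specialize :: "ereal \<Rightarrow> ratfun \<Rightarrow> real" where
  "specialize \<tau> f =
     (if \<tau> = \<infinity> then Lim at_top (ratfun_eval f) else ratfun_eval f (real_of_ereal \<tau>))"

text \<open>Real polynomials in \<open>x\<^sub>0, x\<^sub>1, \<dots>\<close>, with the ring structure of \<open>Poly_Mapping\<close>.\<close>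

type_synonym rpoly = "expo \<Rightarrow>\<^sub>0 real"

definition const_poly :: "real \<Rightarrow> rpoly" where
  "const_poly c = Poly_Mapping.single 0 c"

definition eval_poly :: "rpoly \<Rightarrow> (nat \<Rightarrow> real) \<Rightarrow> real" where
  "eval_poly p x = (\<Sum>a\<in>Poly_Mapping.keys p. Poly_Mapping.lookup p a *
     (\<Prod>i\<in>Poly_Mapping.keys a. x i ^ Poly_Mapping.lookup a i))"

text \<open>
  Restriction to the variables \<open>x\<^sub>0, \<dots>, x\<^bsub>n-1\<^esub>\<close> (all others set to zero) and coefficientwise
  specialization of the parameter.
\<close>

definition jack_poly :: "nat \<Rightarrow> ereal \<Rightarrow> expo \<Rightarrow> rpoly" where
  "jack_poly n \<tau> lam = Poly_Mapping.Abs_poly_mapping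
     (\<lambda>a. if Poly_Mapping.keys a \<subseteq> {..<n} then specialize \<tau> (jack_sf lam a) else 0)"

definition jack_normalized :: "nat \<Rightarrow> ereal \<Rightarrow> expo \<Rightarrow> rpoly" where
  "jack_normalized n \<tau> lam =
     const_poly (1 / eval_poly (jack_poly n \<tau> lam) (\<lambda>_. 1)) * jack_poly n \<tau> lam"


section \<open>The Jack semiring\<close>

definition jack_generators :: "nat \<Rightarrow> ereal \<Rightarrow> rpoly set" where
  "jack_generators n \<sigma> =
     {jack_normalized n \<sigma> lam - jack_normalized n \<sigma> mu | lam mu.
        lam \<in> Parts n \<and> mu \<in> Parts n \<and> lam \<succcurlyeq> mu} \<union>
     {jack_normalized n \<sigma> lam | lam. lam \<in> Parts n}"

definition jack_semiring :: "nat \<Rightarrow> ereal \<Rightarrow> rpoly set" where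
  "jack_semiring n \<sigma> =
     {\<Sum>i<N. const_poly (c i) * prod_list (gs i) | (N :: nat) c gs.
        \<forall>i<N. 0 \<le> c i \<and> set (gs i) \<subseteq> jack_generators n \<sigma>}"

end

theory Submission
  imports Defs "HOL-Combinatorics.Permutations"
begin

text \<open>
  In two variables the normalized Jack polynomial of \<open>(a, b)\<close> is \<open>(x y)\<^sup>b\<close> times the mean of
  \<open>((1 - U) x + U y)\<^bsup>a-b\<^esup>\<close> for a random variable \<open>U\<close> with the symmetric beta distribution of parameter
  \<open>\<tau>\<close> (two point masses for \<open>\<tau> = 0\<close>, the point \<open>1/2\<close> for \<open>\<tau> = \<infinity>\<close>). With \<open>s = (x + y)/2\<close> and
  \<open>w = (x - y)/2\<close> the base of the power is \<open>s + (1 - 2U) w\<close>, so the mean is a polynomial in \<open>s\<close> and \<open>w\<^sup>2\<close>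
  whose coefficients are binomial coefficients times even central moments, hence nonnegative. The
  difference belonging to \<open>(a, b)\<close> and \<open>(a - 1, b + 1)\<close> then also has nonnegative coefficients in \<open>s\<close>,
  \<open>w\<^sup>2\<close> and \<open>x y\<close> (\<open>Phi_step_coeff\<close>), and for every finite \<open>\<sigma>\<close> these three polynomials lie in the
  Jack semiring: \<open>s\<close> and \<open>x y\<close> are normalized Jack polynomials, and \<open>w\<^sup>2\<close> is a positive multiple of the
  generator for \<open>(2, 0)\<close> and \<open>(1, 1)\<close>. In the second part only two monomial symmetric polynomials occur,
  and the differences for \<open>\<sigma>\<close> and \<open>\<tau>\<close> turn out to be positive multiples of one another
  (\<open>hook_difference\<close>).

  Both computations rest on an eigenvalue equation for Jack functions, which are
  defined as the unique family with certain properties; so their existence and uniqueness have to be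
  proved as well. Existence
  uses the operators of Nazarov and Sklyanin. On functions that are symmetric in all variables except
  \<open>x\<^sub>i\<close>, a Dunkl operator \<open>dunkl\<close> acts. In the basis \<open>x\<^sub>i\<^sup>a p\<^sub>M\<close> (\<open>p\<^sub>M\<close> a product of power sums) its
  matrix is symmetric with respect to the weights of the scalar product (\<open>kern_symmetric\<close>), so the
  operator \<open>nsop k\<close>, which sends a symmetric function \<open>f\<close> to the part of \<open>dunkl\<^sup>k f\<close> free of \<open>x\<^sub>i\<close>, is
  self-adjoint. In terms of monomials the Dunkl operator respects the dominance order (\<open>below_dunkl\<close>),
  and the diagonal entry of \<open>nsop (k + 1)\<close> at \<open>\<mu>\<close> is \<open>\<theta>\<close> times a polynomial in \<open>\<theta>\<close> with value
  \<open>\<Sum>\<^sub>i \<mu>\<^sub>i\<^sup>k\<close> at \<open>\<theta> = 0\<close>; for large \<open>k\<close> these values separate the partitions of a given size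
  (\<open>ex_distinct_eig\<close>). The eigenfunctions of a triangular self-adjoint operator with distinct diagonal
  entries form an orthogonal unitriangular family (\<open>jack_family_exists\<close>).

  The field of rational functions is ordered with \<open>\<theta> > 0\<close>, so the scalar product has no isotropic
  vectors. This gives uniqueness, and it shows that a Jack function is an eigenfunction of every
  \<open>nsop k\<close> (\<open>jack_family_eigen\<close>). The case \<open>k = 3\<close> is the Calogero-Sutherland equation
  (\<open>jack_cs_equation\<close>). In two variables it reduces to a recurrence of length two for the
  coefficients (\<open>jack_ex2_recurrence\<close>), which is the recurrence of the beta moments.
\<close>

section \<open>Exponent vectors and their multisets of parts\<close>

abbreviation lkp :: "expo \<Rightarrow> nat \<Rightarrow> nat" where "lkp \<equiv> Poly_Mapping.lookup"
abbreviation kys :: "expo \<Rightarrow> nat set" where "kys \<equiv> Poly_Mapping.keys"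
abbreviation sgl :: "nat \<Rightarrow> nat \<Rightarrow> expo" where "sgl \<equiv> Poly_Mapping.single"

text \<open>
  The multiset of nonzero exponents. Two exponent vectors are rearrangements of each other if and
  only if their multisets agree, and partitions correspond to the multisets without \<open>0\<close>.
\<close>
definition parts :: "expo \<Rightarrow> nat multiset" where
  "parts a = image_mset (lkp a) (mset_set (kys a))"

lemma lkp_diff_single: "lkp (a - sgl i r) k = lkp a k - (if k = i then r else 0)"
  by (simp add: lookup_minus lookup_single when_def)

lemma lkp_add_single: "lkp (a + sgl i r) k = lkp a k + (if k = i then r else 0)"
  by (simp add: lookup_add lookup_single when_def)

lemma zero_notin_parts [simp]: "0 \<notin># parts a"
  by (auto simp: parts_def in_keys_iff)

lemma count_parts: "x > 0 \<Longrightarrow> count (parts a) x = card {k. lkp a k = x}"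
proof -
  assume x: "x > 0"
  have "count (parts a) x = card {k \<in> kys a. lkp a k = x}"
    by (simp add: parts_def count_image_mset Int_def vimage_def
        sum.inter_filter conj_commute)
  also have "{k \<in> kys a. lkp a k = x} = {k. lkp a k = x}"
    using x by (auto simp: in_keys_iff)
  finally show ?thesis .
qed

lemma size_parts [simp]: "size (parts a) = card (kys a)"
  by (simp add: parts_def)

lemma sum_mset_parts [simp]: "\<Sum>\<^sub># (parts a) = psize a"
  by (simp add: parts_def psize_def sum_unfold_sum_mset)

lemma sum_parts_image:
  "(\<Sum>x\<in>#parts a. f x) = (\<Sum>k\<in>kys a. f (lkp a k))"
  by (simp add: parts_def sum_unfold_sum_mset image_mset.compositionality comp_def)

lemma psize_superset:
  assumes "finite S" "kys a \<subseteq> S" shows "psize a = (\<Sum>i\<in>S. lkp a i)"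
  unfolding psize_def using assms
  by (intro sum.mono_neutral_left) (auto simp: in_keys_iff)

lemma parts_superset:
  assumes "finite S" "kys a \<subseteq> S"
  shows "filter_mset (\<lambda>x. x \<noteq> 0) (image_mset (lkp a) (mset_set S)) = parts a"
proof -
  have "filter_mset (\<lambda>x. x \<noteq> 0) (image_mset (lkp a) (mset_set S))
      = image_mset (lkp a) (filter_mset (\<lambda>k. lkp a k \<noteq> 0) (mset_set S))"
    by (simp add: filter_mset_image_mset comp_def)
  also have "filter_mset (\<lambda>k. lkp a k \<noteq> 0) (mset_set S) = mset_set {k\<in>S. lkp a k \<noteq> 0}"
    using assms by (simp add: filter_mset_mset_set)
  also have "{k\<in>S. lkp a k \<noteq> 0} = kys a" using assms by (auto simp: in_keys_iff)
  finally show ?thesis by (simp add: parts_def)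
qed

lemma rearrangement_iff_parts: "rearrangement a b \<longleftrightarrow> parts a = parts b"
proof
  assume "rearrangement a b"
  then obtain \<pi> where p: "bij \<pi>" "lkp b = lkp a \<circ> \<pi>" unfolding rearrangement_def by blast
  have "bij_betw \<pi> (kys b) (kys a)"
    unfolding bij_betw_def
  proof
    show "inj_on \<pi> (kys b)" using p(1) by (meson bij_is_inj inj_on_subset subset_UNIV)
    show "\<pi> ` kys b = kys a"
    proof (intro equalityI subsetI)
      fix x assume "x \<in> \<pi> ` kys b" then show "x \<in> kys a" using p(2) by (auto simp: in_keys_iff)
    next
      fix x assume x: "x \<in> kys a"
      obtain y where "x = \<pi> y" using p(1) by (metis bij_pointE)
      with x p(2) show "x \<in> \<pi> ` kys b" by (auto simp: in_keys_iff)
    qed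
  qed
  then have "image_mset \<pi> (mset_set (kys b)) = mset_set (kys a)"
    by (simp add: bij_betw_def image_mset_mset_set)
  then show "parts a = parts b"
    unfolding parts_def p(2) by (metis image_mset.compositionality)
next
  assume eq: "parts a = parts b"
  have "finite (kys a \<union> kys b)" by simp
  then obtain N where N: "kys a \<union> kys b \<subseteq> {..<N}" using finite_nat_iff_bounded by blast
  define xs where "xs = map (lkp a) [0..<N]"
  define ys where "ys = map (lkp b) [0..<N]"
  have mx: "mset xs = image_mset (lkp a) (mset_set {..<N})"
    "mset ys = image_mset (lkp b) (mset_set {..<N})"
    by (simp_all add: xs_def ys_def lessThan_atLeast0)
  have c: "count (mset xs) x = count (mset ys) x" if "x \<noteq> 0" for x
  proof -
    have "count (filter_mset (\<lambda>x. x \<noteq> 0) (mset xs)) x = count (filter_mset (\<lambda>x. x \<noteq> 0) (mset ys)) x"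
      using parts_superset[of "{..<N}" a] parts_superset[of "{..<N}" b] N eq
      by (simp add: mx)
    then show ?thesis using that by simp
  qed
  have sz: "size (filter_mset (\<lambda>x. x \<noteq> 0) (mset xs)) + count (mset xs) 0 = N"
    "size (filter_mset (\<lambda>x. x \<noteq> 0) (mset ys)) + count (mset ys) 0 = N"
  proof -
    have *: "size (filter_mset (\<lambda>x. x \<noteq> 0) M) + count M 0 = size M" for M :: "nat multiset"
      by (induction M) auto
    show "size (filter_mset (\<lambda>x. x \<noteq> 0) (mset xs)) + count (mset xs) 0 = N"
      "size (filter_mset (\<lambda>x. x \<noteq> 0) (mset ys)) + count (mset ys) 0 = N"
      unfolding * by (auto simp: xs_def ys_def)
  qed
  have "filter_mset (\<lambda>x. x \<noteq> 0) (mset xs) = filter_mset (\<lambda>x. x \<noteq> 0) (mset ys)"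
    using parts_superset[of "{..<N}" a] parts_superset[of "{..<N}" b] N eq
    by (simp add: mx)
  with sz have "count (mset xs) 0 = count (mset ys) 0" by simp
  with c have "mset xs = mset ys" by (metis multiset_eqI)
  then obtain p where p: "p permutes {..<length xs}" "permute_list p xs = ys"
    by (metis mset_eq_permutation)
  have len: "length xs = N" by (simp add: xs_def)
  have "lkp b k = lkp a (p k)" for k
  proof (cases "k < N")
    case True
    then have pk: "p k < N" using p(1) len permutes_in_image[OF p(1), of k] by simp
    have "lkp b k = ys ! k" using True by (simp add: ys_def)
    also have "\<dots> = xs ! p k" using p True len by (metis permute_list_nth)
    also have "\<dots> = lkp a (p k)" using pk by (simp add: xs_def)
    finally show ?thesis .
  next
    case False
    then have "p k = k" using p(1) len by (simp add: permutes_def)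
    moreover have "k \<notin> kys a" "k \<notin> kys b" using N False by auto
    ultimately show ?thesis by (simp add: in_keys_iff)
  qed
  then show "rearrangement a b" unfolding rearrangement_def
    using permutes_bij[OF p(1)] by (intro exI[of _ p]) auto
qed

lemma parts_eq_bij:
  assumes "bij \<pi>" "\<And>k. lkp b k = lkp a (\<pi> k)" shows "parts b = parts a"
proof -
  have "rearrangement a b" unfolding rearrangement_def
    using assms by (intro exI[of _ \<pi>]) auto
  then show ?thesis by (simp add: rearrangement_iff_parts)
qed

lemma parts_add_single:
  assumes "i \<notin> kys a" "r > 0"
  shows "parts (a + sgl i r) = add_mset r (parts a)"
proof -
  have k: "kys (a + sgl i r) = insert i (kys a)"
    using assms by (auto simp: in_keys_iff lkp_add_single split: if_splits)
  have "image_mset (lkp (a + sgl i r)) (mset_set (kys a)) = image_mset (lkp a) (mset_set (kys a))"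
    using assms by (intro image_mset_cong) (auto simp: lkp_add_single)
  then show ?thesis using assms
    by (simp add: parts_def k lkp_add_single in_keys_iff)
qed

lemma parts_remove:
  assumes "lkp a i = r" "r > 0"
  shows "parts a = add_mset r (parts (a - sgl i r))"
proof -
  have "a = (a - sgl i r) + sgl i r"
    using assms by (intro poly_mapping_eqI) (simp add: lkp_diff_single lkp_add_single)
  moreover have "i \<notin> kys (a - sgl i r)" using assms by (simp add: in_keys_iff lkp_diff_single)
  ultimately show ?thesis using parts_add_single assms(2) by metis
qed

lemma partition_keys:
  assumes "is_partition a" shows "kys a = {..<card (kys a)}"
proof -
  have mono: "lkp a j \<le> lkp a i" if "i \<le> j" for i j
    using assms that unfolding is_partition_def by (simp add: antimonoD)
  have down: "i \<in> kys a" if "j \<in> kys a" "i \<le> j" for i j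
    using mono[OF that(2)] that by (simp add: in_keys_iff)
  have "finite (kys a)" by simp
  then obtain N where "kys a = {..<N}"
  proof -
    define N where "N = (LEAST n. n \<notin> kys a)"
    have ex: "\<exists>n. n \<notin> kys a" using \<open>finite (kys a)\<close> infinite_UNIV_nat ex_new_if_finite by blast
    have "N \<notin> kys a" unfolding N_def using ex by (rule LeastI_ex)
    moreover have "m \<in> kys a" if "m < N" for m using that not_less_Least N_def by blast
    ultimately have "kys a = {..<N}" using down by (auto simp: not_less) (metis linorder_not_le)
    then show ?thesis using that by blast
  qed
  then show ?thesis by simp
qed

lemma parts_mset_map:
  assumes "is_partition a" shows "parts a = mset (map (lkp a) [0..<card (kys a)])"
  unfolding parts_def by (subst partition_keys[OF assms]) (simp add: lessThan_atLeast0)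

lemma parts_inj_partition:
  assumes "is_partition a" "is_partition b" "parts a = parts b" shows "a = b"
proof -
  let ?n = "card (kys a)"
  have n: "card (kys b) = ?n" using assms(3) size_parts by metis
  have s: "sorted (rev (map (lkp c) [0..<k]))" if "is_partition c" for c k
    using that by (auto simp: sorted_rev_iff_nth_mono is_partition_def antimono_def)
  have "rev (map (lkp a) [0..<?n]) = rev (map (lkp b) [0..<?n])"
    using assms s n parts_mset_map by (metis mset_rev properties_for_sort)
  then have "lkp a k = lkp b k" if "k < ?n" for k using that
    by (metis (no_types, lifting) add_0 diff_zero length_upt nth_map nth_upt rev_rev_ident)
  moreover have "lkp a k = 0" "lkp b k = 0" if "\<not> k < ?n" for k
    using that partition_keys assms n by (metis in_keys_iff lessThan_iff)+
  ultimately show ?thesis by (metis poly_mapping_eqI)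
qed

lemma ex_partition:
  assumes "0 \<notin># M" shows "\<exists>a. is_partition a \<and> parts a = M"
proof -
  define xs where "xs = rev (sorted_list_of_multiset M)"
  have xs: "mset xs = M" "sorted (rev xs)" by (simp_all add: xs_def)
  define a where "a = Poly_Mapping.nth xs"
  have lk: "lkp a k = (if k < length xs then xs ! k else 0)" for k
    by (simp add: a_def nth_default_def)
  have nz: "xs ! k \<noteq> 0" if "k < length xs" for k
    using assms xs(1) that by (metis nth_mem set_mset_mset)
  have "is_partition a"
    using xs(2) by (auto simp: is_partition_def antimono_def lk sorted_rev_iff_nth_mono)
  have k: "kys a = {..<length xs}" using nz by (auto simp: in_keys_iff lk split: if_splits)
  have "parts a = mset (map (lkp a) [0..<length xs])"
    using parts_mset_map[OF \<open>is_partition a\<close>] k by simp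
  also have "map (lkp a) [0..<length xs] = xs" by (rule nth_equalityI) (auto simp: lk)
  finally show ?thesis using xs \<open>is_partition a\<close> by auto
qed

text \<open>
  The partition with a given multiset of parts (meaningful only for multisets without \<open>0\<close>).
\<close>
definition part_of :: "nat multiset \<Rightarrow> expo" where
  "part_of M = (SOME a. is_partition a \<and> parts a = M)"

lemma part_of: assumes "0 \<notin># M" shows "is_partition (part_of M)" "parts (part_of M) = M"
  using someI_ex[OF ex_partition[OF assms]] by (simp_all add: part_of_def)

lemma part_of_parts: "is_partition a \<Longrightarrow> part_of (parts a) = a"
  by (rule parts_inj_partition) (auto intro: part_of)

text \<open>
  The partitions of \<open>d\<close>, as multisets.
\<close>
definition mparts :: "nat \<Rightarrow> nat multiset set" where
  "mparts d = {M. 0 \<notin># M \<and> \<Sum>\<^sub># M = d}"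

lemma size_le_sum: "0 \<notin># M \<Longrightarrow> size M \<le> \<Sum>\<^sub># (M :: nat multiset)"
  by (induction M) (auto simp: Suc_le_eq)

lemma finite_mparts [simp]: "finite (mparts d)"
proof -
  have "M \<in> mset ` {xs. set xs \<subseteq> {..d} \<and> length xs \<le> d}" if "M \<in> mparts d" for M
  proof -
    obtain xs where xs: "M = mset xs" by (metis ex_mset)
    have "x \<le> d" if "x \<in># M" for x
      using that \<open>M \<in> mparts d\<close> by (auto simp: mparts_def dest!: multi_member_split)
    moreover have "length xs \<le> d" using size_le_sum[of M] \<open>M \<in> mparts d\<close> xs by (auto simp: mparts_def)
    ultimately show ?thesis using xs by auto
  qed
  then have "mparts d \<subseteq> mset ` {xs. set xs \<subseteq> {..d} \<and> length xs \<le> d}" by blast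
  then show ?thesis
    by (rule finite_subset) (intro finite_imageI finite_lists_length_le finite_atMost)
qed

lemma parts_in_mparts [simp]: "parts a \<in> mparts d \<longleftrightarrow> psize a = d"
  by (simp add: mparts_def)

section \<open>Symmetric functions and power sums\<close>

text \<open>
  Symmetric series, given by their coefficients.
\<close>
definition symm :: "(expo \<Rightarrow> 'a) \<Rightarrow> bool" where
  "symm f \<longleftrightarrow> (\<forall>a b. parts a = parts b \<longrightarrow> f a = f b)"

lemma symmD: "symm f \<Longrightarrow> parts a = parts b \<Longrightarrow> f a = f b"
  unfolding symm_def by blast

text \<open>
  The monomial symmetric function of the partition with the multiset \<open>M\<close> of parts.
\<close>
definition msym :: "nat multiset \<Rightarrow> expo \<Rightarrow> 'a::zero_neq_one" where
  "msym M a = (if parts a = M then 1 else 0)"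

lemma monomial_sf_eq: "monomial_sf a = msym (parts a)"
proof (rule ext)
  fix x
  have "(parts a = parts x) = (parts x = parts a)" by (rule eq_commute)
  then show "monomial_sf a x = msym (parts a) x"
    unfolding monomial_sf_def msym_def rearrangement_iff_parts by (rule if_cong) (rule refl)+
qed

text \<open>
  Multiplication by the power sum \<open>p\<^sub>r\<close>. The condition \<open>0 < r\<close> makes the sum finite; for \<open>r = 0\<close> the
  operator is zero, so that the operators commute for all indices.
\<close>
definition pmul :: "nat \<Rightarrow> (expo \<Rightarrow> 'a::comm_ring_1) \<Rightarrow> expo \<Rightarrow> 'a" where
  "pmul r f a = (\<Sum>i | 0 < r \<and> r \<le> lkp a i. f (a - sgl i r))"

lemma finite_pmul_set [simp]: "finite {i. 0 < r \<and> r \<le> lkp a i}"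
  by (rule finite_subset[of _ "kys a"]) (auto simp: in_keys_iff)

lemma pmul_commute: "pmul r (pmul s f) = pmul s (pmul r f)"
proof (rule ext)
  fix a
  have *: "pmul r (pmul s f) a = (\<Sum>(i,j) | 0 < r \<and> 0 < s \<and> r \<le> lkp a i \<and> s \<le> lkp (a - sgl i r) j.
      f (a - sgl i r - sgl j s))" for r s
    unfolding pmul_def
    by (subst sum.Sigma) (auto intro!: sum.cong simp: Sigma_def)
  have "r \<le> lkp a i \<and> s \<le> lkp (a - sgl i r) j \<longleftrightarrow> s \<le> lkp a j \<and> r \<le> lkp (a - sgl j s) i" for i j
    by (auto simp: lkp_diff_single)
  moreover have "a - sgl i r - sgl j s = a - sgl j s - sgl i r" for i j
    by (intro poly_mapping_eqI) (simp add: lookup_minus)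
  ultimately show "pmul r (pmul s f) a = pmul s (pmul r f) a"
    unfolding * by (intro sum.reindex_bij_witness[of _ "\<lambda>(i,j). (j,i)" "\<lambda>(i,j). (j,i)"]) auto
qed

interpretation pm: comp_fun_commute "pmul :: nat \<Rightarrow> (expo \<Rightarrow> 'a::comm_ring_1) \<Rightarrow> _"
  by unfold_locales (rule ext, unfold comp_apply, rule pmul_commute)

text \<open>
  The product of the power sums \<open>p\<^sub>r\<close> for \<open>r\<close> in \<open>M\<close>.
\<close>
definition psum :: "nat multiset \<Rightarrow> expo \<Rightarrow> 'a::comm_ring_1" where
  "psum M = fold_mset pmul (\<lambda>a. if a = 0 then 1 else 0) M"

lemma psum_empty: "psum {#} = (\<lambda>a. if a = 0 then 1 else 0)"
  by (simp add: psum_def)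

lemma psum_add: "psum (add_mset r M) = pmul r (psum M)"
  by (simp add: psum_def pm.fold_mset_add_mset)

lemma finite_add_set: "finite {(b, c). b + c = (a :: expo)}"
proof -
  define F where "F = {f. \<forall>x. (x \<in> kys a \<longrightarrow> f x \<in> {..psize a}) \<and> (x \<notin> kys a \<longrightarrow> f x = (0::nat))}"
  have "finite F" unfolding F_def by (rule finite_set_of_finite_funs) auto
  then have fin: "finite (lkp -` F)"
    by (rule finite_vimageI) (simp add: inj_def lookup_inject)
  have "{(b, c). b + c = a} \<subseteq> (\<lambda>b. (b, a - b)) ` (lkp -` F)"
  proof (intro subsetI, elim CollectE case_prodE)
    fix x b c assume x: "x = (b, c)" and a: "b + c = a"
    have "lkp b x \<le> psize a" if "x \<in> kys a" for x
    proof -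
      have "lkp b x \<le> lkp a x" by (simp add: lookup_add flip: a)
      also have "\<dots> \<le> psize a" unfolding psize_def using that by (intro member_le_sum) auto
      finally show ?thesis .
    qed
    moreover have "lkp b x = 0" if "x \<notin> kys a" for x
      using that by (simp add: in_keys_iff lookup_add flip: a)
    ultimately have "b \<in> lkp -` F" by (simp add: F_def)
    moreover have "c = a - b" using a by (metis add_diff_cancel_left')
    ultimately show "x \<in> (\<lambda>b. (b, a - b)) ` (lkp -` F)"
      using x by blast
  qed
  then show ?thesis using fin finite_surj by blast
qed

lemma sf_mult_power_sum:
  assumes "r > 0" shows "sf_mult (power_sum r) f = pmul r f"
proof (rule ext)
  fix a
  have inj: "sgl i r = sgl j r \<longleftrightarrow> i = j" for i j
    using assms by (metis keys_single less_numeral_extra(3) singleton_inject)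
  have "sf_mult (power_sum r) f a = (\<Sum>(b, c)\<in>(\<lambda>i. (sgl i r, a - sgl i r)) ` {i. 0 < r \<and> r \<le> lkp a i}.
       power_sum r b * f c)"
    unfolding sf_mult_def
  proof (intro sum.mono_neutral_right finite_add_set)
    show "(\<lambda>i. (sgl i r, a - sgl i r)) ` {i. 0 < r \<and> r \<le> lkp a i} \<subseteq> {(b, c). b + c = a}"
      by (auto intro!: poly_mapping_eqI simp: lookup_add lkp_diff_single lookup_single when_def)
    show "\<forall>i\<in>{(b, c). b + c = a} - (\<lambda>i. (sgl i r, a - sgl i r)) ` {i. 0 < r \<and> r \<le> lkp a i}.
       (case i of (b, c) \<Rightarrow> power_sum r b * f c) = 0"
    proof (intro ballI, rule ccontr)
      fix x assume x: "x \<in> {(b, c). b + c = a} - (\<lambda>i. (sgl i r, a - sgl i r)) ` {i. 0 < r \<and> r \<le> lkp a i}"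
        and nz: "(case x of (b, c) \<Rightarrow> power_sum r b * f c) \<noteq> 0"
      obtain b c where bc: "x = (b, c)" by force
      from nz bc have "power_sum r b \<noteq> 0" by auto
      then obtain i where b: "b = sgl i r" by (auto simp: power_sum_def split: if_splits)
      from x bc have a: "a = b + c" by auto
      have "r \<le> lkp a i" by (simp add: a b lookup_add)
      moreover have "c = a - sgl i r" by (simp add: a b)
      ultimately show False using x bc b assms by auto
    qed
  qed
  also have "\<dots> = pmul r f a"
    unfolding pmul_def by (subst sum.reindex) (auto simp: inj_on_def inj power_sum_def intro!: sum.cong)
  finally show "sf_mult (power_sum r) f a = pmul r f a" .
qed

lemma power_sf_eq:
  assumes "is_partition a" shows "power_sf a = psum (parts a)"
proof -
  have "foldr sf_mult (map power_sum xs) sf_one = psum (mset xs)" if "0 \<notin> set xs" for xs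
    using that
  proof (induction xs)
    case Nil then show ?case by (auto simp: psum_empty sf_one_def)
  next
    case (Cons x xs) then show ?case by (simp add: psum_add sf_mult_power_sum)
  qed
  from this[of "map (lkp a) [0..<plength a]"] 
  have "0 \<notin> set (map (lkp a) [0..<plength a]) \<Longrightarrow> power_sf a = psum (mset (map (lkp a) [0..<plength a]))"
    by (simp add: power_sf_def comp_def)
  moreover have "mset (map (lkp a) [0..<plength a]) = parts a"
    using parts_mset_map[OF assms] by (simp add: plength_def)
  moreover have "0 \<notin> set (map (lkp a) [0..<plength a])"
    using \<open>_ = parts a\<close> zero_notin_parts[of a] by (metis set_mset_mset)
  ultimately show ?thesis by simp
qed

lemma psize_diff_single: "r \<le> lkp a i \<Longrightarrow> psize (a - sgl i r) + r = psize a"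
proof -
  assume r: "r \<le> lkp a i"
  let ?S = "insert i (kys a)"
  have "psize (a - sgl i r) = (\<Sum>k\<in>?S. lkp (a - sgl i r) k)"
    by (rule psize_superset) (auto simp: in_keys_iff lkp_diff_single split: if_splits)
  also have "\<dots> = lkp a i - r + (\<Sum>k\<in>?S - {i}. lkp (a - sgl i r) k)"
    by (subst sum.remove[of _ i]) (auto simp: lkp_diff_single)
  also have "(\<Sum>k\<in>?S - {i}. lkp (a - sgl i r) k) = (\<Sum>k\<in>?S - {i}. lkp a k)"
    by (intro sum.cong) (auto simp: lkp_diff_single)
  finally have 1: "psize (a - sgl i r) = lkp a i - r + (\<Sum>k\<in>?S - {i}. lkp a k)" .
  have "psize a = (\<Sum>k\<in>?S. lkp a k)" by (rule psize_superset) auto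
  also have "\<dots> = lkp a i + (\<Sum>k\<in>?S - {i}. lkp a k)"
    by (subst sum.remove[of _ i]) auto
  finally show ?thesis using 1 r by simp
qed

lemma pmul_symm:
  assumes "symm f" shows "symm (pmul r f)"
  unfolding symm_def
proof (intro allI impI)
  fix a b assume "parts a = parts b"
  then obtain \<pi> where p: "bij \<pi>" "lkp b = lkp a \<circ> \<pi>"
    using rearrangement_iff_parts unfolding rearrangement_def by blast
  have "pmul r f b = (\<Sum>i | 0 < r \<and> r \<le> lkp b i. f (a - sgl (\<pi> i) r))"
    unfolding pmul_def
  proof (intro sum.cong refl)
    fix i
    have "parts (b - sgl i r) = parts (a - sgl (\<pi> i) r)"
    proof (rule parts_eq_bij[OF p(1)])
      fix k have "\<pi> k = \<pi> i \<longleftrightarrow> k = i" using p(1) by (metis bij_pointE)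
      then show "lkp (b - sgl i r) k = lkp (a - sgl (\<pi> i) r) (\<pi> k)"
        by (simp add: lkp_diff_single p(2))
    qed
    then show "f (b - sgl i r) = f (a - sgl (\<pi> i) r)" using assms symmD by blast
  qed
  also have "\<dots> = (\<Sum>i | 0 < r \<and> r \<le> lkp a i. f (a - sgl i r))"
  proof (rule sum.reindex_bij_betw)
    show "bij_betw \<pi> {i. 0 < r \<and> r \<le> lkp b i} {i. 0 < r \<and> r \<le> lkp a i}"
      unfolding bij_betw_def
    proof
      show "inj_on \<pi> {i. 0 < r \<and> r \<le> lkp b i}"
        using p(1) by (meson bij_is_inj inj_on_subset subset_UNIV)
      show "\<pi> ` {i. 0 < r \<and> r \<le> lkp b i} = {i. 0 < r \<and> r \<le> lkp a i}"
      proof (intro equalityI subsetI)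
        fix x assume x: "x \<in> {i. 0 < r \<and> r \<le> lkp a i}"
        obtain y where "x = \<pi> y" using p(1) by (metis bij_pointE)
        with x p(2) show "x \<in> \<pi> ` {i. 0 < r \<and> r \<le> lkp b i}" by auto
      qed (auto simp: p(2))
    qed
  qed
  finally show "pmul r f a = pmul r f b" by (simp add: pmul_def)
qed

lemma psum_symm: "symm (psum M)"
proof (induction M)
  case empty
  have "a = 0 \<longleftrightarrow> b = 0" if "parts a = parts b" for a b
  proof -
    have "a = 0 \<longleftrightarrow> parts a = {#}" for a
      by (simp add: parts_def mset_set_empty_iff)
    then show ?thesis using that by simp
  qed
  then show ?case unfolding symm_def psum_empty by (metis (no_types, lifting))
next
  case (add r M) then show ?case by (simp add: psum_add pmul_symm)
qed

lemma pmul_nonzeroE: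
  assumes "pmul r f a \<noteq> 0"
  obtains i where "0 < r" "r \<le> lkp a i" "f (a - sgl i r) \<noteq> 0"
  using assms unfolding pmul_def by (metis (mono_tags, lifting) mem_Collect_eq sum.not_neutral_contains_not_neutral)

lemma psum_degree: "psum M a \<noteq> 0 \<Longrightarrow> psize a = \<Sum>\<^sub># M"
proof (induction M arbitrary: a)
  case empty then show ?case by (auto simp: psum_empty psize_def split: if_splits)
next
  case (add r M)
  from add.prems obtain i where "0 < r" "r \<le> lkp a i" "psum M (a - sgl i r) \<noteq> (0 :: 'a)"
    unfolding psum_add by (rule pmul_nonzeroE)
  with add.IH psize_diff_single[of r a i] show ?case by force
qed

lemma card_keys_diff_single:
  assumes "0 < r" "r \<le> lkp a i"
  shows "card (kys a) \<le> Suc (card (kys (a - sgl i r)))"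
    "r \<noteq> lkp a i \<Longrightarrow> kys (a - sgl i r) = kys a"
proof -
  have "kys a \<subseteq> insert i (kys (a - sgl i r))"
    by (auto simp: in_keys_iff lkp_diff_single split: if_splits)
  then have "card (kys a) \<le> card (insert i (kys (a - sgl i r)))" by (intro card_mono) auto
  also have "\<dots> \<le> Suc (card (kys (a - sgl i r)))" by (simp add: card_insert_if)
  finally show "card (kys a) \<le> Suc (card (kys (a - sgl i r)))" .
  show "r \<noteq> lkp a i \<Longrightarrow> kys (a - sgl i r) = kys a" using assms
    by (auto simp: in_keys_iff lkp_diff_single split: if_splits)
qed

text \<open>
  A product of \<open>l\<close> power sums contains no monomial in more than \<open>l\<close> variables, and those in exactly
  \<open>l\<close> variables have exponents \<open>M\<close>. Hence the transition matrix between the products of power sums and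
  the monomial symmetric functions is triangular with respect to length; this gives both linear
  independence (\<open>psum_indep\<close>) and spanning (\<open>psum_span\<close>).
\<close>
lemma psum_support:
  "psum M a \<noteq> 0 \<Longrightarrow> card (kys a) \<le> size M \<and> (card (kys a) = size M \<longrightarrow> parts a = M)"
proof (induction M arbitrary: a)
  case empty then show ?case by (auto simp: psum_empty parts_def split: if_splits)
next
  case (add r M)
  from add.prems obtain i where i: "0 < r" "r \<le> lkp a i" "psum M (a - sgl i r) \<noteq> (0 :: 'a)"
    unfolding psum_add by (rule pmul_nonzeroE)
  note IH = add.IH[OF i(3)] and c = card_keys_diff_single[OF i(1,2)]
  show ?case
  proof (cases "r = lkp a i")
    case True
    then show ?thesis using IH c parts_remove[of a i r] i by auto
  next
    case False
    then show ?thesis using IH c by simp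
  qed
qed

lemma psum_of_nat: "\<exists>c. psum M a = of_nat c \<and> (parts a = M \<longrightarrow> c > 0)"
proof (induction M arbitrary: a)
  case empty
  show ?case
  proof (cases "a = 0")
    case True then show ?thesis by (intro exI[of _ 1]) (simp add: psum_empty)
  next
    case False
    then have "parts a \<noteq> {#}" by (simp add: parts_def mset_set_empty_iff)
    with False show ?thesis by (intro exI[of _ 0]) (simp add: psum_empty)
  qed
next
  case (add r M)
  then obtain c where c: "\<And>a. psum M a = (of_nat (c a) :: 'a)" "\<And>a. parts a = M \<Longrightarrow> c a > 0" by metis
  have "psum (add_mset r M) a = (of_nat (\<Sum>i | 0 < r \<and> r \<le> lkp a i. c (a - sgl i r)) :: 'a)"
    by (simp add: psum_add pmul_def c(1))
  moreover have "(\<Sum>i | 0 < r \<and> r \<le> lkp a i. c (a - sgl i r)) > 0" if p: "parts a = add_mset r M"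
  proof -
    have "r \<in># parts a" using p by simp
    then obtain i where i: "lkp a i = r" "r > 0" by (auto simp: parts_def in_keys_iff)
    then have "parts (a - sgl i r) = M" using parts_remove[of a i r] p by simp
    then have "0 < c (a - sgl i r)" by (rule c(2))
    also have "\<dots> \<le> (\<Sum>i | 0 < r \<and> r \<le> lkp a i. c (a - sgl i r))"
      using i by (intro member_le_sum[of i] finite_pmul_set) auto
    finally show ?thesis .
  qed
  ultimately show ?case by blast
qed

lemma psum_diag_nonzero: "psum (parts a) a \<noteq> (0 :: 'a :: field_char_0)"
  using psum_of_nat[of "parts a" a, where 'a = 'a] by auto

lemma psum_indep:
  fixes c :: "expo \<Rightarrow> 'a :: field_char_0"
  assumes "finite S" "\<And>l. l \<in> S \<Longrightarrow> is_partition l"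
    and zero: "\<And>a. (\<Sum>l\<in>S. c l * psum (parts l) a) = 0" and "l \<in> S"
  shows "c l = 0"
proof (rule ccontr)
  assume "c l \<noteq> 0"
  let ?T = "{l\<in>S. c l \<noteq> 0}"
  have "finite ?T" "?T \<noteq> {}" using assms(1,4) \<open>c l \<noteq> 0\<close> by auto
  then have I: "finite ((\<lambda>k. card (kys k)) ` ?T)" "(\<lambda>k. card (kys k)) ` ?T \<noteq> {}" by simp_all
  obtain m where m: "m \<in> ?T" "Max ((\<lambda>k. card (kys k)) ` ?T) = card (kys m)"
    using Max_in[OF I] by (elim imageE)
  have max: "card (kys k) \<le> card (kys m)" if "k \<in> ?T" for k
    using Max_ge[OF I(1) imageI[OF that]] m(2) by simp
  have "(\<Sum>l\<in>S. c l * psum (parts l) m) = (\<Sum>l\<in>{m}. c l * psum (parts l) m)"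
  proof (intro sum.mono_neutral_right ballI assms(1))
    show "{m} \<subseteq> S" using m by auto
    fix k assume k: "k \<in> S - {m}"
    show "c k * psum (parts k) m = 0"
    proof (rule ccontr)
      assume nz: "c k * psum (parts k) m \<noteq> 0"
      then have "k \<in> ?T" using k by auto
      then have "card (kys k) \<le> card (kys m)" by (rule max)
      with psum_support[of "parts k" m, where 'a = 'a] nz have "parts m = parts k" by auto
      then have "m = k" using assms(2) m(1) k by (intro parts_inj_partition) auto
      with k show False by simp
    qed
  qed
  then show False using zero[of m] m(1) psum_diag_nonzero[of m, where 'a = 'a] by auto
qed

section \<open>The power sum basis\<close>

text \<open>
  Homogeneous symmetric functions of degree \<open>d\<close>.
\<close>
definition homsym :: "nat \<Rightarrow> (expo \<Rightarrow> 'a::zero) \<Rightarrow> bool" where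
  "homsym d f \<longleftrightarrow> symm f \<and> (\<forall>a. f a \<noteq> 0 \<longrightarrow> psize a = d)"

lemma homsymI:
  assumes "\<And>a b. parts a = parts b \<Longrightarrow> f a = f b" "\<And>a. f a \<noteq> 0 \<Longrightarrow> psize a = d"
  shows "homsym d f"
  unfolding homsym_def symm_def using assms by blast

lemma homsymD:
  assumes "homsym d f"
  shows "parts a = parts b \<Longrightarrow> f a = f b" "psize a \<noteq> d \<Longrightarrow> f a = 0"
  using assms unfolding homsym_def symm_def by blast+

lemma homsym_msym: "M \<in> mparts d \<Longrightarrow> homsym d (msym M)"
  by (rule homsymI) (simp_all add: msym_def mparts_def split: if_splits flip: sum_mset_parts)

lemma homsym_psum: "M \<in> mparts d \<Longrightarrow> homsym d (psum M)"
  unfolding homsym_def using psum_symm psum_degree by (fastforce simp: mparts_def)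

lemma homsym_zero: "homsym d (\<lambda>_. 0)"
  by (rule homsymI) simp_all

lemma homsym_comb:
  assumes "homsym d f" "homsym d g" "h 0 0 = 0"
  shows "homsym d (\<lambda>a. h (f a) (g a))"
proof (rule homsymI)
  fix a b assume "parts a = parts b"
  then have "f a = f b" "g a = g b" using assms homsymD(1) by blast+
  then show "h (f a) (g a) = h (f b) (g b)" by simp
next
  fix a assume *: "h (f a) (g a) \<noteq> 0"
  show "psize a = d"
  proof (rule ccontr)
    assume "psize a \<noteq> d"
    then have "f a = 0" "g a = 0" using assms homsymD(2) by blast+
    with * assms(3) show False by simp
  qed
qed

lemma homsym_add: "homsym d f \<Longrightarrow> homsym d g \<Longrightarrow> homsym d (\<lambda>a. f a + (g a :: 'a :: comm_ring_1))"
  by (rule homsym_comb) simp_all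

lemma homsym_diff: "homsym d f \<Longrightarrow> homsym d g \<Longrightarrow> homsym d (\<lambda>a. f a - (g a :: 'a :: comm_ring_1))"
  by (rule homsym_comb) simp_all

lemma homsym_cmult: "homsym d f \<Longrightarrow> homsym d (\<lambda>a. c * (f a :: 'a :: comm_ring_1))"
  using homsym_comb[of d f f "\<lambda>x y. c * x"] by simp

lemma homsym_sum: "(\<And>x. x \<in> S \<Longrightarrow> homsym d (f x)) \<Longrightarrow> homsym d (\<lambda>a. \<Sum>x\<in>S. (f x a :: 'a :: comm_ring_1))"
  by (induction S rule: infinite_finite_induct) (auto intro: homsym_zero homsym_add)

lemma homsym_expand:
  assumes "homsym d f"
  shows "f a = (\<Sum>M\<in>mparts d. f (part_of M) * (msym M a :: 'a :: comm_ring_1))"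
proof (cases "psize a = d")
  case True
  then have "(\<Sum>M\<in>mparts d. f (part_of M) * msym M a) = (\<Sum>M\<in>{parts a}. f (part_of M) * msym M a)"
    by (intro sum.mono_neutral_right) (auto simp: msym_def)
  also have "\<dots> = f (part_of (parts a))" by (simp add: msym_def)
  also have "\<dots> = f a" using assms part_of(2)[OF zero_notin_parts] unfolding homsym_def symm_def by metis
  finally show ?thesis by simp
next
  case False
  then have "f a = 0" using assms by (auto simp: homsym_def)
  moreover have "f (part_of M) * msym M a = 0" if "M \<in> mparts d" for M
    using that False by (auto simp: msym_def)
  ultimately show ?thesis by (simp add: sum.neutral)
qed

lemma psum_span_msym:
  assumes "M \<in> mparts d"
  shows "\<exists>c. \<forall>a. msym M a = (\<Sum>N\<in>mparts d. c N * (psum N a :: 'a :: field_char_0))"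
  using assms
proof (induction "size M" arbitrary: M rule: less_induct)
  case less
  have M: "0 \<notin># M" using less.prems by (simp add: mparts_def)
  let ?c = "\<lambda>N. psum M (part_of N) :: 'a"
  have cM: "?c M \<noteq> 0" using psum_diag_nonzero[of "part_of M", where 'a = 'a] part_of(2)[OF M] by simp
  have small: "size N < size M" if "N \<in> mparts d - {M}" "?c N \<noteq> 0" for N
  proof -
    have N: "parts (part_of N) = N" using that by (intro part_of) (auto simp: mparts_def)
    show ?thesis using psum_support[OF that(2)] that(1) N size_parts[of "part_of N"] by auto
  qed
  have "\<exists>c. N \<in> mparts d - {M} \<and> ?c N \<noteq> 0 \<longrightarrow> (\<forall>a. msym N a = (\<Sum>N'\<in>mparts d. c N' * (psum N' a :: 'a)))" for N
    using small less.hyps by blast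
  then obtain C where C: "\<And>N a. N \<in> mparts d - {M} \<Longrightarrow> ?c N \<noteq> 0 \<Longrightarrow> msym N a = (\<Sum>N'\<in>mparts d. C N N' * (psum N' a :: 'a))"
    by metis
  define e where "e N' = ((if N' = M then 1 else 0) - (\<Sum>N\<in>mparts d - {M}. ?c N * C N N')) / ?c M" for N'
  have "msym M a = (\<Sum>N'\<in>mparts d. e N' * (psum N' a :: 'a))" for a
  proof -
    have "(psum M a :: 'a) = (\<Sum>N\<in>mparts d. ?c N * msym N a)"
      using homsym_expand[OF homsym_psum[OF less.prems]] by blast
    also have "\<dots> = ?c M * msym M a + (\<Sum>N\<in>mparts d - {M}. ?c N * msym N a)"
      using less.prems by (subst sum.remove[of _ M]) auto
    also have "(\<Sum>N\<in>mparts d - {M}. ?c N * msym N a) = (\<Sum>N\<in>mparts d - {M}. ?c N * (\<Sum>N'\<in>mparts d. C N N' * psum N' a))"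
    proof (intro sum.cong refl)
      fix N assume "N \<in> mparts d - {M}"
      then show "?c N * msym N a = ?c N * (\<Sum>N'\<in>mparts d. C N N' * psum N' a)"
        using C[of N a] by (cases "?c N = 0") auto
    qed
    also have "\<dots> = (\<Sum>N'\<in>mparts d. (\<Sum>N\<in>mparts d - {M}. ?c N * C N N') * psum N' a)"
      by (simp add: sum_distrib_left sum_distrib_right mult.assoc) (rule sum.swap)
    finally have *: "?c M * msym M a = psum M a - (\<Sum>N'\<in>mparts d. (\<Sum>N\<in>mparts d - {M}. ?c N * C N N') * psum N' a)"
      by (simp add: algebra_simps)
    have "(\<Sum>N'\<in>mparts d. (if N' = M then 1 else 0) * psum N' a) = (\<Sum>N'\<in>{M}. (if N' = M then 1 else 0) * (psum N' a :: 'a))"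
      using less.prems by (intro sum.mono_neutral_right) auto
    then have **: "(\<Sum>N'\<in>mparts d. (if N' = M then 1 else 0) * psum N' a) = (psum M a :: 'a)" by simp
    have "(\<Sum>N'\<in>mparts d. e N' * psum N' a) = (\<Sum>N'\<in>mparts d. (if N' = M then 1 else 0) * psum N' a - (\<Sum>N\<in>mparts d - {M}. ?c N * C N N') * psum N' a) / ?c M"
      unfolding sum_divide_distrib e_def by (intro sum.cong refl) (simp add: algebra_simps diff_divide_distrib)
    also have "\<dots> = ?c M * msym M a / ?c M" unfolding sum_subtractf ** * ..
    finally show ?thesis using cM by simp
  qed
  then show ?case by blast
qed

lemma psum_span:
  assumes "homsym d f"
  shows "\<exists>c. \<forall>a. f a = (\<Sum>N\<in>mparts d. c N * (psum N a :: 'a :: field_char_0))"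
proof -
  have "\<exists>c. M \<in> mparts d \<longrightarrow> (\<forall>a. msym M a = (\<Sum>N\<in>mparts d. c N * (psum N a :: 'a)))" for M
    using psum_span_msym by blast
  then obtain C where C: "\<And>M a. M \<in> mparts d \<Longrightarrow> msym M a = (\<Sum>N\<in>mparts d. C M N * (psum N a :: 'a))"
    by metis
  have "f a = (\<Sum>N\<in>mparts d. (\<Sum>M\<in>mparts d. f (part_of M) * C M N) * psum N a)" for a
  proof -
    have "f a = (\<Sum>M\<in>mparts d. f (part_of M) * (\<Sum>N\<in>mparts d. C M N * psum N a))"
      using homsym_expand[OF assms, of a] C by simp
    also have "\<dots> = (\<Sum>N\<in>mparts d. (\<Sum>M\<in>mparts d. f (part_of M) * C M N) * psum N a)"
      by (simp add: sum_distrib_left sum_distrib_right mult.assoc) (rule sum.swap)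
    finally show ?thesis .
  qed
  then show ?thesis by (intro exI allI)
qed

lemma inj_part_of: "inj_on part_of (mparts d)"
  by (rule inj_onI) (metis (mono_tags, lifting) mparts_def mem_Collect_eq part_of(2))

lemma power_coeffs_unique:
  assumes "power_expansion f c" shows "power_coeffs f = c"
proof -
  have *: "c' = c" if "power_expansion f c'" for c'
  proof
    fix l
    let ?S = "{l. c l \<noteq> 0} \<union> {l. c' l \<noteq> 0}"
    have fin: "finite ?S" and part: "\<And>l. l \<in> ?S \<Longrightarrow> is_partition l"
      using assms that unfolding power_expansion_def by auto
    have e: "(\<Sum>l\<in>?S. e l * psum (parts l) a) = f a" if "power_expansion f e" "{l. e l \<noteq> 0} \<subseteq> ?S" for e a
    proof -
      have "f a = (\<Sum>l | e l \<noteq> 0. e l * power_sf l a)" using that(1) by (simp add: power_expansion_def)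
      also have "\<dots> = (\<Sum>l\<in>?S. e l * power_sf l a)"
        using fin that(2) by (intro sum.mono_neutral_left) auto
      also have "\<dots> = (\<Sum>l\<in>?S. e l * psum (parts l) a)"
        using part by (intro sum.cong) (auto simp: power_sf_eq)
      finally show ?thesis ..
    qed
    have "(\<Sum>l\<in>?S. (c l - c' l) * psum (parts l) a) = 0" for a
      using e[OF assms, of a] e[OF that, of a] by (simp add: left_diff_distrib sum_subtractf)
    then have "l \<in> ?S \<Longrightarrow> c l - c' l = 0"
      using psum_indep[of ?S "\<lambda>l. c l - c' l" l] fin part by blast
    then show "c' l = c l" by (cases "l \<in> ?S") auto
  qed
  show ?thesis unfolding power_coeffs_def by (rule the_equality[where P = "power_expansion f", OF assms *])
qed

lemma power_coeffs_psum:
  assumes "\<And>a. f a = (\<Sum>M\<in>mparts d. c M * psum M a)"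
  shows "power_coeffs f = (\<lambda>l. if is_partition l \<and> psize l = d then c (parts l) else 0)"
proof (rule power_coeffs_unique)
  let ?e = "\<lambda>l. if is_partition l \<and> psize l = d then c (parts l) else 0"
  have sub: "{l. ?e l \<noteq> 0} \<subseteq> part_of ` mparts d"
  proof
    fix l assume "l \<in> {l. ?e l \<noteq> 0}"
    then have "is_partition l" "psize l = d" by (auto split: if_splits)
    then have "l = part_of (parts l)" "parts l \<in> mparts d" by (simp_all add: part_of_parts)
    then show "l \<in> part_of ` mparts d" by blast
  qed
  have "f a = (\<Sum>l | ?e l \<noteq> 0. ?e l * power_sf l a)" for a
  proof -
    have "(\<Sum>l | ?e l \<noteq> 0. ?e l * power_sf l a) = (\<Sum>l\<in>part_of ` mparts d. ?e l * power_sf l a)"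
      using sub by (intro sum.mono_neutral_left) auto
    also have "\<dots> = (\<Sum>M\<in>mparts d. ?e (part_of M) * power_sf (part_of M) a)"
      by (subst sum.reindex[OF inj_part_of]) simp
    also have "\<dots> = (\<Sum>M\<in>mparts d. c M * psum M a)"
    proof (intro sum.cong refl)
      fix M assume M: "M \<in> mparts d"
      then have p: "is_partition (part_of M)" "parts (part_of M) = M" using part_of by (auto simp: mparts_def)
      then have "psize (part_of M) = d" using M by (metis parts_in_mparts)
      then show "?e (part_of M) * power_sf (part_of M) a = c M * psum M a" using p by (simp add: power_sf_eq)
    qed
    finally show ?thesis using assms by simp
  qed
  moreover have "finite {l. ?e l \<noteq> 0}" by (rule finite_subset[OF sub]) simp
  moreover have "{l. ?e l \<noteq> 0} \<subseteq> Collect is_partition" by auto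
  ultimately show "power_expansion f ?e" unfolding power_expansion_def by blast
qed

section \<open>The scalar product in power sum coordinates\<close>

text \<open>
  The coordinate of \<open>f\<close> at the product of power sums \<open>p\<^sub>M\<close>.
\<close>
definition pcoef :: "symfun \<Rightarrow> nat multiset \<Rightarrow> ratfun" where
  "pcoef f M = power_coeffs f (part_of M)"

lemma pcoef_unique:
  assumes "\<And>a. f a = (\<Sum>M\<in>mparts d. c M * psum M a)" "M \<in> mparts d"
  shows "pcoef f M = c M"
proof -
  have "is_partition (part_of M)" "parts (part_of M) = M" using part_of assms(2) by (auto simp: mparts_def)
  then show ?thesis using assms(2) by (simp add: pcoef_def power_coeffs_psum[OF assms(1)] flip: parts_in_mparts)
qed

lemma pcoef_expand:
  assumes "homsym d f" shows "f a = (\<Sum>M\<in>mparts d. pcoef f M * psum M a)"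
proof -
  from psum_span[OF assms] obtain c where c: "\<forall>a. f a = (\<Sum>N\<in>mparts d. c N * psum N a)" by (rule exE)
  note c = c[rule_format]
  have "f a = (\<Sum>N\<in>mparts d. c N * psum N a)" by (rule c)
  also have "\<dots> = (\<Sum>M\<in>mparts d. pcoef f M * psum M a)"
    by (intro sum.cong refl) (simp add: pcoef_unique[OF c])
  finally show ?thesis .
qed

lemma pcoef_add:
  assumes "homsym d f" "homsym d g" "M \<in> mparts d"
  shows "pcoef (\<lambda>a. f a + g a) M = pcoef f M + pcoef g M"
proof (rule pcoef_unique[OF _ assms(3)])
  show "f a + g a = (\<Sum>M\<in>mparts d. (pcoef f M + pcoef g M) * psum M a)" for a
    unfolding pcoef_expand[OF assms(1), of a] pcoef_expand[OF assms(2), of a]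
    by (simp add: distrib_right sum.distrib)
qed

lemma pcoef_cmult:
  assumes "homsym d f" "M \<in> mparts d"
  shows "pcoef (\<lambda>a. c * f a) M = c * pcoef f M"
proof (rule pcoef_unique[OF _ assms(2)])
  show "c * f a = (\<Sum>M\<in>mparts d. c * pcoef f M * psum M a)" for a
    unfolding pcoef_expand[OF assms(1), of a] by (simp add: mult.assoc sum_distrib_left)
qed

text \<open>
  The squared norm of \<open>p\<^sub>M\<close> in the scalar product.
\<close>
definition wt :: "nat multiset \<Rightarrow> ratfun" where
  "wt M = of_nat (\<Prod>i\<in>set_mset M. i ^ count M i * fact (count M i)) / theta ^ size M"

lemma zpart_parts: "zpart l = (\<Prod>i\<in>set_mset (parts l). i ^ count (parts l) i * fact (count (parts l) i))"
proof -
  have s: "set_mset (parts l) = lkp l ` kys l" by (simp add: parts_def)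
  show ?thesis unfolding zpart_def s
  proof (intro prod.cong refl)
    fix i assume "i \<in> lkp l ` kys l"
    then have "i > 0" by (auto simp: in_keys_iff)
    then have "count (parts l) i = part_mult i l" by (simp add: count_parts part_mult_def)
    then show "i ^ part_mult i l * fact (part_mult i l) = i ^ count (parts l) i * fact (count (parts l) i)" by simp
  qed
qed

lemma power_pairing_parts: "power_pairing l l = wt (parts l)"
  by (simp add: power_pairing_def wt_def zpart_parts plength_def)

lemma wt_add: "theta * wt (add_mset r M) = of_nat (r * Suc (count M r)) * wt M"
proof -
  have t: "theta \<noteq> 0" by (simp add: theta_def Zero_fract_def eq_fract)
  let ?f = "\<lambda>M i. i ^ count M i * fact (count M i) :: nat"
  have "(\<Prod>i\<in>set_mset (add_mset r M). ?f (add_mset r M) i)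
      = ?f (add_mset r M) r * (\<Prod>i\<in>set_mset M - {r}. ?f (add_mset r M) i)"
    by (subst prod.remove[of _ r]) (auto simp: insert_Diff_if)
  also have "(\<Prod>i\<in>set_mset M - {r}. ?f (add_mset r M) i) = (\<Prod>i\<in>set_mset M - {r}. ?f M i)"
    by (intro prod.cong) auto
  also have "?f (add_mset r M) r = r * Suc (count M r) * ?f M r" by (simp add: algebra_simps)
  also have "r * Suc (count M r) * ?f M r * (\<Prod>i\<in>set_mset M - {r}. ?f M i) = r * Suc (count M r) * (\<Prod>i\<in>set_mset M. ?f M i)"
  proof (cases "r \<in># M")
    case True then show ?thesis by (subst prod.remove[of _ r "?f M"]) auto
  next
    case False then show ?thesis by (simp add: not_in_iff)
  qed
  finally have "(\<Prod>i\<in>set_mset (add_mset r M). ?f (add_mset r M) i) = r * Suc (count M r) * (\<Prod>i\<in>set_mset M. ?f M i)" .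
  then show ?thesis unfolding wt_def using t by simp
qed

text \<open>
  Polynomials are ordered by the sign of the leading coefficient, and this order extends to the field
  of fractions.
\<close>
lemma theta_pos: "theta > 0"
proof -
  have "(0 :: rat poly) < [:0, 1:]" "(0 :: rat poly) < 1"
    by (simp_all add: less_poly_def pos_poly_pCons one_pCons)
  then show ?thesis unfolding theta_def by (simp add: zero_less_Fract_iff)
qed

lemma wt_pos: "M \<in> mparts d \<Longrightarrow> wt M > 0"
proof -
  assume "M \<in> mparts d"
  then have "(\<Prod>i\<in>set_mset M. i ^ count M i * fact (count M i)) > 0"
    by (intro prod_pos) (auto simp: mparts_def intro!: Nat.gr0I)
  then show ?thesis unfolding wt_def using theta_pos by (intro divide_pos_pos) (simp_all only: of_nat_0_less_iff zero_less_power)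
qed

lemma jack_inner_eq:
  assumes "homsym d f" "homsym d g"
  shows "jack_inner f g = (\<Sum>M\<in>mparts d. pcoef f M * pcoef g M * wt M)"
proof -
  have pc: "power_coeffs h = (\<lambda>l. if is_partition l \<and> psize l = d then pcoef h (parts l) else 0)"
    if "homsym d h" for h using pcoef_expand[OF that] by (rule power_coeffs_psum)
  have sub: "{l. power_coeffs h l \<noteq> 0} \<subseteq> part_of ` mparts d" if "homsym d h" for h
  proof
    fix l assume "l \<in> {l. power_coeffs h l \<noteq> 0}"
    then have "is_partition l" "psize l = d" by (auto simp: pc[OF that] split: if_splits)
    then have "l = part_of (parts l)" "parts l \<in> mparts d" by (simp_all add: part_of_parts)
    then show "l \<in> part_of ` mparts d" by blast
  qed
  have fin: "finite (part_of ` mparts d)" by simp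
  have "jack_inner f g = (\<Sum>l | power_coeffs f l \<noteq> 0. \<Sum>m\<in>part_of ` mparts d.
      power_coeffs f l * power_coeffs g m * power_pairing l m)"
    unfolding jack_inner_def using sub[OF assms(2)] fin
    by (intro sum.cong refl sum.mono_neutral_left) auto
  also have "\<dots> = (\<Sum>l\<in>part_of ` mparts d. \<Sum>m\<in>part_of ` mparts d.
      power_coeffs f l * power_coeffs g m * power_pairing l m)"
    using sub[OF assms(1)] fin by (intro sum.mono_neutral_left) auto
  also have "\<dots> = (\<Sum>l\<in>part_of ` mparts d. power_coeffs f l * power_coeffs g l * power_pairing l l)"
  proof (intro sum.cong refl)
    fix l assume "l \<in> part_of ` mparts d"
    then have "(\<Sum>m\<in>part_of ` mparts d. power_coeffs f l * power_coeffs g m * power_pairing l m) =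
      (\<Sum>m\<in>{l}. power_coeffs f l * power_coeffs g m * power_pairing l m)"
      by (intro sum.mono_neutral_right) (auto simp: power_pairing_def)
    then show "(\<Sum>m\<in>part_of ` mparts d. power_coeffs f l * power_coeffs g m * power_pairing l m) =
      power_coeffs f l * power_coeffs g l * power_pairing l l" by simp
  qed
  also have "\<dots> = (\<Sum>M\<in>mparts d. pcoef f M * pcoef g M * power_pairing (part_of M) (part_of M))"
    by (subst sum.reindex[OF inj_part_of]) (simp add: pcoef_def)
  also have "\<dots> = (\<Sum>M\<in>mparts d. pcoef f M * pcoef g M * wt M)"
    by (intro sum.cong refl) (auto simp: power_pairing_parts part_of mparts_def)
  finally show ?thesis .
qed

lemma jack_inner_diff_degree:
  assumes "homsym d f" "homsym e g" "d \<noteq> e" shows "jack_inner f g = 0"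
proof -
  have pc: "power_coeffs h = (\<lambda>l. if is_partition l \<and> psize l = d then pcoef h (parts l) else 0)"
    if "homsym d h" for h d using pcoef_expand[OF that] by (rule power_coeffs_psum)
  show ?thesis unfolding jack_inner_def pc[OF assms(1)] pc[OF assms(2)]
    using assms(3) by (intro sum.neutral ballI) (auto simp: power_pairing_def split: if_splits)
qed

lemma jack_inner_commute:
  assumes "homsym d f" "homsym d g" shows "jack_inner f g = jack_inner g f"
  by (simp add: jack_inner_eq[OF assms] jack_inner_eq[OF assms(2,1)] mult.commute)

lemma jack_inner_add_right:
  assumes "homsym d f" "homsym d g" "homsym d h"
  shows "jack_inner f (\<lambda>a. g a + h a) = jack_inner f g + jack_inner f h"
  by (simp add: jack_inner_eq[OF assms(1) homsym_add[OF assms(2,3)]] jack_inner_eq[OF assms(1,2)] jack_inner_eq[OF assms(1,3)]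
      pcoef_add[OF assms(2,3)] algebra_simps sum.distrib cong: sum.cong)

lemma jack_inner_cmult_right:
  assumes "homsym d f" "homsym d g"
  shows "jack_inner f (\<lambda>a. c * g a) = c * jack_inner f g"
  by (simp add: jack_inner_eq[OF assms(1) homsym_cmult[OF assms(2)]] jack_inner_eq[OF assms]
      pcoef_cmult[OF assms(2)] sum_distrib_left ac_simps cong: sum.cong)

lemma jack_inner_sum_right:
  assumes "homsym d f" "finite S" "\<And>x. x \<in> S \<Longrightarrow> homsym d (g x)"
  shows "jack_inner f (\<lambda>a. \<Sum>x\<in>S. c x * g x a) = (\<Sum>x\<in>S. c x * jack_inner f (g x))"
  using assms(2,3)
proof (induction S rule: finite_induct)
  case empty
  have "pcoef (\<lambda>a. 0) M = 0" if "M \<in> mparts d" for M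
    by (rule pcoef_unique[where d = d and c = "\<lambda>_. 0", OF _ that]) simp
  then show ?case by (simp add: jack_inner_eq[OF assms(1) homsym_zero])
next
  case (insert x S)
  have 1: "homsym d (\<lambda>a. c x * g x a)" "homsym d (\<lambda>a. \<Sum>x\<in>S. c x * g x a)"
    using insert.prems by (auto intro!: homsym_cmult homsym_sum)
  show ?case using insert jack_inner_add_right[OF assms(1) 1] jack_inner_cmult_right[OF assms(1), of "g x" "c x"]
    by simp
qed

text \<open>
  In power sum coordinates \<open>jack_inner f f\<close> is a sum of squares with positive weights in an ordered
  field.
\<close>
lemma jack_inner_self_zero:
  assumes "homsym d f" "jack_inner f f = 0" shows "f a = 0"
proof -
  have "\<forall>M\<in>mparts d. pcoef f M * pcoef f M * wt M = 0"
  proof -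
    have "0 \<le> pcoef f M * pcoef f M * wt M" if "M \<in> mparts d" for M
      by (intro mult_nonneg_nonneg zero_le_square less_imp_le wt_pos[OF that])
    then show ?thesis
      using assms(2) unfolding jack_inner_eq[OF assms(1,1)] by (subst (asm) sum_nonneg_eq_0_iff) auto
  qed
  then have "\<forall>M\<in>mparts d. pcoef f M = 0"
    using wt_pos by (metis less_irrefl mult_eq_0_iff)
  then show ?thesis using pcoef_expand[OF assms(1), of a] by simp
qed

section \<open>The Dunkl operator\<close>

text \<open>
  Exchange of the variables \<open>i\<close> and \<open>j\<close>.
\<close>
definition swp :: "nat \<Rightarrow> nat \<Rightarrow> expo \<Rightarrow> expo" where
  "swp i j a = Poly_Mapping.map_key (transpose i j) a"

lemma lkp_swp: "lkp (swp i j a) k = lkp a (transpose i j k)"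
  by (simp add: swp_def map_key.rep_eq)

lemma parts_swp [simp]: "parts (swp i j a) = parts a"
  by (rule parts_eq_bij[where \<pi> = "transpose i j"]) (simp_all add: lkp_swp)

text \<open>
  The Dunkl operator
  \<open>x\<^sub>i \<partial>\<^sub>i + t \<Sum>\<^sub>j x\<^sub>j / (x\<^sub>i - x\<^sub>j) (1 - s\<^sub>i\<^sub>j)\<close> in infinitely many variables, where \<open>s\<^sub>i\<^sub>j\<close> exchanges \<open>x\<^sub>i\<close> and \<open>x\<^sub>j\<close>.
  For a series \<open>h\<close> that is divisible by \<open>x\<^sub>i - x\<^sub>j\<close>, the coefficient of \<open>x\<^sub>j / (x\<^sub>i - x\<^sub>j) h\<close> at \<open>b\<close> is the sum of
  the coefficients of \<open>h\<close> at \<open>b + r e\<^sub>i - r e\<^sub>j\<close> over \<open>r = 1, \<dots>, b\<^sub>j\<close>; in particular only the finitely many \<open>j\<close>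
  that occur in \<open>b\<close> contribute.
\<close>
definition dunkl :: "'a::comm_ring_1 \<Rightarrow> nat \<Rightarrow> (expo \<Rightarrow> 'a) \<Rightarrow> expo \<Rightarrow> 'a" where
  "dunkl t i g b = of_nat (lkp b i) * g b + t * (\<Sum>j\<in>kys b - {i}. \<Sum>r\<in>{1..lkp b j}.
     g (b + sgl i r - sgl j r) - g (swp i j (b + sgl i r - sgl j r)))"

text \<open>
  Multiplication by \<open>x\<^sub>i\<^sup>a\<close>.
\<close>
definition xmul :: "nat \<Rightarrow> nat \<Rightarrow> (expo \<Rightarrow> 'a::comm_ring_1) \<Rightarrow> expo \<Rightarrow> 'a" where
  "xmul i a f b = (if a \<le> lkp b i then f (b - sgl i a) else 0)"

lemma xmul_0 [simp]: "xmul i 0 f = f"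
  by (rule ext) (simp add: xmul_def)

text \<open>
  The coefficientwise form of \<open>x\<^sub>j (x\<^sub>i\<^sup>a - x\<^sub>j\<^sup>a) / (x\<^sub>i - x\<^sub>j) = \<Sum>\<^sub>s x\<^sub>i\<^bsup>a-s\<^esup> x\<^sub>j\<^sup>s\<close>, the sum ranging over
  \<open>s = 1, \<dots>, a\<close>: the two sums on the left overlap except for \<open>r \<le> a\<close>.
\<close>
lemma exchange_sum:
  fixes \<phi> :: "nat \<Rightarrow> nat \<Rightarrow> 'a::comm_ring_1"
  assumes sym: "\<And>u v. \<phi> u v = \<phi> v u"
  shows "(\<Sum>r\<in>{1..q}. (if a \<le> p + r then \<phi> (p + r - a) (q - r) else 0)
            - (if a \<le> q - r then \<phi> (q - r - a) (p + r) else 0))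
       = (\<Sum>s\<in>{1..a}. if s \<le> q \<and> a \<le> p + s then \<phi> (p + s - a) (q - s) else 0)"
proof -
  define A where "A r = (if a \<le> p + r then \<phi> (p + r - a) (q - r) else 0)" for r
  have "(\<Sum>r\<in>{1..q}. if a \<le> q - r then \<phi> (q - r - a) (p + r) else 0)
      = (\<Sum>r | r \<in> {1..q} \<and> a \<le> q - r. \<phi> (q - r - a) (p + r))"
    by (subst sum.inter_filter[symmetric]) simp_all
  also have "\<dots> = (\<Sum>r | r \<in> {1..q} \<and> a < r. A r)"
  proof (cases "a \<le> q")
    case True
    then show ?thesis
      by (intro sum.reindex_bij_witness[of _ "\<lambda>r. r - a" "\<lambda>r. r + a"])
        (auto simp: A_def sym ac_simps)
  next
    case False
    then have e: "{r. r \<in> {1..q} \<and> a \<le> q - r} = {}" "{r. r \<in> {1..q} \<and> a < r} = {}" by auto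
    show ?thesis unfolding e by simp
  qed
  finally have 1: "(\<Sum>r\<in>{1..q}. if a \<le> q - r then \<phi> (q - r - a) (p + r) else 0)
    = (\<Sum>r | r \<in> {1..q} \<and> a < r. A r)" .
  have "(\<Sum>r\<in>{1..q}. A r) = (\<Sum>r | r \<in> {1..q} \<and> r \<le> a. A r) + (\<Sum>r | r \<in> {1..q} \<and> a < r. A r)"
    by (subst sum.union_disjoint[symmetric]) (auto intro!: sum.cong)
  moreover have "(\<Sum>r | r \<in> {1..q} \<and> r \<le> a. A r)
     = (\<Sum>s\<in>{1..a}. if s \<le> q \<and> a \<le> p + s then \<phi> (p + s - a) (q - s) else 0)"
    by (intro sum.mono_neutral_cong_left) (auto simp: A_def)
  ultimately show ?thesis unfolding sum_subtractf 1 A_def[symmetric] by simp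
qed

lemma dunkl_xmul:
  assumes "symm f"
  shows "dunkl t i (xmul i a f) b = of_nat (lkp b i) * xmul i a f b
    + t * ((\<Sum>s\<in>{1..a}. xmul i (a - s) (pmul s f) b) - of_nat a * xmul i a f b)"
proof -
  have inner: "(\<Sum>r\<in>{1..lkp b j}. xmul i a f (b + sgl i r - sgl j r) - xmul i a f (swp i j (b + sgl i r - sgl j r)))
     = (\<Sum>s\<in>{1..a}. if s \<le> lkp b j \<and> a \<le> lkp b i + s then f (b - sgl i (a - s) - sgl j s) else 0)"
    if j: "j \<in> kys b - {i}" for j
  proof -
    have ij: "i \<noteq> j" using j by auto
    let ?p = "lkp b i" and ?q = "lkp b j"
    define w where "w u v = b - sgl i ?p - sgl j ?q + sgl i u + sgl j v" for u v
    have lw: "lkp (w u v) k = (if k = i then u else if k = j then v else lkp b k)" for u v k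
      using ij by (auto simp: w_def lkp_diff_single lkp_add_single)
    have sym: "f (w u v) = f (w v u)" for u v
    proof (rule symmD[OF assms])
      have "swp i j (w v u) = w u v"
        using ij by (intro poly_mapping_eqI) (auto simp: lkp_swp lw transpose_def)
      then show "parts (w u v) = parts (w v u)" using parts_swp by metis
    qed
    have 1: "xmul i a f (b + sgl i r - sgl j r) = (if a \<le> ?p + r then f (w (?p + r - a) (?q - r)) else 0)" for r
    proof -
      have "b + sgl i r - sgl j r - sgl i a = w (?p + r - a) (?q - r)"
        using ij by (intro poly_mapping_eqI) (auto simp: lw lkp_diff_single lkp_add_single)
      then show ?thesis using ij by (simp add: xmul_def lkp_diff_single lkp_add_single)
    qed
    have 2: "xmul i a f (swp i j (b + sgl i r - sgl j r)) = (if a \<le> ?q - r then f (w (?q - r - a) (?p + r)) else 0)" for r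
    proof -
      have "swp i j (b + sgl i r - sgl j r) - sgl i a = w (?q - r - a) (?p + r)"
        using ij by (intro poly_mapping_eqI) (auto simp: lw lkp_swp lkp_diff_single lkp_add_single transpose_def)
      then show ?thesis using ij by (simp add: xmul_def lkp_swp lkp_diff_single lkp_add_single)
    qed
    have 3: "w (?p + s - a) (?q - s) = b - sgl i (a - s) - sgl j s" if "s \<le> a" "s \<le> ?q" "a \<le> ?p + s" for s
      using ij that by (intro poly_mapping_eqI) (auto simp: lw lkp_diff_single)
    have "(\<Sum>r\<in>{1..?q}. xmul i a f (b + sgl i r - sgl j r) - xmul i a f (swp i j (b + sgl i r - sgl j r)))
      = (\<Sum>s\<in>{1..a}. if s \<le> ?q \<and> a \<le> ?p + s then f (w (?p + s - a) (?q - s)) else 0)"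
      unfolding 1 2 by (rule exchange_sum) (rule sym)
    also have "\<dots> = (\<Sum>s\<in>{1..a}. if s \<le> ?q \<and> a \<le> ?p + s then f (b - sgl i (a - s) - sgl j s) else 0)"
      using 3 by (intro sum.cong refl) auto
    finally show ?thesis .
  qed
  have outer: "xmul i (a - s) (pmul s f) b = xmul i a f b +
      (\<Sum>j\<in>kys b - {i}. if s \<le> lkp b j \<and> a \<le> lkp b i + s then f (b - sgl i (a - s) - sgl j s) else 0)"
    if s: "s \<in> {1..a}" for s
  proof (cases "a - s \<le> lkp b i")
    case False
    then have "\<not> a \<le> lkp b i + s" "\<not> a \<le> lkp b i" using s by auto
    then show ?thesis using False by (simp add: xmul_def)
  next
    case True
    let ?b = "b - sgl i (a - s)"
    have "xmul i (a - s) (pmul s f) b = (\<Sum>j | 0 < s \<and> s \<le> lkp ?b j. f (?b - sgl j s))"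
      using True by (simp add: xmul_def pmul_def)
    also have "\<dots> = (\<Sum>j\<in>insert i (kys b - {i}). if s \<le> lkp ?b j then f (?b - sgl j s) else 0)"
      using s by (intro sum.mono_neutral_cong_left)
        (auto simp: in_keys_iff lkp_diff_single split: if_splits)
    also have "\<dots> = (if s \<le> lkp ?b i then f (?b - sgl i s) else 0)
        + (\<Sum>j\<in>kys b - {i}. if s \<le> lkp ?b j then f (?b - sgl j s) else 0)"
      by (subst sum.insert) auto
    also have "(if s \<le> lkp ?b i then f (?b - sgl i s) else 0) = xmul i a f b"
    proof -
      have "?b - sgl i s = b - sgl i a"
        using s by (intro poly_mapping_eqI) (auto simp: lkp_diff_single)
      moreover have "s \<le> lkp ?b i \<longleftrightarrow> a \<le> lkp b i" using s True by (auto simp: lkp_diff_single)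
      ultimately show ?thesis by (simp add: xmul_def)
    qed
    also have "(\<Sum>j\<in>kys b - {i}. if s \<le> lkp ?b j then f (?b - sgl j s) else 0) =
      (\<Sum>j\<in>kys b - {i}. if s \<le> lkp b j \<and> a \<le> lkp b i + s then f (?b - sgl j s) else 0)"
      using True by (intro sum.cong refl) (auto simp: lkp_diff_single)
    finally show ?thesis .
  qed
  have "(\<Sum>s\<in>{1..a}. xmul i (a - s) (pmul s f) b) = of_nat a * xmul i a f b +
     (\<Sum>s\<in>{1..a}. \<Sum>j\<in>kys b - {i}. if s \<le> lkp b j \<and> a \<le> lkp b i + s then f (b - sgl i (a - s) - sgl j s) else 0)"
    by (subst sum.cong[OF refl outer]) (simp_all add: sum.distrib)
  also have "(\<Sum>s\<in>{1..a}. \<Sum>j\<in>kys b - {i}. if s \<le> lkp b j \<and> a \<le> lkp b i + s then f (b - sgl i (a - s) - sgl j s) else 0)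
     = (\<Sum>j\<in>kys b - {i}. \<Sum>r\<in>{1..lkp b j}. xmul i a f (b + sgl i r - sgl j r) - xmul i a f (swp i j (b + sgl i r - sgl j r)))"
    by (subst sum.swap) (intro sum.cong refl inner[symmetric])
  finally show ?thesis by (simp add: dunkl_def)
qed

lemma pmul_xmul: "pmul s (xmul i r f) = xmul i r (pmul s f)"
proof (rule ext)
  fix b
  show "pmul s (xmul i r f) b = xmul i r (pmul s f) b"
  proof (cases "r \<le> lkp b i")
    case True
    have "pmul s (xmul i r f) b = (\<Sum>j | 0 < s \<and> s \<le> lkp b j \<and> r \<le> lkp (b - sgl j s) i. f (b - sgl j s - sgl i r))"
      unfolding pmul_def xmul_def
      by (subst sum.inter_filter[symmetric]) (auto intro!: sum.cong simp: conj_assoc)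
    also have "\<dots> = (\<Sum>j | 0 < s \<and> s \<le> lkp (b - sgl i r) j. f (b - sgl i r - sgl j s))"
    proof (rule sum.cong)
      show "{j. 0 < s \<and> s \<le> lkp b j \<and> r \<le> lkp (b - sgl j s) i} = {j. 0 < s \<and> s \<le> lkp (b - sgl i r) j}"
        using True by (auto simp: lkp_diff_single split: if_splits)
      fix j
      have "b - sgl j s - sgl i r = b - sgl i r - sgl j s"
        by (intro poly_mapping_eqI) (simp add: lookup_minus)
      then show "f (b - sgl j s - sgl i r) = f (b - sgl i r - sgl j s)" by simp
    qed
    finally show ?thesis using True by (simp add: xmul_def pmul_def)
  next
    case False
    then have "xmul i r f (b - sgl j s) = 0" for j by (simp add: xmul_def lkp_diff_single)
    then show ?thesis using False by (simp add: pmul_def) (simp add: xmul_def)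
  qed
qed

text \<open>
  The derivation \<open>x\<^sub>i \<partial>\<^sub>i\<close> sends \<open>p\<^sub>r\<close> to \<open>r x\<^sub>i\<^sup>r\<close>.
\<close>
lemma euler_psum:
  assumes "0 \<notin># M"
  shows "of_nat (lkp b i) * psum M b = (\<Sum>r\<in>#M. of_nat r * xmul i r (psum (M - {#r#})) b)"
  using assms
proof (induction M arbitrary: b)
  case empty
  show ?case by (auto simp: psum_empty)
next
  let ?P = "psum :: nat multiset \<Rightarrow> expo \<Rightarrow> 'a"
  case (add s M)
  then have s: "0 < s" and IH: "\<And>b. of_nat (lkp b i) * ?P M b = (\<Sum>r\<in>#M. of_nat r * xmul i r (?P (M - {#r#})) b)"
    by auto
  have "of_nat (lkp b i) * ?P (add_mset s M) b = (\<Sum>j | 0 < s \<and> s \<le> lkp b j. of_nat (lkp b i) * ?P M (b - sgl j s))"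
    by (simp add: psum_add pmul_def sum_distrib_left)
  also have "\<dots> = (\<Sum>j | 0 < s \<and> s \<le> lkp b j. of_nat (lkp (b - sgl j s) i) * ?P M (b - sgl j s)
      + (if j = i then of_nat s * ?P M (b - sgl i s) else 0))"
    by (intro sum.cong refl) (auto simp: lkp_diff_single of_nat_diff algebra_simps)
  also have "\<dots> = pmul s (\<lambda>b. of_nat (lkp b i) * ?P M b) b + of_nat s * xmul i s (?P M) b"
    using s unfolding sum.distrib sum.delta[OF finite_pmul_set] by (simp add: pmul_def xmul_def)
  also have "pmul s (\<lambda>b. of_nat (lkp b i) * ?P M b) b = (\<Sum>r\<in>#M. of_nat r * xmul i r (?P (add_mset s M - {#r#})) b)"
  proof -
    have "pmul s (\<lambda>b. \<Sum>r\<in>#N. of_nat r * F r b) b = (\<Sum>r\<in>#N. of_nat r * pmul s (F r) b)" for N and F :: "nat \<Rightarrow> expo \<Rightarrow> 'a"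
      by (induction N) (simp_all add: pmul_def sum.distrib sum_distrib_left)
    then have "pmul s (\<lambda>b. of_nat (lkp b i) * ?P M b) b = (\<Sum>r\<in>#M. of_nat r * pmul s (xmul i r (?P (M - {#r#}))) b)"
      unfolding IH .
    also have "\<dots> = (\<Sum>r\<in>#M. of_nat r * xmul i r (?P (add_mset s M - {#r#})) b)"
      by (intro arg_cong[where f = sum_mset] image_mset_cong) (auto simp: pmul_xmul psum_add)
    finally show ?thesis .
  qed
  finally show ?case by (simp add: add.commute)
qed

lemma sum_mset_count: "(\<Sum>x\<in>#M. f x) = (\<Sum>x\<in>set_mset M. of_nat (count M x) * (f x :: 'a::comm_semiring_1))"
proof (induction M)
  case (add y M)
  have *: "(\<Sum>x\<in>set_mset M. of_nat (count M x) * f x) = (\<Sum>x\<in>insert y (set_mset M). of_nat (count M x) * f x)"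
    by (intro sum.mono_neutral_left) (auto simp: not_in_iff)
  have "(\<Sum>x\<in>insert y (set_mset M). of_nat (count (add_mset y M) x) * f x) =
     (\<Sum>x\<in>insert y (set_mset M). of_nat (count M x) * f x + (if x = y then f y else 0))"
    by (intro sum.cong) (auto simp: algebra_simps)
  then show ?case using add * by (simp add: sum.distrib sum.delta add.commute)
qed simp

text \<open>
  The indices \<open>(a, M)\<close> of the products \<open>x\<^sub>i\<^sup>a p\<^sub>M\<close> of degree \<open>d\<close>.
\<close>
definition xpairs :: "nat \<Rightarrow> (nat \<times> nat multiset) set" where
  "xpairs d = {(a, M). 0 \<notin># M \<and> a + \<Sum>\<^sub># M = d}"

lemma finite_xpairs [simp]: "finite (xpairs d)"
proof (rule finite_subset)
  show "xpairs d \<subseteq> {..d} \<times> (\<Union>e\<le>d. mparts e)" by (auto simp: xpairs_def mparts_def)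
qed simp

text \<open>
  The product \<open>x\<^sub>i\<^sup>a p\<^sub>M\<close> for \<open>x = (a, M)\<close>.
\<close>
definition xpsum :: "nat \<Rightarrow> nat \<times> nat multiset \<Rightarrow> expo \<Rightarrow> 'a::comm_ring_1" where
  "xpsum i x = xmul i (fst x) (psum (snd x))"

text \<open>
  The matrix of the Dunkl operator in the basis \<open>x\<^sub>i\<^sup>a p\<^sub>M\<close>. A factor \<open>p\<^sub>r\<close> can be turned into
  \<open>x\<^sub>i\<^sup>r\<close> by the derivation, and a factor \<open>x\<^sub>i\<^sup>r\<close> into \<open>p\<^sub>r\<close> by the difference part; these two moves are
  adjoint to each other.
\<close>
definition kern :: "'a::comm_ring_1 \<Rightarrow> nat \<times> nat multiset \<Rightarrow> nat \<times> nat multiset \<Rightarrow> 'a" where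
  "kern t y x = (if y = x then of_nat (fst x) * (1 - t) else 0)
    + (if fst x < fst y \<and> snd x = add_mset (fst y - fst x) (snd y)
       then of_nat ((fst y - fst x) * count (snd x) (fst y - fst x)) else 0)
    + (if fst y < fst x \<and> snd y = add_mset (fst x - fst y) (snd x) then t else 0)"

lemma xmul_xmul: "xmul i a (xmul i r f) = xmul i (a + r) f"
proof (rule ext)
  fix b
  have "b - sgl i a - sgl i r = b - sgl i (a + r)"
    by (intro poly_mapping_eqI) (simp add: lkp_diff_single)
  then show "xmul i a (xmul i r f) b = xmul i (a + r) f b"
    by (auto simp: xmul_def lkp_diff_single)
qed

lemma euler_xpsum:
  assumes "0 \<notin># M"
  shows "of_nat (lkp b i) * xmul i a (psum M) b = of_nat a * xmul i a (psum M) b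
     + (\<Sum>r\<in>#M. of_nat r * xmul i (a + r) (psum (M - {#r#})) b)"
proof (cases "a \<le> lkp b i")
  case True
  let ?b = "b - sgl i a"
  have "of_nat (lkp b i) * psum M ?b = of_nat a * psum M ?b + of_nat (lkp ?b i) * (psum M ?b :: 'a)"
    using True by (simp add: lkp_diff_single of_nat_diff algebra_simps)
  also have "of_nat (lkp ?b i) * (psum M ?b :: 'a) = (\<Sum>r\<in>#M. of_nat r * xmul i r (psum (M - {#r#})) ?b)"
    by (rule euler_psum[OF assms])
  also have "\<dots> = (\<Sum>r\<in>#M. of_nat r * xmul i (a + r) (psum (M - {#r#})) b)"
    using True by (intro arg_cong[where f = sum_mset] image_mset_cong)
      (simp add: xmul_xmul[symmetric, of i a] xmul_def[of i a])
  finally show ?thesis using True by (simp add: xmul_def[of i a])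
next
  case False
  then show ?thesis by (simp add: xmul_def)
qed

lemma dunkl_xpsum:
  assumes "x \<in> xpairs d"
  shows "dunkl t i (xpsum i x) b = (\<Sum>y\<in>xpairs d. kern t y x * xpsum i y b)"
proof -
  obtain a M where x: "x = (a, M)" by force
  have M: "0 \<notin># M" "a + \<Sum>\<^sub># M = d" using assms by (auto simp: x xpairs_def)
  have 1: "(\<Sum>y\<in>xpairs d. (if y = x then of_nat (fst x) * (1 - t) else 0) * xpsum i y b) = of_nat a * (1 - t) * xpsum i x b"
  proof -
    have "(\<Sum>y\<in>xpairs d. (if y = x then of_nat (fst x) * (1 - t) else 0) * xpsum i y b)
      = (\<Sum>y\<in>{x}. (if y = x then of_nat (fst x) * (1 - t) else 0) * xpsum i y b)"
      using assms by (intro sum.mono_neutral_right) auto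
    then show ?thesis by (simp add: x)
  qed
  have 2: "(\<Sum>y\<in>xpairs d. (if fst x < fst y \<and> snd x = add_mset (fst y - fst x) (snd y)
       then of_nat ((fst y - fst x) * count (snd x) (fst y - fst x)) else 0) * xpsum i y b)
     = (\<Sum>r\<in>#M. of_nat r * xmul i (a + r) (psum (M - {#r#})) b)" (is "?L = ?R")
  proof -
    have "?R = (\<Sum>r\<in>set_mset M. of_nat (count M r) * (of_nat r * xmul i (a + r) (psum (M - {#r#})) b))"
      by (rule sum_mset_count)
    also have "\<dots> = (\<Sum>y\<in>(\<lambda>r. (a + r, M - {#r#})) ` set_mset M. of_nat ((fst y - a) * count M (fst y - a)) * xpsum i y b)"
      by (subst sum.reindex) (auto simp: inj_on_def xpsum_def algebra_simps)
    also have "\<dots> = (\<Sum>y\<in>xpairs d. (if fst x < fst y \<and> snd x = add_mset (fst y - fst x) (snd y)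
       then of_nat ((fst y - fst x) * count (snd x) (fst y - fst x)) else 0) * xpsum i y b)"
    proof (intro sum.mono_neutral_cong_left finite_xpairs ballI)
      show "(\<lambda>r. (a + r, M - {#r#})) ` set_mset M \<subseteq> xpairs d"
      proof (intro image_subsetI)
        fix r assume r: "r \<in># M"
        then have "\<Sum>\<^sub># M = \<Sum>\<^sub># (add_mset r (M - {#r#}))" by simp
        moreover have "\<Sum>\<^sub># (add_mset r N) = r + \<Sum>\<^sub># N" for N :: "nat multiset" by simp
        ultimately have "\<Sum>\<^sub># M = r + \<Sum>\<^sub># (M - {#r#})" by (simp only:)
        moreover have "0 \<notin># M - {#r#}" using M(1) by (meson in_diffD)
        ultimately show "(a + r, M - {#r#}) \<in> xpairs d" using M by (simp add: xpairs_def)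
      qed
    next
      fix y assume y: "y \<in> xpairs d - (\<lambda>r. (a + r, M - {#r#})) ` set_mset M"
      have n: "\<not> (fst x < fst y \<and> snd x = add_mset (fst y - fst x) (snd y))"
      proof
        assume *: "fst x < fst y \<and> snd x = add_mset (fst y - fst x) (snd y)"
        then have "y = (a + (fst y - a), M - {#fst y - a#})" "fst y - a \<in># M" by (auto simp: x prod_eq_iff)
        with y show False by blast
      qed
      show "(if fst x < fst y \<and> snd x = add_mset (fst y - fst x) (snd y)
       then of_nat ((fst y - fst x) * count (snd x) (fst y - fst x)) else 0) * xpsum i y b = 0" by (subst if_not_P[OF n]) simp
    next
      fix y assume "y \<in> (\<lambda>r. (a + r, M - {#r#})) ` set_mset M"
      then obtain r where r: "y = (a + r, M - {#r#})" "r \<in># M" by auto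
      then have "r \<noteq> 0" using M by metis
      then show "of_nat ((fst y - a) * count M (fst y - a)) * xpsum i y b =
        (if fst x < fst y \<and> snd x = add_mset (fst y - fst x) (snd y)
       then of_nat ((fst y - fst x) * count (snd x) (fst y - fst x)) else 0) * xpsum i y b"
        using r by (simp add: x)
    qed
    finally show ?thesis by simp
  qed
  have 3: "(\<Sum>y\<in>xpairs d. (if fst y < fst x \<and> snd y = add_mset (fst x - fst y) (snd x) then t else 0) * xpsum i y b)
     = t * (\<Sum>s\<in>{1..a}. xmul i (a - s) (pmul s (psum M)) b)"
  proof -
    have "t * (\<Sum>s\<in>{1..a}. xmul i (a - s) (pmul s (psum M)) b) = (\<Sum>y\<in>(\<lambda>s. (a - s, add_mset s M)) ` {1..a}. t * xpsum i y b)"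
      by (subst sum.reindex) (auto simp: inj_on_def xpsum_def psum_add sum_distrib_left)
    also have "\<dots> = (\<Sum>y\<in>xpairs d. (if fst y < fst x \<and> snd y = add_mset (fst x - fst y) (snd x) then t else 0) * xpsum i y b)"
    proof (intro sum.mono_neutral_cong_left finite_xpairs ballI)
      show "(\<lambda>s. (a - s, add_mset s M)) ` {1..a} \<subseteq> xpairs d" using M by (auto simp: xpairs_def)
    next
      fix y assume y: "y \<in> xpairs d - (\<lambda>s. (a - s, add_mset s M)) ` {1..a}"
      have n: "\<not> (fst y < fst x \<and> snd y = add_mset (fst x - fst y) (snd x))"
      proof
        assume *: "fst y < fst x \<and> snd y = add_mset (fst x - fst y) (snd x)"
        then have "y = (a - (a - fst y), add_mset (a - fst y) M)" "a - fst y \<in> {1..a}" by (auto simp: x prod_eq_iff)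
        with y show False by blast
      qed
      show "(if fst y < fst x \<and> snd y = add_mset (fst x - fst y) (snd x) then t else 0) * xpsum i y b = 0" by (subst if_not_P[OF n]) simp
    qed (auto simp: x)
    finally show ?thesis ..
  qed
  have "dunkl t i (xpsum i x) b = of_nat (lkp b i) * xmul i a (psum M) b
    + t * ((\<Sum>s\<in>{1..a}. xmul i (a - s) (pmul s (psum M)) b) - of_nat a * xmul i a (psum M) b)"
    unfolding xpsum_def x fst_conv snd_conv by (rule dunkl_xmul[OF psum_symm])
  also have "\<dots> = of_nat a * (1 - t) * xmul i a (psum M) b + (\<Sum>r\<in>#M. of_nat r * xmul i (a + r) (psum (M - {#r#})) b)
     + t * (\<Sum>s\<in>{1..a}. xmul i (a - s) (pmul s (psum M)) b)"
    unfolding euler_xpsum[OF M(1)] by (simp add: algebra_simps)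
  also have "\<dots> = (\<Sum>y\<in>xpairs d. kern t y x * xpsum i y b)"
    unfolding kern_def distrib_right sum.distrib 1 2 3 by (simp add: x xpsum_def)
  finally show ?thesis .
qed

lemma dunkl_sum:
  "dunkl t i (\<lambda>b. \<Sum>x\<in>S. c x * g x b) b = (\<Sum>x\<in>S. c x * dunkl t i (g x) b)"
proof (induction S rule: infinite_finite_induct)
  case (insert x S)
  have add: "dunkl t i (\<lambda>b. f b + h b) b = dunkl t i f b + dunkl t i h b" for f h
    by (simp add: dunkl_def algebra_simps sum.distrib sum_subtractf)
  have mul: "dunkl t i (\<lambda>b. k * f b) b = k * dunkl t i f b" for f k
  proof -
    have "(\<Sum>j\<in>kys b - {i}. \<Sum>r = 1..lkp b j. k * f (b + sgl i r - sgl j r) - k * f (swp i j (b + sgl i r - sgl j r)))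
      = k * (\<Sum>j\<in>kys b - {i}. \<Sum>r = 1..lkp b j. f (b + sgl i r - sgl j r) - f (swp i j (b + sgl i r - sgl j r)))"
      unfolding sum_distrib_left right_diff_distrib ..
    then show ?thesis by (simp add: dunkl_def algebra_simps)
  qed
  show ?case using insert by (simp add: add mul)
qed (simp_all add: dunkl_def)

text \<open>
  The action of the matrix on coefficient vectors.
\<close>
definition kern_op :: "'a::comm_ring_1 \<Rightarrow> nat \<Rightarrow> (nat \<times> nat multiset \<Rightarrow> 'a) \<Rightarrow> nat \<times> nat multiset \<Rightarrow> 'a" where
  "kern_op t d c y = (\<Sum>x\<in>xpairs d. kern t y x * c x)"

lemma dunkl_kern_op:
  "dunkl t i (\<lambda>b. \<Sum>x\<in>xpairs d. c x * xpsum i x b) = (\<lambda>b. \<Sum>x\<in>xpairs d. kern_op t d c x * xpsum i x b)"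
proof (rule ext)
  fix b
  have "dunkl t i (\<lambda>b. \<Sum>x\<in>xpairs d. c x * xpsum i x b) b = (\<Sum>x\<in>xpairs d. c x * (\<Sum>y\<in>xpairs d. kern t y x * xpsum i y b))"
    unfolding dunkl_sum by (intro sum.cong refl) (simp add: dunkl_xpsum)
  also have "\<dots> = (\<Sum>x\<in>xpairs d. \<Sum>y\<in>xpairs d. kern t y x * c x * xpsum i y b)"
    by (simp add: sum_distrib_left ac_simps)
  also have "\<dots> = (\<Sum>y\<in>xpairs d. \<Sum>x\<in>xpairs d. kern t y x * c x * xpsum i y b)" by (rule sum.swap)
  also have "\<dots> = (\<Sum>y\<in>xpairs d. kern_op t d c y * xpsum i y b)" by (simp add: kern_op_def sum_distrib_right)
  finally show "dunkl t i (\<lambda>b. \<Sum>x\<in>xpairs d. c x * xpsum i x b) b = (\<Sum>y\<in>xpairs d. kern_op t d c y * xpsum i y b)" .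
qed

lemma dunkl_kern_op_pow:
  "(dunkl t i ^^ k) (\<lambda>b. \<Sum>x\<in>xpairs d. c x * xpsum i x b) = (\<lambda>b. \<Sum>x\<in>xpairs d. (kern_op t d ^^ k) c x * xpsum i x b)"
  by (induction k) (simp_all add: dunkl_kern_op)

lemma kern_symmetric: "kern theta y x * wt (snd y) = kern theta x y * wt (snd x)"
proof -
  have *: "of_nat ((fst y - fst x) * count (snd x) (fst y - fst x)) * wt (snd y) = theta * wt (snd x)"
    if "snd x = add_mset (fst y - fst x) (snd y)" for x y :: "nat \<times> nat multiset"
    unfolding that wt_add by (simp add: that)
  show ?thesis
  proof (cases "fst x" "fst y" rule: linorder_cases)
    case less
    then show ?thesis using *[of x y] by (auto simp: kern_def)
  next
    case equal
    then show ?thesis by (auto simp: kern_def)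
  next
    case greater
    then show ?thesis using *[of y x] by (auto simp: kern_def)
  qed
qed

lemma kern_op_selfadjoint:
  "(\<Sum>x\<in>xpairs d. kern_op theta d c x * e x * wt (snd x)) = (\<Sum>x\<in>xpairs d. c x * kern_op theta d e x * wt (snd x))"
proof -
  have "(\<Sum>y\<in>xpairs d. kern_op theta d c y * e y * wt (snd y)) = (\<Sum>y\<in>xpairs d. \<Sum>x\<in>xpairs d. (kern theta y x * wt (snd y)) * c x * e y)"
    by (simp add: kern_op_def sum_distrib_right sum_distrib_left ac_simps)
  also have "\<dots> = (\<Sum>x\<in>xpairs d. \<Sum>y\<in>xpairs d. (kern theta x y * wt (snd x)) * c x * e y)"
    by (subst sum.swap) (simp add: kern_symmetric)
  also have "\<dots> = (\<Sum>x\<in>xpairs d. c x * kern_op theta d e x * wt (snd x))"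
    by (simp add: kern_op_def sum_distrib_right sum_distrib_left ac_simps)
  finally show ?thesis .
qed

lemma kern_op_pow_selfadjoint:
  "(\<Sum>x\<in>xpairs d. (kern_op theta d ^^ k) c x * e x * wt (snd x)) = (\<Sum>x\<in>xpairs d. c x * (kern_op theta d ^^ k) e x * wt (snd x))"
proof (induction k arbitrary: e)
  case (Suc k)
  then show ?case by (simp add: kern_op_selfadjoint flip: funpow_swap1)
qed simp

section \<open>The Nazarov-Sklyanin operators\<close>

text \<open>
  A variable that does not occur in \<open>b\<close>.
\<close>
definition fresh :: "expo \<Rightarrow> nat" where
  "fresh b = (SOME i. i \<notin> kys b)"

lemma fresh: "fresh b \<notin> kys b"
  unfolding fresh_def using ex_new_if_finite[OF infinite_UNIV_nat finite_keys[of b]] by (rule someI_ex)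

text \<open>
  The Nazarov-Sklyanin operator: the part of \<open>dunkl\<^sup>k f\<close> free of the distinguished variable. Its
  coefficient at \<open>b\<close> is read off with a distinguished variable that does not occur in \<open>b\<close>; for symmetric
  \<open>f\<close> the choice does not matter (\<open>dunkl_pow_homsym\<close>).
\<close>
definition nsop :: "nat \<Rightarrow> symfun \<Rightarrow> symfun" where
  "nsop k f b = (dunkl theta (fresh b) ^^ k) f b"

text \<open>
  The power sum coordinates of \<open>f\<close>, as coordinates with respect to \<open>x\<^sub>i\<^sup>0 p\<^sub>M\<close>.
\<close>
definition embed0 :: "symfun \<Rightarrow> nat \<times> nat multiset \<Rightarrow> ratfun" where
  "embed0 f x = (if fst x = 0 then pcoef f (snd x) else 0)"

lemma sum_xpairs_zero:
  assumes "\<And>x. fst x \<noteq> 0 \<Longrightarrow> h x = 0"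
  shows "(\<Sum>x\<in>xpairs d. h x) = (\<Sum>M\<in>mparts d. h (0, M))"
proof -
  have "(\<Sum>x\<in>xpairs d. h x) = (\<Sum>x\<in>Pair 0 ` mparts d. h x)"
  proof (intro sum.mono_neutral_right finite_xpairs ballI)
    show "Pair 0 ` mparts d \<subseteq> xpairs d" by (auto simp: xpairs_def mparts_def)
    fix x assume "x \<in> xpairs d - Pair 0 ` mparts d"
    then have "fst x \<noteq> 0" by (cases x) (auto simp: xpairs_def mparts_def)
    then show "h x = 0" by (rule assms)
  qed
  also have "\<dots> = (\<Sum>M\<in>mparts d. h (0, M))" by (subst sum.reindex) (auto simp: inj_on_def)
  finally show ?thesis .
qed

lemma dunkl_pow_homsym:
  assumes "homsym d f" "i \<notin> kys b"
  shows "(dunkl theta i ^^ k) f b = (\<Sum>M\<in>mparts d. (kern_op theta d ^^ k) (embed0 f) (0, M) * psum M b)"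
proof -
  have "f = (\<lambda>b. \<Sum>x\<in>xpairs d. embed0 f x * xpsum i x b)"
  proof (rule ext)
    fix b
    have "(\<Sum>x\<in>xpairs d. embed0 f x * xpsum i x b) = (\<Sum>M\<in>mparts d. embed0 f (0, M) * xpsum i (0, M) b)"
      by (rule sum_xpairs_zero) (simp add: embed0_def)
    also have "\<dots> = f b" using pcoef_expand[OF assms(1), of b] by (simp add: embed0_def xpsum_def)
    finally show "f b = (\<Sum>x\<in>xpairs d. embed0 f x * xpsum i x b)" ..
  qed
  then have "(dunkl theta i ^^ k) f b = (\<Sum>x\<in>xpairs d. (kern_op theta d ^^ k) (embed0 f) x * xpsum i x b)"
    using dunkl_kern_op_pow[of k theta i "embed0 f" d] by metis
  also have "\<dots> = (\<Sum>M\<in>mparts d. (kern_op theta d ^^ k) (embed0 f) (0, M) * xpsum i (0, M) b)"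
    using assms(2) by (intro sum_xpairs_zero) (auto simp: xpsum_def xmul_def in_keys_iff)
  finally show ?thesis by (simp add: xpsum_def)
qed

lemma nsop_expand:
  assumes "homsym d f"
  shows "nsop k f b = (\<Sum>M\<in>mparts d. (kern_op theta d ^^ k) (embed0 f) (0, M) * psum M b)"
  unfolding nsop_def by (rule dunkl_pow_homsym[OF assms fresh])

lemma homsym_nsop:
  assumes "homsym d f" shows "homsym d (nsop k f)"
proof -
  have "nsop k f = (\<lambda>b. \<Sum>M\<in>mparts d. (kern_op theta d ^^ k) (embed0 f) (0, M) * psum M b)"
    by (rule ext) (rule nsop_expand[OF assms])
  moreover have "homsym d \<dots>" by (intro homsym_sum homsym_cmult homsym_psum)
  ultimately show ?thesis by simp
qed

lemma nsop_selfadjoint: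
  assumes "homsym d f" "homsym d g"
  shows "jack_inner (nsop k f) g = jack_inner f (nsop k g)"
proof -
  have p: "pcoef (nsop k h) M = (kern_op theta d ^^ k) (embed0 h) (0, M)" if "homsym d h" "M \<in> mparts d" for h M
    by (rule pcoef_unique[OF nsop_expand[OF that(1)] that(2)])
  have "jack_inner (nsop k f) g = (\<Sum>M\<in>mparts d. (kern_op theta d ^^ k) (embed0 f) (0, M) * embed0 g (0, M) * wt (snd (0 :: nat, M)))"
    unfolding jack_inner_eq[OF homsym_nsop[OF assms(1)] assms(2)]
    by (intro sum.cong refl) (simp add: p assms embed0_def)
  also have "\<dots> = (\<Sum>x\<in>xpairs d. (kern_op theta d ^^ k) (embed0 f) x * embed0 g x * wt (snd x))"
    by (rule sum_xpairs_zero[symmetric]) (simp add: embed0_def)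
  also have "\<dots> = (\<Sum>x\<in>xpairs d. embed0 f x * (kern_op theta d ^^ k) (embed0 g) x * wt (snd x))"
    by (rule kern_op_pow_selfadjoint)
  also have "\<dots> = (\<Sum>M\<in>mparts d. embed0 f (0, M) * (kern_op theta d ^^ k) (embed0 g) (0, M) * wt (snd (0 :: nat, M)))"
    by (rule sum_xpairs_zero) (simp add: embed0_def)
  also have "\<dots> = jack_inner f (nsop k g)"
    unfolding jack_inner_eq[OF assms(1) homsym_nsop[OF assms(2)]]
    by (intro sum.cong refl) (simp add: p assms embed0_def)
  finally show ?thesis .
qed

lemma dunkl_pow_sum:
  "(dunkl t i ^^ k) (\<lambda>b. \<Sum>x\<in>S. c x * g x b) = (\<lambda>b. \<Sum>x\<in>S. c x * (dunkl t i ^^ k) (g x) b)"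
proof (induction k)
  case (Suc k)
  then show ?case by (simp add: dunkl_sum[abs_def])
qed simp

lemma nsop_sum: "nsop k (\<lambda>b. \<Sum>x\<in>S. c x * g x b) = (\<lambda>b. \<Sum>x\<in>S. c x * nsop k (g x) b)"
  by (rule ext) (simp add: nsop_def dunkl_pow_sum)

section \<open>Dominance and triangularity\<close>

text \<open>
  The dominance order is used in the form \<open>\<Sum>\<^sub>i max(\<nu>\<^sub>i - c, 0) \<le> \<Sum>\<^sub>i max(\<mu>\<^sub>i - c, 0)\<close> for all \<open>c\<close> (with
  truncated subtraction), which needs no sorting.
\<close>
definition excess :: "nat \<Rightarrow> nat multiset \<Rightarrow> nat" where
  "excess c M = (\<Sum>x\<in>#M. x - c)"

text \<open>
  The relation \<open>domin N M\<close> says that \<open>M\<close> dominates \<open>N\<close>.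
\<close>
definition domin :: "nat multiset \<Rightarrow> nat multiset \<Rightarrow> bool" where
  "domin N M \<longleftrightarrow> \<Sum>\<^sub># N = \<Sum>\<^sub># M \<and> (\<forall>c. excess c N \<le> excess c M)"

lemma domin_refl: "domin M M"
  by (simp add: domin_def)

lemma domin_trans: "domin L M \<Longrightarrow> domin M N \<Longrightarrow> domin L N"
  unfolding domin_def by (auto intro: le_trans)

lemma excess_Suc: "excess c M = excess (Suc c) M + size (filter_mset (\<lambda>x. c < x) M)"
  unfolding excess_def by (induction M) auto

lemma count_filter_step: "count M (Suc c) + size (filter_mset (\<lambda>x. Suc c < x) M) = size (filter_mset (\<lambda>x. c < x) M)"
  by (induction M) auto

lemma domin_antisym:
  assumes "domin M N" "domin N M" "0 \<notin># M" "0 \<notin># N" shows "M = N"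
proof -
  have e: "excess c M = excess c N" for c using assms by (simp add: domin_def le_antisym)
  then have s: "size (filter_mset (\<lambda>x. c < x) M) = size (filter_mset (\<lambda>x. c < x) N)" for c
    using excess_Suc[of c M] excess_Suc[of c N] by simp
  have "count M x = count N x" for x
  proof (cases x)
    case 0 then show ?thesis using assms by (simp add: not_in_iff)
  next
    case (Suc c)
    then show ?thesis using count_filter_step[of M c] count_filter_step[of N c] s[of c] s[of "Suc c"] by simp
  qed
  then show ?thesis by (rule multiset_eqI)
qed

lemma excess_parts: "excess c (parts a) = (\<Sum>k\<in>kys a. lkp a k - c)"
  by (simp add: excess_def sum_parts_image)

lemma excess_parts_superset: "finite S \<Longrightarrow> kys a \<subseteq> S \<Longrightarrow> excess c (parts a) = (\<Sum>k\<in>S. lkp a k - c)"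
  unfolding excess_parts by (intro sum.mono_neutral_left) (auto simp: in_keys_iff)

lemma excess_ge_initial: "(\<Sum>i<k. lkp a i - c) \<le> excess c (parts a)"
proof -
  have "(\<Sum>i<k. lkp a i - c) \<le> (\<Sum>i\<in>kys a \<union> {..<k}. lkp a i - c)"
    by (intro sum_mono2) auto
  also have "\<dots> = excess c (parts a)" by (rule excess_parts_superset[symmetric]) auto
  finally show ?thesis .
qed

lemma partition_mono: "is_partition a \<Longrightarrow> i \<le> j \<Longrightarrow> lkp a j \<le> lkp a i"
  unfolding is_partition_def by (rule antimonoD)

lemma sum_minus_add: "(\<Sum>i<k. lkp a i) \<le> (\<Sum>i<k. lkp a i - c) + k * c"
proof -
  have "(\<Sum>i<k. lkp a i) \<le> (\<Sum>i<k. (lkp a i - c) + c)" by (intro sum_mono) simp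
  then show ?thesis by (simp add: sum.distrib)
qed

lemma excess_initial:
  assumes "\<And>i. i < k \<Longrightarrow> c \<le> lkp a i" "\<And>i. k \<le> i \<Longrightarrow> lkp a i \<le> c"
  shows "excess c (parts a) + k * c = (\<Sum>i<k. lkp a i)"
proof -
  have "excess c (parts a) = (\<Sum>i\<in>kys a \<union> {..<k}. lkp a i - c)" by (rule excess_parts_superset) auto
  also have "\<dots> = (\<Sum>i<k. lkp a i - c)" using assms(2) by (intro sum.mono_neutral_right) auto
  finally have "excess c (parts a) + k * c = (\<Sum>i<k. (lkp a i - c) + c)" by (simp add: sum.distrib)
  also have "\<dots> = (\<Sum>i<k. lkp a i)" using assms(1) by (intro sum.cong) auto
  finally show ?thesis .
qed

lemma majorizes_iff_domin:
  assumes "is_partition a" "is_partition b"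
  shows "a \<succcurlyeq> b \<longleftrightarrow> domin (parts b) (parts a)"
proof
  assume L: "a \<succcurlyeq> b"
  have "excess c (parts b) \<le> excess c (parts a)" for c
  proof -
    define k where "k = (LEAST i. lkp b i \<le> c)"
    have "\<exists>i. lkp b i \<le> c" using fresh[of b] by (auto simp: in_keys_iff intro!: exI[of _ "fresh b"])
    then have k: "lkp b k \<le> c" unfolding k_def by (rule LeastI_ex)
    have "c \<le> lkp b i" if "i < k" for i using not_less_Least[of i "\<lambda>i. lkp b i \<le> c"] that by (simp add: k_def)
    moreover have "lkp b i \<le> c" if "k \<le> i" for i using partition_mono[OF assms(2) that] k by simp
    ultimately have "excess c (parts b) + k * c = (\<Sum>i<k. lkp b i)" by (rule excess_initial)
    also have "\<dots> \<le> (\<Sum>i<k. lkp a i)" using L by (simp add: majorizes_def)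
    also have "\<dots> \<le> (\<Sum>i<k. lkp a i - c) + k * c" by (rule sum_minus_add)
    also have "\<dots> \<le> excess c (parts a) + k * c" using excess_ge_initial by simp
    finally show ?thesis by simp
  qed
  then show "domin (parts b) (parts a)" using L by (simp add: domin_def majorizes_def)
next
  assume R: "domin (parts b) (parts a)"
  have "(\<Sum>i<k. lkp b i) \<le> (\<Sum>i<k. lkp a i)" for k
  proof -
    \<comment> \<open>Cutting at the first omitted part makes the estimate sharp for \<open>a\<close>.\<close>
    define c where "c = lkp a k"
    have "(\<Sum>i<k. lkp b i) \<le> (\<Sum>i<k. lkp b i - c) + k * c" by (rule sum_minus_add)
    also have "\<dots> \<le> excess c (parts b) + k * c" using excess_ge_initial by simp
    also have "\<dots> \<le> excess c (parts a) + k * c" using R by (simp add: domin_def)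
    also have "\<dots> = (\<Sum>i<k. lkp a i)"
      using partition_mono[OF assms(1)] by (intro excess_initial) (simp_all add: c_def)
    finally show ?thesis .
  qed
  then show "a \<succcurlyeq> b" using R by (simp add: domin_def majorizes_def)
qed

text \<open>
  Only monomials dominated by \<open>M\<close> occur in \<open>f\<close>.
\<close>
definition below :: "nat multiset \<Rightarrow> (expo \<Rightarrow> 'a::zero) \<Rightarrow> bool" where
  "below M f \<longleftrightarrow> (\<forall>b. f b \<noteq> 0 \<longrightarrow> domin (parts b) M)"

lemma belowD: "below M f \<Longrightarrow> \<not> domin (parts b) M \<Longrightarrow> f b = 0"
  unfolding below_def by blast

text \<open>
  Moving at least the difference of the exponents from \<open>x\<^sub>j\<close> to \<open>x\<^sub>i\<close> gives a dominating exponent vector.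
\<close>
lemma spread_domin:
  assumes "i \<noteq> j" "r \<le> lkp b j" "lkp b j \<le> lkp b i + r"
  shows "domin (parts b) (parts (b + sgl i r - sgl j r))"
proof -
  let ?g = "b + sgl i r - sgl j r" and ?S = "kys b \<union> {i, j}"
  have lg: "lkp ?g k = (if k = i then lkp b i + r else if k = j then lkp b j - r else lkp b k)" for k
    using assms by (simp add: lkp_diff_single lkp_add_single)
  have sub: "kys ?g \<subseteq> ?S" by (auto simp: in_keys_iff lg split: if_splits)
  have split: "(\<Sum>k\<in>?S. h k) = h i + h j + (\<Sum>k\<in>?S - {i, j}. h k)" for h :: "nat \<Rightarrow> nat"
    using assms(1) by (subst sum.subset_diff[of "{i, j}"]) auto
  have rest: "(\<Sum>k\<in>?S - {i, j}. h (lkp ?g k)) = (\<Sum>k\<in>?S - {i, j}. h (lkp b k))" for h :: "nat \<Rightarrow> nat"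
    by (intro sum.cong) (auto simp: lg)
  have "excess c (parts b) \<le> excess c (parts ?g)" for c
  proof -
    have "(lkp b i - c) + (lkp b j - c) \<le> (lkp ?g i - c) + (lkp ?g j - c)"
      using assms by (simp add: lg)
    then show ?thesis
      using excess_parts_superset[of ?S b c] excess_parts_superset[of ?S ?g c] sub
        split[of "\<lambda>k. lkp b k - c"] split[of "\<lambda>k. lkp ?g k - c"] rest[of "\<lambda>x. x - c"]
      by (simp add: subset_insertI2)
  qed
  moreover have "psize b = psize ?g"
  proof -
    have "lkp b i + lkp b j = lkp ?g i + lkp ?g j" using assms by (simp add: lg)
    then show ?thesis
      using psize_superset[of ?S b] psize_superset[of ?S ?g] sub
        split[of "lkp b"] split[of "lkp ?g"] rest[of "\<lambda>x. x"] by (simp add: subset_insertI2)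
  qed
  ultimately show ?thesis by (simp add: domin_def)
qed

lemma below_dunkl:
  assumes "below M g" shows "below M (dunkl t i g)"
  unfolding below_def
proof (intro allI impI, rule ccontr)
  fix b assume nz: "dunkl t i g b \<noteq> 0" and nd: "\<not> domin (parts b) M"
  have "(\<Sum>r\<in>{1..lkp b j}. g (b + sgl i r - sgl j r) - g (swp i j (b + sgl i r - sgl j r))) = 0"
    if j: "j \<in> kys b - {i}" for j
  proof -
    let ?p = "lkp b i" and ?q = "lkp b j" and ?g = "\<lambda>r. b + sgl i r - sgl j r"
    have ij: "i \<noteq> j" using j by auto
    \<comment> \<open>From the exchange on, the exponents dominate those of \<open>b\<close>.\<close>
    have zero: "g (?g r) = 0 \<and> g (swp i j (?g r)) = 0" if "r \<le> ?q" "?q \<le> ?p + r" for r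
    proof -
      have "\<not> domin (parts (?g r)) M" using spread_domin[OF ij that] nd domin_trans by blast
      then show ?thesis using belowD[OF assms] by simp
    qed
    let ?A = "{r. 1 \<le> r \<and> ?p + r < ?q}"
    have fin: "finite ?A" by (rule finite_subset[of _ "{..?q}"]) auto
    have "(\<Sum>r\<in>{1..?q}. g (?g r) - g (swp i j (?g r))) = (\<Sum>r\<in>?A. g (?g r) - g (swp i j (?g r)))"
    proof (intro sum.mono_neutral_right ballI)
      fix r assume "r \<in> {1..?q} - ?A"
      then show "g (?g r) - g (swp i j (?g r)) = 0" using zero[of r] by auto
    qed auto
    also have "\<dots> = (\<Sum>r\<in>?A. g (?g r)) - (\<Sum>r\<in>?A. g (swp i j (?g r)))" by (rule sum_subtractf)
    \<comment> \<open>Short of the exchange, the terms for \<open>r\<close> and \<open>b\<^sub>j - b\<^sub>i - r\<close> cancel.\<close>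
    also have "(\<Sum>r\<in>?A. g (swp i j (?g r))) = (\<Sum>r\<in>?A. g (?g r))"
    proof (rule sum.reindex_bij_witness[of _ "\<lambda>r. ?q - ?p - r" "\<lambda>r. ?q - ?p - r"])
      fix r assume r: "r \<in> ?A"
      have "swp i j (?g r) = ?g (?q - ?p - r)"
        using r ij by (intro poly_mapping_eqI) (auto simp: lkp_swp lkp_diff_single lkp_add_single transpose_def)
      then show "g (?g (?q - ?p - r)) = g (swp i j (?g r))" by simp
    qed auto
    finally show ?thesis by simp
  qed
  then have "dunkl t i g b = of_nat (lkp b i) * g b" by (simp add: dunkl_def)
  with nz nd belowD[OF assms nd] show False by simp
qed

lemma below_nsop: assumes "below M f" shows "below M (nsop k f)"
proof -
  have "below M ((dunkl theta i ^^ k) f)" for i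
    using assms by (induction k) (simp_all add: below_dunkl)
  then show ?thesis unfolding below_def nsop_def by blast
qed

lemma below_msym: "below M (msym M)"
  by (simp add: below_def msym_def domin_refl)

section \<open>Separation of the diagonal entries\<close>

text \<open>
  The rational function \<open>x\<close> is a polynomial in \<open>\<theta>\<close> with value \<open>q\<close> at \<open>\<theta> = 0\<close>.
\<close>
definition val0 :: "ratfun \<Rightarrow> rat \<Rightarrow> bool" where
  "val0 x q \<longleftrightarrow> (\<exists>p. x = Fract p 1 \<and> poly p 0 = q)"

lemma val0_0: "val0 0 0" unfolding val0_def by (intro exI[of _ 0]) (simp add: Zero_fract_def)
lemma val0_1: "val0 1 1" unfolding val0_def by (intro exI[of _ 1]) (simp add: One_fract_def)
lemma val0_add: "val0 x p \<Longrightarrow> val0 y q \<Longrightarrow> val0 (x + y) (p + q)"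
proof -
  assume "val0 x p" "val0 y q"
  then obtain u v where "x = Fract u 1" "poly u 0 = p" "y = Fract v 1" "poly v 0 = q" by (auto simp: val0_def)
  then show ?thesis unfolding val0_def by (intro exI[of _ "u + v"]) simp
qed
lemma val0_mult: "val0 x p \<Longrightarrow> val0 y q \<Longrightarrow> val0 (x * y) (p * q)"
proof -
  assume "val0 x p" "val0 y q"
  then obtain u v where "x = Fract u 1" "poly u 0 = p" "y = Fract v 1" "poly v 0 = q" by (auto simp: val0_def)
  then show ?thesis unfolding val0_def by (intro exI[of _ "u * v"]) simp
qed
lemma val0_diff: "val0 x p \<Longrightarrow> val0 y q \<Longrightarrow> val0 (x - y) (p - q)"
proof -
  assume "val0 x p" "val0 y q"
  then obtain u v where "x = Fract u 1" "poly u 0 = p" "y = Fract v 1" "poly v 0 = q" by (auto simp: val0_def)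
  then show ?thesis unfolding val0_def by (intro exI[of _ "u - v"]) simp
qed
lemma val0_theta: "val0 theta 0" unfolding val0_def theta_def by (intro exI[of _ "[:0, 1:]"]) simp
lemma val0_of_nat: "val0 (of_nat n) (of_nat n)"
  by (induction n) (auto intro: val0_0 val0_add[OF val0_1])
lemma val0_sum: "(\<And>x. x \<in> S \<Longrightarrow> val0 (f x) (h x)) \<Longrightarrow> val0 (sum f S) (sum h S)"
  by (induction S rule: infinite_finite_induct) (auto intro: val0_0 val0_add)
lemma val0_unique: "val0 x p \<Longrightarrow> val0 x q \<Longrightarrow> p = q"
  unfolding val0_def by (auto simp: eq_fract)

lemma val0_dunkl:
  assumes "\<And>b. val0 (g b) (h b)"
  shows "val0 (dunkl theta i g b) (of_nat (lkp b i) * h b)"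
proof -
  have "val0 (dunkl theta i g b) (of_nat (lkp b i) * h b + 0 * (\<Sum>j\<in>kys b - {i}. \<Sum>r\<in>{1..lkp b j}.
     h (b + sgl i r - sgl j r) - h (swp i j (b + sgl i r - sgl j r))))"
    unfolding dunkl_def by (intro val0_add val0_mult val0_of_nat val0_theta val0_sum val0_diff assms)
  then show ?thesis by simp
qed

lemma val0_dunkl_pow:
  "val0 ((dunkl theta i ^^ k) (msym M) b) (of_nat (lkp b i) ^ k * msym M b)"
proof (induction k arbitrary: b)
  case 0 show ?case by (auto simp: msym_def val0_0 val0_1)
next
  case (Suc k)
  have "val0 (dunkl theta i ((dunkl theta i ^^ k) (msym M)) b) (of_nat (lkp b i) * (of_nat (lkp b i) ^ k * msym M b))"
    by (rule val0_dunkl) (rule Suc)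
  then show ?case by (simp add: mult.assoc)
qed

text \<open>
  The diagonal entry of \<open>nsop (k + 1)\<close> at \<open>M\<close> in the basis of monomial symmetric functions.
\<close>
definition eig :: "nat \<Rightarrow> nat multiset \<Rightarrow> ratfun" where
  "eig k M = nsop (Suc k) (msym M) (part_of M)"

text \<open>
  For \<open>\<theta> = 0\<close> the Dunkl operator multiplies \<open>x\<^sup>b\<close> by \<open>b\<^sub>i\<close>. The last of the \<open>k + 1\<close> applications has to remove
  the distinguished variable, so it contributes only through its difference part, with the factor \<open>\<theta>\<close>.
\<close>
lemma eig_value:
  assumes M: "0 \<notin># M" and k: "k > 0"
  shows "\<exists>s. eig k M = theta * s \<and> val0 s (of_nat (\<Sum>x\<in>#M. x ^ k))"
proof -
  let ?b = "part_of M"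
  define i where "i = fresh ?b"
  have i: "i \<notin> kys ?b" unfolding i_def by (rule fresh)
  have pb: "parts ?b = M" by (rule part_of(2)[OF M])
  let ?g = "(dunkl theta i ^^ k) (msym M)" and ?h = "\<lambda>b. of_nat (lkp b i) ^ k * msym M b :: rat"
  define s where "s = (\<Sum>j\<in>kys ?b - {i}. \<Sum>r\<in>{1..lkp ?b j}. ?g (?b + sgl i r - sgl j r) - ?g (swp i j (?b + sgl i r - sgl j r)))"
  have "eig k M = theta * s"
    using i by (simp add: eig_def nsop_def dunkl_def s_def in_keys_iff flip: i_def)
  moreover have "val0 s (\<Sum>j\<in>kys ?b - {i}. \<Sum>r\<in>{1..lkp ?b j}. ?h (?b + sgl i r - sgl j r) - ?h (swp i j (?b + sgl i r - sgl j r)))"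
    unfolding s_def by (intro val0_sum val0_diff val0_dunkl_pow)
  moreover have "(\<Sum>j\<in>kys ?b - {i}. \<Sum>r\<in>{1..lkp ?b j}. ?h (?b + sgl i r - sgl j r) - ?h (swp i j (?b + sgl i r - sgl j r)))
     = (\<Sum>j\<in>kys ?b. of_nat (lkp ?b j ^ k))"
  proof (rule sum.cong)
    show "kys ?b - {i} = kys ?b" using i by simp
    fix j assume j: "j \<in> kys ?b"
    let ?q = "lkp ?b j" and ?c = "\<lambda>r. ?b + sgl i r - sgl j r"
    have ij: "i \<noteq> j" using i j by auto
    have bi: "lkp ?b i = 0" using i by (simp add: in_keys_iff)
    have q: "?q > 0" using j by (simp add: in_keys_iff)
    have lc: "lkp (?c r) k = (if k = i then r else if k = j then ?q - r else lkp ?b k)" for r k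
      using ij bi by (simp add: lkp_diff_single lkp_add_single)
    \<comment> \<open>Only moving the whole exponent of \<open>x\<^sub>j\<close> to \<open>x\<^sub>i\<close> keeps the multiset of exponents.\<close>
    have "?h (?c r) - ?h (swp i j (?c r)) = (if r = ?q then of_nat (?q ^ k) else 0)" if r: "r \<in> {1..?q}" for r
    proof (cases "r = ?q")
      case True
      have "?c r = swp i j ?b"
        using ij True bi by (intro poly_mapping_eqI) (auto simp: lc lkp_swp transpose_def)
      then have "parts (?c r) = M" using pb by simp
      then show ?thesis using True ij k by (simp add: msym_def lkp_swp lc)
    next
      case False
      then have "kys (?c r) = insert i (kys ?b)"
        using r j ij by (auto simp: in_keys_iff lc split: if_splits)
      then have "card (kys (?c r)) = Suc (card (kys ?b))" using i by simp
      then have "parts (?c r) \<noteq> parts ?b" using size_parts by (metis n_not_Suc_n)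
      then have "parts (?c r) \<noteq> M" using pb by simp
      then show ?thesis using False by (simp add: msym_def)
    qed
    then have "(\<Sum>r\<in>{1..?q}. ?h (?c r) - ?h (swp i j (?c r))) = (\<Sum>r\<in>{1..?q}. if r = ?q then of_nat (?q ^ k) else 0)"
      by (intro sum.cong refl)
    also have "\<dots> = of_nat (?q ^ k)" using q by (subst sum.delta) auto
    finally show "(\<Sum>r\<in>{1..?q}. ?h (?c r) - ?h (swp i j (?c r))) = of_nat (?q ^ k)" .
  qed
  moreover have "(\<Sum>j\<in>kys ?b. of_nat (lkp ?b j ^ k)) = (of_nat (\<Sum>x\<in>#M. x ^ k) :: rat)"
    using sum_parts_image[of "\<lambda>x. x ^ k" ?b] pb by simp
  ultimately show ?thesis by metis
qed

lemma bernoulli_nat: "x ^ n * (x + Suc n) \<le> (x + 1 :: nat) ^ Suc n"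
proof (induction n)
  case (Suc n)
  have "x ^ Suc n * (x + Suc (Suc n)) \<le> (x + 1) * (x ^ n * (x + Suc n))"
    by (simp add: algebra_simps)
  also have "\<dots> \<le> (x + 1) * (x + 1) ^ Suc n" using Suc by (rule mult_le_mono2)
  finally show ?case by simp
qed simp

lemma power_gap:
  assumes "k > d * d" "x \<le> d" shows "d * x ^ k < (x + 1 :: nat) ^ k"
proof (cases "x = 0")
  case True then show ?thesis using assms by simp
next
  case False
  obtain n where n: "k = Suc n" using assms(1) by (cases k) auto
  have "d * x < x + Suc n" using mult_le_mono2[OF assms(2), of d] assms(1) n by linarith
  moreover have "0 < x ^ n" using False by simp
  ultimately have "x ^ n * (d * x) < x ^ n * (x + Suc n)" by (simp only: mult_less_cancel1)
  also have "\<dots> \<le> (x + 1) ^ Suc n" by (rule bernoulli_nat)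
  finally show ?thesis using n by (simp add: ac_simps)
qed

text \<open>
  For large \<open>k\<close> the power sum is determined lexicographically: a part \<open>x\<close> outweighs any number
  (at most \<open>d\<close>) of smaller parts.
\<close>
lemma ex_separating_power: "\<exists>k>0. inj_on (\<lambda>M. \<Sum>x\<in>#M. x ^ k) (mparts d)"
proof -
  \<comment> \<open>Large enough for \<open>d x\<^sup>k < (x + 1)\<^sup>k\<close> whenever \<open>x \<le> d\<close>; see \<open>power_gap\<close>.\<close>
  define k where "k = Suc (d * d)"
  have less: "(\<Sum>x\<in>#N. x ^ k) < (\<Sum>x\<in>#M. x ^ k)"
    if "size N \<le> d" "x \<in># M" "x > 0" "x \<le> d" "\<And>y. y \<in># N \<Longrightarrow> y < x" for N M and x :: nat
  proof -
    have "(\<Sum>y\<in>#N. y ^ k) \<le> (\<Sum>y\<in>#N. (x - 1) ^ k)"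
      using that(5) by (intro sum_mset_mono power_mono) force+
    also have "\<dots> = size N * (x - 1) ^ k" by simp
    also have "\<dots> \<le> d * (x - 1) ^ k" using that(1) by simp
    also have "\<dots> < (x - 1 + 1) ^ k" using that by (intro power_gap) (auto simp: k_def)
    also have "\<dots> \<le> (\<Sum>y\<in>#M. y ^ k)"
      using that(2,3) by (auto dest!: multi_member_split)
    finally show ?thesis .
  qed
  have "M = N" if MN: "M \<in> mparts d" "N \<in> mparts d" and eq: "(\<Sum>x\<in>#M. x ^ k) = (\<Sum>x\<in>#N. x ^ k)" for M N
  proof (rule ccontr)
    assume ne: "M \<noteq> N"
    let ?M = "M - N" and ?N = "N - M" and ?I = "M \<inter># N"
    have dec: "M = ?M + ?I" "N = ?N + ?I"
      by (simp_all add: multiset_eq_iff) (metis add.commute diff_add_inverse2 le_add_diff_inverse2 linorder_linear min.absorb1 min.absorb2 add_0 diff_is_0_eq)+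
    have sum: "\<Sum>\<^sub># ?M = \<Sum>\<^sub># ?N"
      using MN arg_cong[OF dec(1), of sum_mset] arg_cong[OF dec(2), of sum_mset] by (simp add: mparts_def)
    have pw: "(\<Sum>x\<in>#?M. x ^ k) = (\<Sum>x\<in>#?N. x ^ k)"
      using eq arg_cong[OF dec(1), of "\<lambda>M. \<Sum>x\<in>#M. x ^ k"] arg_cong[OF dec(2), of "\<lambda>M. \<Sum>x\<in>#M. x ^ k"] by simp
    have z: "0 \<notin># ?M" "0 \<notin># ?N" using MN by (auto simp: mparts_def dest: in_diffD)
    have disj: "x \<notin># ?N" if "x \<in># ?M" for x
      using that by (simp add: in_diff_count)
    have le: "\<Sum>\<^sub># ?M \<le> d" "\<Sum>\<^sub># ?N \<le> d"
      using MN arg_cong[OF dec(1), of sum_mset] arg_cong[OF dec(2), of sum_mset] by (simp_all add: mparts_def)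
    have sz: "size ?M \<le> d" "size ?N \<le> d" using size_le_sum z le by (meson le_trans)+
    have "?M + ?N \<noteq> {#}" using ne dec by auto
    then have S: "finite (set_mset (?M + ?N))" "set_mset (?M + ?N) \<noteq> {}" by auto
    define x where "x = Max (set_mset (?M + ?N))"
    have x: "x \<in># ?M + ?N" using Max_in[OF S] by (simp add: x_def)
    have mx: "y \<le> x" if "y \<in># ?M + ?N" for y using Max_ge[OF S(1) that] by (simp add: x_def)
    have xd: "x > 0" "x \<le> d"
    proof -
      show "x > 0" using x z by (auto intro!: Nat.gr0I)
      have "x \<le> \<Sum>\<^sub># ?M \<or> x \<le> \<Sum>\<^sub># ?N" using x by (auto dest!: multi_member_split)
      then show "x \<le> d" using le by auto
    qed
    show False
    proof (cases "x \<in># ?M")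
      case True
      have "y < x" if "y \<in># ?N" for y
        using mx[of y] that disj[OF True] by (metis le_neq_implies_less union_iff)
      then show False using less[OF sz(2) True xd] pw by simp
    next
      case False
      then have xN: "x \<in># ?N" using x by simp
      have "y < x" if "y \<in># ?M" for y
        using mx[of y] that False by (metis le_neq_implies_less union_iff)
      then show False using less[OF sz(1) xN xd] pw by simp
    qed
  qed
  then show ?thesis by (intro exI[of _ k]) (auto simp: k_def intro!: inj_onI)
qed

lemma ex_distinct_eig: "\<exists>k. inj_on (eig k) (mparts d)"
proof -
  obtain k where k: "k > 0" "inj_on (\<lambda>M. \<Sum>x\<in>#M. x ^ k) (mparts d)" using ex_separating_power by blast
  have "M = N" if MN: "M \<in> mparts d" "N \<in> mparts d" and eq: "eig k M = eig k N" for M N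
  proof -
    obtain s where s: "eig k M = theta * s" "val0 s (of_nat (\<Sum>x\<in>#M. x ^ k))"
      using eig_value[OF _ k(1)] MN by (auto simp: mparts_def)
    obtain s' where s': "eig k N = theta * s'" "val0 s' (of_nat (\<Sum>x\<in>#N. x ^ k))"
      using eig_value[OF _ k(1)] MN by (auto simp: mparts_def)
    have "s = s'" using eq s(1) s'(1) theta_pos by simp
    then have "(of_nat (\<Sum>x\<in>#M. x ^ k) :: rat) = of_nat (\<Sum>x\<in>#N. x ^ k)"
      using val0_unique[OF s(2)] s'(2) by metis
    then have "(\<Sum>x\<in>#M. x ^ k) = (\<Sum>x\<in>#N. x ^ k)" by (simp only: of_nat_eq_iff)
    then show ?thesis using k(2) MN by (auto dest: inj_onD)
  qed
  then show ?thesis by (auto intro!: exI[of _ k] inj_onI)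
qed

section \<open>Existence and uniqueness of Jack functions\<close>

text \<open>
  A strictly monotone function for the dominance order on the partitions of \<open>d\<close>.
\<close>
definition dom_rank :: "nat \<Rightarrow> nat multiset \<Rightarrow> nat" where
  "dom_rank d M = (\<Sum>c\<le>d. excess c M)"

lemma excess_large:
  assumes "\<Sum>\<^sub># M \<le> c" shows "excess c M = 0"
proof -
  have "x - c = 0" if "x \<in># M" for x using that assms by (auto dest!: multi_member_split)
  then show ?thesis by (simp add: excess_def)
qed

lemma dom_rank_less:
  assumes "M \<in> mparts d" "N \<in> mparts d" "domin N M" "N \<noteq> M" shows "dom_rank d N < dom_rank d M"
proof -
  have "\<exists>c\<le>d. excess c N < excess c M"
  proof (rule ccontr)
    assume *: "\<not> ?thesis"
    have "excess c M \<le> excess c N" for c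
      using * excess_large[of M c] assms(1) by (cases "c \<le> d") (auto simp: mparts_def not_less)
    then have "domin M N" using assms by (simp add: domin_def)
    then show False using domin_antisym[of M N] assms by (auto simp: mparts_def)
  qed
  then show ?thesis unfolding dom_rank_def using assms(3) by (intro sum_strict_mono_ex1) (auto simp: domin_def)
qed

text \<open>
  Only monomials with exponents in \<open>S\<close> occur in \<open>f\<close>.
\<close>
definition suppon :: "nat multiset set \<Rightarrow> (expo \<Rightarrow> 'a::zero) \<Rightarrow> bool" where
  "suppon S f \<longleftrightarrow> (\<forall>b. f b \<noteq> 0 \<longrightarrow> parts b \<in> S)"

lemma nsop_add: "nsop k (\<lambda>b. f b + g b) = (\<lambda>b. nsop k f b + nsop k g b)"
  using nsop_sum[of k "\<lambda>_. 1" "\<lambda>x. if x then f else g" UNIV] by (simp add: UNIV_bool add.commute)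

lemma nsop_cmult: "nsop k (\<lambda>b. c * f b) = (\<lambda>b. c * nsop k f b)"
  using nsop_sum[of k "\<lambda>_. c" "\<lambda>_. f" "{()}"] by simp

lemma suppon_diff:
  assumes "suppon S f" "suppon S g" shows "suppon S (\<lambda>b. f b - (g b :: 'a::comm_ring_1))"
  unfolding suppon_def
proof (intro allI impI)
  fix b assume "f b - g b \<noteq> 0"
  then have "f b \<noteq> 0 \<or> g b \<noteq> 0" by auto
  then show "parts b \<in> S" using assms unfolding suppon_def by blast
qed

lemma below_diff:
  assumes "below M f" "below M g" shows "below M (\<lambda>b. f b - (g b :: 'a::comm_ring_1))"
  unfolding below_def
proof (intro allI impI)
  fix b assume "f b - g b \<noteq> 0"
  then have "f b \<noteq> 0 \<or> g b \<noteq> 0" by auto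
  then show "domin (parts b) M" using assms unfolding below_def by blast
qed

lemma below_cmult: "below M f \<Longrightarrow> below M (\<lambda>b. c * (f b :: 'a::comm_ring_1))"
  unfolding below_def by (metis mult_zero_right)

lemma homsym_minus_leading:
  assumes "homsym d v" "suppon S v" "M \<in> mparts d"
  shows "suppon (S - {M}) (\<lambda>b. v b - v (part_of M) * (msym M b :: 'a::comm_ring_1))"
  unfolding suppon_def
proof (intro allI impI)
  fix b assume nz: "v b - v (part_of M) * msym M b \<noteq> 0"
  have pM: "parts (part_of M) = M" using assms(3) by (intro part_of) (simp add: mparts_def)
  have "parts b \<noteq> M"
  proof
    assume "parts b = M"
    then have "v b = v (part_of M)" using homsymD(1)[OF assms(1)] pM by metis
    then show False using nz \<open>parts b = M\<close> by (simp add: msym_def)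
  qed
  then show "parts b \<in> S - {M}" using nz assms(2) by (auto simp: msym_def suppon_def)
qed

text \<open>
  On a down-closed set of partitions a triangular operator minus a constant that is different from
  all diagonal entries is surjective; the leading term is removed at a partition of maximal rank.
\<close>
lemma shifted_solvable:
  assumes "S \<subseteq> mparts d" "\<And>M N. M \<in> S \<Longrightarrow> N \<in> mparts d \<Longrightarrow> domin N M \<Longrightarrow> N \<in> S"
    and "c \<notin> eig k ` S" "homsym d v" "suppon S v"
  shows "\<exists>u. homsym d u \<and> suppon S u \<and> (\<forall>b. nsop (Suc k) u b - c * u b = v b)"
  using assms
proof (induction "card S" arbitrary: S v rule: less_induct)
  case less
  note finS = finite_subset[OF less.prems(1) finite_mparts]
  show ?case
  proof (cases "S = {}")
    case True
    then have "v b = 0" for b using less.prems(5) by (auto simp: suppon_def)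
    moreover have "nsop (Suc k) (\<lambda>_. 0) b = 0" for b using nsop_sum[of "Suc k" "\<lambda>_. 0" "\<lambda>_ _. 0" "{}"] by simp
    ultimately show ?thesis by (intro exI[of _ "\<lambda>_. 0"]) (simp add: homsym_zero suppon_def)
  next
    case False
    obtain M where M: "M \<in> S" "\<And>N. N \<in> S \<Longrightarrow> dom_rank d N \<le> dom_rank d M"
    proof -
      have "Max (dom_rank d ` S) \<in> dom_rank d ` S" using finS False by (intro Max_in) auto
      then obtain M where "M \<in> S" "Max (dom_rank d ` S) = dom_rank d M" by (elim imageE)
      then show thesis using that[of M] Max_ge[of "dom_rank d ` S"] finS by auto
    qed
    have Md: "M \<in> mparts d" using M(1) less.prems(1) by auto
    have pM: "parts (part_of M) = M" using Md by (intro part_of) (simp add: mparts_def)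
    \<comment> \<open>The multiple of \<open>m\<^sub>M\<close> that produces the leading term of \<open>v\<close>.\<close>
    define a where "a = v (part_of M) / (eig k M - c)"
    have ne: "eig k M - c \<noteq> 0" using less.prems(3) M(1) by auto
    define w where "w b = a * nsop (Suc k) (msym M) b - c * (a * msym M b)" for b
    have w: "homsym d w" unfolding w_def by (intro homsym_diff homsym_cmult homsym_nsop homsym_msym Md)
    have wS: "suppon S w"
      unfolding suppon_def
    proof (intro allI impI)
      fix b assume nz: "w b \<noteq> 0"
      have "domin (parts b) M"
        using nz below_nsop[OF below_msym, of M "Suc k"] unfolding w_def below_def msym_def
        by (auto simp: domin_refl split: if_splits)
      moreover have "parts b \<in> mparts d" using nz w by (auto simp: homsym_def)
      ultimately show "parts b \<in> S" using less.prems(2)[OF M(1)] by blast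
    qed
    have lead: "w (part_of M) = v (part_of M)"
    proof -
      have "w (part_of M) = a * (eig k M - c)" by (simp add: w_def eig_def msym_def pM algebra_simps)
      then show ?thesis using ne by (simp add: a_def)
    qed
    let ?v = "\<lambda>b. v b - w b"
    have v': "homsym d ?v" by (intro homsym_diff less.prems(4) w)
    have "suppon (S - {M}) ?v"
    proof -
      have "suppon S ?v" using less.prems(5) wS by (rule suppon_diff)
      from homsym_minus_leading[OF v' this Md] show ?thesis by (simp add: lead)
    qed
    moreover have "N \<in> S - {M}" if "M' \<in> S - {M}" "N \<in> mparts d" "domin N M'" for M' N
    proof -
      have "N \<in> S" using that less.prems(2) by blast
      moreover have "N \<noteq> M"
        using dom_rank_less[of M' d M] M(2)[of M'] that Md less.prems(1) by (auto simp: not_less)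
      ultimately show ?thesis by simp
    qed
    moreover have "card (S - {M}) < card S" using finS M(1) by (meson card_Diff1_less)
    moreover have "S - {M} \<subseteq> mparts d" "c \<notin> eig k ` (S - {M})" using less.prems by auto
    ultimately obtain u where u: "homsym d u" "suppon (S - {M}) u" "\<And>b. nsop (Suc k) u b - c * u b = v b - w b"
      using less.hyps[of "S - {M}" ?v] v' by blast
    let ?u = "\<lambda>b. u b + a * msym M b"
    have "homsym d ?u" by (intro homsym_add u homsym_cmult homsym_msym Md)
    moreover have "suppon S ?u" using u(2) M(1) by (auto simp: suppon_def msym_def)
    moreover have "nsop (Suc k) ?u b - c * ?u b = v b" for b
      using u(3)[of b] by (simp add: nsop_add nsop_cmult w_def algebra_simps)
    ultimately show ?thesis by blast
  qed
qed

text \<open>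
  The function \<open>f\<close> is \<open>m\<^sub>M\<close> plus a combination of smaller monomial symmetric functions.
\<close>
definition unitriang :: "nat multiset \<Rightarrow> symfun \<Rightarrow> bool" where
  "unitriang M f \<longleftrightarrow> homsym (\<Sum>\<^sub># M) f \<and> below M f \<and> (\<forall>b. parts b = M \<longrightarrow> f b = 1)"

lemma exists_eigenfunction:
  assumes inj: "inj_on (eig k) (mparts d)" and M: "M \<in> mparts d"
  shows "\<exists>f. unitriang M f \<and> (\<forall>b. nsop (Suc k) f b = eig k M * f b)"
proof -
  let ?S = "{N \<in> mparts d. domin N M \<and> N \<noteq> M}"
  have pM: "parts (part_of M) = M" using M by (intro part_of) (simp add: mparts_def)
  define v where "v b = eig k M * msym M b - nsop (Suc k) (msym M) b" for b
  have v: "homsym d v" unfolding v_def by (intro homsym_diff homsym_cmult homsym_nsop homsym_msym M)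
  have vS: "suppon ?S v"
    unfolding suppon_def
  proof (intro allI impI)
    fix b assume nz: "v b \<noteq> 0"
    have "domin (parts b) M"
      using nz below_nsop[OF below_msym, of M "Suc k"] unfolding v_def below_def msym_def
      by (auto simp: domin_refl split: if_splits)
    moreover have "parts b \<in> mparts d" using nz v by (auto simp: homsym_def)
    moreover have "parts b \<noteq> M"
    proof
      assume e: "parts b = M"
      then have "nsop (Suc k) (msym M) b = eig k M"
        unfolding eig_def using homsymD(1)[OF homsym_nsop[OF homsym_msym[OF M]]] pM by metis
      then show False using nz e by (simp add: v_def msym_def)
    qed
    ultimately show "parts b \<in> ?S" by blast
  qed
  have "\<exists>u. homsym d u \<and> suppon ?S u \<and> (\<forall>b. nsop (Suc k) u b - eig k M * u b = v b)"
  proof (rule shifted_solvable[OF _ _ _ v vS])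
    show "?S \<subseteq> mparts d" by auto
    show "eig k M \<notin> eig k ` ?S" using inj M by (auto dest: inj_onD)
    fix M' N assume a: "M' \<in> ?S" "N \<in> mparts d" "domin N M'"
    then have "domin N M" using domin_trans by blast
    moreover have "N \<noteq> M" using a M domin_antisym[of M M'] by (auto simp: mparts_def)
    ultimately show "N \<in> ?S" using a by blast
  qed
  then obtain u where u: "homsym d u" "suppon ?S u" "\<And>b. nsop (Suc k) u b - eig k M * u b = v b" by blast
  let ?f = "\<lambda>b. msym M b + u b"
  have "homsym d ?f" by (intro homsym_add homsym_msym M u)
  moreover have "below M ?f" using u(2) by (auto simp: below_def suppon_def msym_def domin_refl)
  moreover have "?f b = 1" if "parts b = M" for b using that u(2) by (auto simp: suppon_def msym_def)
  moreover have "nsop (Suc k) ?f b = eig k M * ?f b" for b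
    using u(3)[of b] by (simp add: nsop_add v_def algebra_simps)
  ultimately show ?thesis using M unfolding unitriang_def mparts_def by (intro exI[of _ ?f]) auto
qed

lemma unitriang_iff_expansion:
  assumes l: "is_partition lam"
  shows "(\<exists>K. \<forall>a. f a = monomial_sf lam a +
           (\<Sum>mu | is_partition mu \<and> mu \<noteq> lam \<and> lam \<succcurlyeq> mu. K mu * monomial_sf mu a))
     \<longleftrightarrow> unitriang (parts lam) f"
proof -
  let ?M = "parts lam" and ?d = "psize lam"
  let ?S = "{mu. is_partition mu \<and> mu \<noteq> lam \<and> lam \<succcurlyeq> mu}"
  have MPd: "?M \<in> mparts ?d" by simp
  have S: "?S \<subseteq> part_of ` {N \<in> mparts ?d. domin N ?M \<and> N \<noteq> ?M}"
  proof
    fix m assume m: "m \<in> ?S"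
    then have "parts m \<in> {N \<in> mparts ?d. domin N ?M \<and> N \<noteq> ?M}"
      using l by (auto simp: majorizes_iff_domin domin_def dest: parts_inj_partition)
    moreover have "m = part_of (parts m)" using m by (simp add: part_of_parts)
    ultimately show "m \<in> part_of ` {N \<in> mparts ?d. domin N ?M \<and> N \<noteq> ?M}" by blast
  qed
  then have fin: "finite ?S" by (rule finite_subset) simp
  have Sp: "parts m \<noteq> ?M" "domin (parts m) ?M" "psize m = ?d" "is_partition m" if "m \<in> ?S" for m
    using that l parts_inj_partition[of m lam] majorizes_iff_domin[of lam m]
    by (auto simp: majorizes_def)
  show ?thesis
  proof
    assume "\<exists>K. \<forall>a. f a = monomial_sf lam a + (\<Sum>mu\<in>?S. K mu * monomial_sf mu a)"
    then obtain K where K: "f a = msym ?M a + (\<Sum>mu\<in>?S. K mu * msym (parts mu) a)" for a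
      by (auto simp: monomial_sf_eq)
    have "homsym ?d f"
    proof -
      have "homsym ?d (\<lambda>a. msym ?M a + (\<Sum>mu\<in>?S. K mu * msym (parts mu) a))"
        using Sp(3) by (intro homsym_add homsym_msym homsym_sum homsym_cmult) simp_all
      then show ?thesis unfolding K[abs_def] .
    qed
    moreover have "below ?M f"
      unfolding below_def
    proof (intro allI impI, rule ccontr)
      fix b assume "f b \<noteq> 0" and n: "\<not> domin (parts b) ?M"
      have "msym ?M b = (0 :: ratfun)" using n by (auto simp: msym_def domin_refl)
      moreover have "K m * msym (parts m) b = 0" if "m \<in> ?S" for m using Sp(2)[OF that] n by (auto simp: msym_def)
      ultimately show False using \<open>f b \<noteq> 0\<close> unfolding K by (simp add: sum.neutral)
    qed
    moreover have "f b = 1" if pb: "parts b = ?M" for b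
    proof -
      have "K m * msym (parts m) b = 0" if m: "m \<in> ?S" for m using Sp(1)[OF m] pb by (auto simp: msym_def)
      then show ?thesis using pb unfolding K by (simp add: sum.neutral msym_def)
    qed
    ultimately show "unitriang ?M f" by (simp add: unitriang_def)
  next
    assume u: "unitriang ?M f"
    then have sd: "homsym ?d f" by (simp add: unitriang_def)
    have "f a = monomial_sf lam a + (\<Sum>mu\<in>?S. f mu * monomial_sf mu a)" for a
    proof (cases "parts a = ?M")
      case True
      have "f m * monomial_sf m a = 0" if m: "m \<in> ?S" for m
        using Sp(1)[OF m] True by (auto simp: msym_def monomial_sf_eq)
      then show ?thesis using True u by (simp add: sum.neutral unitriang_def monomial_sf_eq msym_def)
    next
      case False
      show ?thesis
      proof (cases "f a = 0")
        case True
        have "f m * monomial_sf m a = 0" if m: "m \<in> ?S" for m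
          using True homsymD(1)[OF sd, of m a] by (auto simp: msym_def monomial_sf_eq)
        then show ?thesis using False True by (simp add: sum.neutral monomial_sf_eq msym_def)
      next
        case nz: False
        let ?m = "part_of (parts a)"
        have m: "is_partition ?m" "parts ?m = parts a" by (simp_all add: part_of)
        have "domin (parts a) ?M" using u nz by (auto simp: unitriang_def below_def)
        then have mS: "?m \<in> ?S" using m l False by (auto simp: majorizes_iff_domin)
        have "(\<Sum>mu\<in>?S. f mu * monomial_sf mu a) = (\<Sum>mu\<in>{?m}. f mu * monomial_sf mu a)"
        proof (intro sum.mono_neutral_right fin ballI)
          show "{?m} \<subseteq> ?S" using mS by blast
          fix x assume x: "x \<in> ?S - {?m}"
          have "parts x \<noteq> parts a"
          proof
            assume "parts x = parts a"
            then have "x = ?m" using Sp(4)[of x] x m by (intro parts_inj_partition) simp_all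
            then show False using x by simp
          qed
          then show "f x * monomial_sf x a = 0" by (simp add: monomial_sf_eq msym_def)
        qed
        also have "\<dots> = f a" using m homsymD(1)[OF sd, of ?m a] by (simp add: monomial_sf_eq msym_def)
        finally show ?thesis using False by (simp add: monomial_sf_eq msym_def)
      qed
    qed
    then show "\<exists>K. \<forall>a. f a = monomial_sf lam a + (\<Sum>mu\<in>?S. K mu * monomial_sf mu a)" by blast
  qed
qed

lemma jack_family_iff:
  "jack_family P \<longleftrightarrow> (\<forall>lam. is_partition lam \<longrightarrow> unitriang (parts lam) (P lam)) \<and>
     (\<forall>lam mu. is_partition lam \<longrightarrow> is_partition mu \<longrightarrow> lam \<noteq> mu \<longrightarrow> jack_inner (P lam) (P mu) = 0)"
  unfolding jack_family_def using unitriang_iff_expansion by meson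

lemma jack_family_exists: "\<exists>P. jack_family P"
proof -
  have "\<exists>k. inj_on (eig k) (mparts d)" for d by (rule ex_distinct_eig)
  then obtain k where k: "\<And>d. inj_on (eig (k d)) (mparts d)" by metis
  have "\<exists>f. is_partition lam \<longrightarrow> unitriang (parts lam) f \<and> (\<forall>b. nsop (Suc (k (psize lam))) f b = eig (k (psize lam)) (parts lam) * f b)" for lam
    using exists_eigenfunction[OF k[of "psize lam"], of "parts lam"] by auto
  then obtain P where P: "\<And>lam. is_partition lam \<Longrightarrow> unitriang (parts lam) (P lam)"
    "\<And>lam b. is_partition lam \<Longrightarrow> nsop (Suc (k (psize lam))) (P lam) b = eig (k (psize lam)) (parts lam) * P lam b"
    by metis
  have sd: "homsym (psize lam) (P lam)" if "is_partition lam" for lam using P(1)[OF that] by (simp add: unitriang_def)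
  have "jack_inner (P lam) (P mu) = 0" if lm: "is_partition lam" "is_partition mu" "lam \<noteq> mu" for lam mu
  proof (cases "psize lam = psize mu")
    case False
    then show ?thesis using jack_inner_diff_degree sd lm by blast
  next
    case True
    let ?d = "psize mu" and ?T = "nsop (Suc (k (psize mu)))" and ?e = "\<lambda>l. eig (k (psize mu)) (parts l)"
    have s: "homsym ?d (P lam)" "homsym ?d (P mu)" using sd[OF lm(1)] sd[OF lm(2)] True by simp_all
    have T: "?T (P lam) = (\<lambda>b. ?e lam * P lam b)" "?T (P mu) = (\<lambda>b. ?e mu * P mu b)"
      using P(2)[OF lm(1)] P(2)[OF lm(2)] True by (simp_all add: fun_eq_iff)
    have "?e lam * jack_inner (P lam) (P mu) = jack_inner (P mu) (\<lambda>b. ?e lam * P lam b)"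
      using jack_inner_cmult_right[OF s(2,1)] jack_inner_commute[OF s] by simp
    also have "\<dots> = jack_inner (?T (P lam)) (P mu)"
      unfolding T by (rule jack_inner_commute[OF s(2) homsym_cmult[OF s(1)]])
    also have "\<dots> = jack_inner (P lam) (?T (P mu))" by (rule nsop_selfadjoint[OF s])
    also have "\<dots> = ?e mu * jack_inner (P lam) (P mu)"
      unfolding T by (rule jack_inner_cmult_right[OF s])
    finally have *: "?e lam * jack_inner (P lam) (P mu) = ?e mu * jack_inner (P lam) (P mu)" .
    have "parts lam \<noteq> parts mu" using lm parts_inj_partition by blast
    then have "?e lam \<noteq> ?e mu" using k[of ?d] True by (metis inj_onD parts_in_mparts)
    then show ?thesis using * by simp
  qed
  then show ?thesis using P(1) jack_family_iff by blast
qed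

text \<open>
  The monomial symmetric functions below \<open>lam\<close> are combinations of the members of the family below
  \<open>lam\<close>, by induction along the dominance order.
\<close>
lemma jack_orth_msym:
  assumes "jack_family P" "is_partition lam" "M \<in> mparts (psize lam)" "M \<noteq> parts lam" "domin M (parts lam)"
  shows "jack_inner (P lam) (msym M) = 0"
  using assms(3-5)
proof (induction "dom_rank (psize lam) M" arbitrary: M rule: less_induct)
  case less
  let ?d = "psize lam" and ?m = "part_of M"
  have M0: "0 \<notin># M" using less.prems by (simp add: mparts_def)
  have m: "is_partition ?m" "parts ?m = M" using part_of[OF M0] by auto
  have md: "psize ?m = ?d" using less.prems m by (metis parts_in_mparts)
  have uP: "unitriang M (P ?m)" "unitriang (parts lam) (P lam)"
    using assms(1,2) m unfolding jack_family_iff by (metis, blast)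
  then have s: "homsym ?d (P ?m)" "homsym ?d (P lam)" using less.prems(1) by (simp_all add: unitriang_def mparts_def)
  have "lam \<noteq> ?m" using m(2) less.prems by auto
  then have "0 = jack_inner (P lam) (P ?m)" using assms(1,2) m(1) by (simp add: jack_family_iff)
  also have "P ?m = (\<lambda>b. \<Sum>N\<in>mparts ?d. P ?m (part_of N) * msym N b)"
    by (rule ext) (rule homsym_expand[OF s(1)])
  also have "jack_inner (P lam) \<dots> = (\<Sum>N\<in>mparts ?d. P ?m (part_of N) * jack_inner (P lam) (msym N))"
    by (rule jack_inner_sum_right[OF s(2) finite_mparts homsym_msym])
  also have "\<dots> = (\<Sum>N\<in>{M}. P ?m (part_of N) * jack_inner (P lam) (msym N))"
  proof (intro sum.mono_neutral_right ballI finite_mparts)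
    show "{M} \<subseteq> mparts ?d" using less.prems by simp
    fix N assume N: "N \<in> mparts ?d - {M}"
    have pN: "parts (part_of N) = N" using N by (intro part_of) (auto simp: mparts_def)
    show "P ?m (part_of N) * jack_inner (P lam) (msym N) = 0"
    proof (cases "P ?m (part_of N) = 0")
      case False
      then have NM: "domin N M" using uP(1) pN by (metis below_def unitriang_def)
      then have "dom_rank ?d N < dom_rank ?d M" using dom_rank_less N less.prems by blast
      moreover have "domin N (parts lam)" using NM less.prems domin_trans by blast
      moreover have "N \<noteq> parts lam"
        using NM less.prems domin_antisym[of N M] M0 by auto
      ultimately have "jack_inner (P lam) (msym N) = 0" using less.hyps N by blast
      then show ?thesis by simp
    qed simp
  qed
  also have "\<dots> = jack_inner (P lam) (msym M)" using uP(1) m(2) by (simp add: unitriang_def)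
  finally show ?case by simp
qed

lemma jack_orth_below:
  assumes "jack_family P" "is_partition lam" "homsym (psize lam) u" "below (parts lam) u"
    and "u lam = 0"
  shows "jack_inner (P lam) u = 0"
proof -
  let ?d = "psize lam"
  have s: "homsym ?d (P lam)" using assms(1,2) by (auto simp: jack_family_iff unitriang_def)
  have "u = (\<lambda>b. \<Sum>N\<in>mparts ?d. u (part_of N) * msym N b)" by (rule ext) (rule homsym_expand[OF assms(3)])
  then have "jack_inner (P lam) u = jack_inner (P lam) (\<lambda>b. \<Sum>N\<in>mparts ?d. u (part_of N) * msym N b)" by (rule arg_cong)
  also have "\<dots> = (\<Sum>N\<in>mparts ?d. u (part_of N) * jack_inner (P lam) (msym N))"
    by (rule jack_inner_sum_right[OF s finite_mparts homsym_msym])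
  also have "\<dots> = 0"
  proof (intro sum.neutral ballI)
    fix N assume N: "N \<in> mparts ?d"
    have pN: "parts (part_of N) = N" using N by (intro part_of) (auto simp: mparts_def)
    show "u (part_of N) * jack_inner (P lam) (msym N) = 0"
    proof (cases "u (part_of N) = 0")
      case False
      then have "domin N (parts lam)" using assms(4) pN by (auto simp: below_def)
      moreover have "N \<noteq> parts lam" using False assms(2,5) part_of_parts by metis
      ultimately show ?thesis using jack_orth_msym[OF assms(1,2) N] by simp
    qed simp
  qed
  finally show ?thesis .
qed

text \<open>
  The difference of two candidates is supported strictly below \<open>lam\<close>, and both candidates are
  orthogonal to everything supported there, so it is orthogonal to itself.
\<close>
lemma jack_family_unique:
  assumes "jack_family P" "jack_family Q" "is_partition lam" shows "P lam = Q lam"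
proof
  fix a
  let ?d = "psize lam" and ?v = "\<lambda>b. P lam b - Q lam b"
  have s: "homsym ?d (P lam)" "homsym ?d (Q lam)" and b: "below (parts lam) (P lam)" "below (parts lam) (Q lam)"
    and l: "P lam lam = 1" "Q lam lam = 1"
    using assms by (auto simp: jack_family_iff unitriang_def)
  have v: "homsym ?d ?v" by (rule homsym_diff[OF s])
  have bv: "below (parts lam) ?v" using b by (rule below_diff)
  have o: "jack_inner (P lam) ?v = 0" "jack_inner (Q lam) ?v = 0"
    using jack_orth_below assms v bv l by simp_all
  have "jack_inner ?v ?v = jack_inner ?v (\<lambda>b. P lam b + (- 1) * Q lam b)" by simp
  also have "\<dots> = jack_inner ?v (P lam) + jack_inner ?v (\<lambda>b. (- 1) * Q lam b)"
    by (rule jack_inner_add_right[OF v s(1) homsym_cmult[OF s(2)]])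
  also have "\<dots> = jack_inner ?v (P lam) - jack_inner ?v (Q lam)"
    unfolding jack_inner_cmult_right[OF v s(2)] by simp
  also have "\<dots> = 0" using o jack_inner_commute[OF v s(1)] jack_inner_commute[OF v s(2)] by simp
  finally have "?v a = 0" by (rule jack_inner_self_zero[OF v])
  then show "P lam a = Q lam a" by simp
qed

text \<open>
  The error \<open>v\<close> of the eigenvalue equation is supported strictly below \<open>lam\<close>, and so is its image under
  the self-adjoint triangular operator; therefore \<open>v\<close> is orthogonal to itself.
\<close>
lemma jack_family_eigen:
  assumes P: "jack_family P" and l: "is_partition lam"
  shows "\<exists>e. \<forall>b. nsop k (P lam) b = e * P lam b"
proof -
  let ?d = "psize lam" and ?f = "P lam"
  define e where "e = nsop k ?f lam"
  let ?v = "\<lambda>b. nsop k ?f b - e * ?f b"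
  have s: "homsym ?d ?f" and b: "below (parts lam) ?f" and l1: "?f lam = 1"
    using assms by (auto simp: jack_family_iff unitriang_def)
  have v: "homsym ?d ?v" by (intro homsym_diff homsym_nsop homsym_cmult s)
  have bv: "below (parts lam) ?v" by (intro below_diff below_cmult below_nsop b)
  have v0: "?v lam = 0" using l1 by (simp add: e_def)
  have Tv: "homsym ?d (nsop k ?v)" "below (parts lam) (nsop k ?v)" by (intro homsym_nsop v, intro below_nsop bv)
  have Tv0: "nsop k ?v lam = 0"
  proof -
    have "?v = (\<lambda>b. \<Sum>N\<in>mparts ?d. ?v (part_of N) * msym N b)" by (rule ext) (rule homsym_expand[OF v])
    then have "nsop k ?v = nsop k (\<lambda>b. \<Sum>N\<in>mparts ?d. ?v (part_of N) * msym N b)" by (rule arg_cong)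
    then have "nsop k ?v lam = (\<Sum>N\<in>mparts ?d. ?v (part_of N) * nsop k (msym N) lam)" by (simp add: nsop_sum)
    also have "\<dots> = 0"
    proof (intro sum.neutral ballI)
      fix N assume N: "N \<in> mparts ?d"
      have pN: "parts (part_of N) = N" using N by (intro part_of) (auto simp: mparts_def)
      show "?v (part_of N) * nsop k (msym N) lam = 0"
      proof (rule ccontr)
        assume nz: "?v (part_of N) * nsop k (msym N) lam \<noteq> 0"
        then have "domin (parts lam) N" using below_nsop[OF below_msym[of N], of k] by (auto simp: below_def)
        moreover have "domin N (parts lam)" using nz bv pN by (auto simp: below_def)
        ultimately have "N = parts lam" using N domin_antisym[of N "parts lam"] by (auto simp: mparts_def)
        then show False using nz v0 part_of_parts[OF l] by simp
      qed
    qed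
    finally show ?thesis .
  qed
  have "jack_inner ?v ?v = jack_inner ?v (\<lambda>b. nsop k ?f b + (- e) * ?f b)" by simp
  also have "\<dots> = jack_inner ?v (nsop k ?f) + jack_inner ?v (\<lambda>b. (- e) * ?f b)"
    by (rule jack_inner_add_right[OF v homsym_nsop[OF s] homsym_cmult[OF s]])
  also have "\<dots> = jack_inner (nsop k ?v) ?f - e * jack_inner ?v ?f"
    unfolding jack_inner_cmult_right[OF v s] nsop_selfadjoint[OF v s] by simp
  also have "\<dots> = 0"
    using jack_orth_below[OF P l v bv v0] jack_orth_below[OF P l Tv Tv0]
      jack_inner_commute[OF s v] jack_inner_commute[OF s Tv(1)] by simp
  finally have "?v a = 0" for a by (rule jack_inner_self_zero[OF v])
  then show ?thesis by (intro exI[of _ e]) simp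
qed

lemma jack_sf_family:
  assumes "jack_family P" "is_partition lam" shows "jack_sf lam = P lam"
  unfolding jack_sf_def
proof (rule the_equality)
  show "\<exists>Q. jack_family Q \<and> P lam = Q lam" using assms(1) by blast
  fix f assume "\<exists>Q. jack_family Q \<and> f = Q lam"
  then show "f = P lam" using jack_family_unique assms by blast
qed

lemma jack_sf_unitriang: "is_partition lam \<Longrightarrow> unitriang (parts lam) (jack_sf lam)"
  using jack_family_exists jack_sf_family jack_family_iff by metis

lemma jack_sf_eigen: "is_partition lam \<Longrightarrow> \<exists>e. \<forall>b. nsop k (jack_sf lam) b = e * jack_sf lam b"
  using jack_family_exists jack_sf_family jack_family_eigen by metis

section \<open>The Calogero-Sutherland equation\<close>

lemma dunkl_symm:
  assumes "symm f" shows "dunkl t i f b = of_nat (lkp b i) * f b"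
proof -
  have "f (swp i j c) = f c" for j c using symmD[OF assms, of "swp i j c" c] by simp
  then show ?thesis by (simp add: dunkl_def)
qed

text \<open>
  The square of the Dunkl operator with distinguished variable \<open>x\<^sub>i\<close>, on symmetric functions; the sum
  over finitely many variables is the Calogero-Sutherland operator.
\<close>
definition csop :: "(expo \<Rightarrow> ratfun) \<Rightarrow> nat \<Rightarrow> expo \<Rightarrow> ratfun" where
  "csop f i b = of_nat (lkp b i) ^ 2 * f b + theta * (\<Sum>j\<in>kys b - {i}. \<Sum>r\<in>{1..lkp b j}.
     (of_nat (lkp b i) - of_nat (lkp b j) + 2 * of_nat r) * f (b + sgl i r - sgl j r))"

lemma dunkl_dunkl_symm:
  assumes "symm f" shows "dunkl theta i (dunkl theta i f) b = csop f i b"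
proof -
  have *: "dunkl theta i f (b + sgl i r - sgl j r) - dunkl theta i f (swp i j (b + sgl i r - sgl j r))
      = (of_nat (lkp b i) - of_nat (lkp b j) + 2 * of_nat r) * f (b + sgl i r - sgl j r)"
    if "j \<in> kys b - {i}" "r \<in> {1..lkp b j}" for j r
  proof -
    let ?c = "b + sgl i r - sgl j r"
    have "f (swp i j ?c) = f ?c" using symmD[OF assms, of "swp i j ?c" ?c] by simp
    moreover have "lkp ?c i = lkp b i + r" "lkp (swp i j ?c) i = lkp b j - r"
      using that by (auto simp: lkp_swp lkp_diff_single lkp_add_single)
    ultimately show ?thesis using that by (simp add: dunkl_symm[OF assms] of_nat_diff algebra_simps)
  qed
  have "dunkl theta i (dunkl theta i f) b = of_nat (lkp b i) * (of_nat (lkp b i) * f b)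
    + theta * (\<Sum>j\<in>kys b - {i}. \<Sum>r\<in>{1..lkp b j}. (of_nat (lkp b i) - of_nat (lkp b j) + 2 * of_nat r) * f (b + sgl i r - sgl j r))"
    unfolding dunkl_def[of theta i "dunkl theta i f"] dunkl_symm[OF assms, of theta i b]
    by (intro arg_cong2[where f = "(+)"] arg_cong[where f = "\<lambda>x. theta * x"] refl sum.cong *) auto
  then show ?thesis by (simp add: csop_def power2_eq_square mult.assoc)
qed

lemma antisym_sum:
  fixes h :: "nat \<Rightarrow> 'a::field_char_0"
  assumes "\<And>u. u \<le> m \<Longrightarrow> h (m - u) = - h u" shows "(\<Sum>u\<in>{0..m}. h u) = 0"
proof -
  have "(\<Sum>u\<in>{0..m}. h u) = (\<Sum>u\<in>{0..m}. h (m - u))"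
    by (rule sum.reindex_bij_witness[of _ "\<lambda>u. m - u" "\<lambda>u. m - u"]) auto
  also have "\<dots> = - (\<Sum>u\<in>{0..m}. h u)" using assms by (simp add: sum_negf)
  finally show ?thesis by (simp add: eq_neg_iff_add_eq_0 flip: mult_2)
qed

lemma transfer_swap:
  assumes "i \<noteq> j" "lkp b i = 0" "r \<le> lkp b j"
  shows "swp i j (b + sgl i r - sgl j r) = b + sgl i (lkp b j - r) - sgl j (lkp b j - r)"
  using assms by (intro poly_mapping_eqI) (auto simp: lkp_swp lkp_diff_single lkp_add_single transpose_def)

lemma csop_absent:
  assumes "symm f" "i \<notin> kys b" shows "csop f i b = theta * of_nat (psize b) * f b"
proof -
  have bi: "lkp b i = 0" using assms(2) by (simp add: in_keys_iff)
  have "(\<Sum>r\<in>{1..lkp b j}. (of_nat (lkp b i) - of_nat (lkp b j) + 2 * of_nat r) * f (b + sgl i r - sgl j r))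
     = of_nat (lkp b j) * f b" if j: "j \<in> kys b - {i}" for j
  proof -
    let ?q = "lkp b j"
    \<comment> \<open>The terms for \<open>r\<close> and \<open>b\<^sub>j - r\<close> cancel, except that \<open>r = 0\<close> is missing from the sum.\<close>
    define h where "h r = (2 * of_nat r - of_nat ?q) * f (b + sgl i r - sgl j r)" for r
    have ij: "i \<noteq> j" using j by auto
    have "h (?q - r) = - h r" if "r \<le> ?q" for r
    proof -
      have "f (b + sgl i (?q - r) - sgl j (?q - r)) = f (b + sgl i r - sgl j r)"
        using transfer_swap[OF ij bi that] by (metis assms(1) parts_swp symmD)
      then show ?thesis using that by (simp add: h_def of_nat_diff algebra_simps)
    qed
    then have "(\<Sum>r\<in>{0..?q}. h r) = 0" by (rule antisym_sum)
    then have "(\<Sum>r\<in>{1..?q}. h r) = - h 0" by (simp add: sum.atLeast_Suc_atMost eq_neg_iff_add_eq_0 add.commute)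
    also have "\<dots> = of_nat ?q * f b" by (simp add: h_def)
    finally show ?thesis using bi by (simp add: h_def)
  qed
  then have "csop f i b = theta * (\<Sum>j\<in>kys b - {i}. of_nat (lkp b j) * f b)"
    using bi by (simp add: csop_def)
  also have "\<dots> = theta * of_nat (psize b) * f b"
    using assms(2) by (simp add: psize_def sum_distrib_right)
  finally show ?thesis .
qed

lemma csop_swp:
  assumes "symm f" "i \<notin> kys b" "j \<in> kys b"
  shows "csop f i (swp i j b) = csop f j b"
proof -
  have bi: "lkp b i = 0" and ij: "i \<noteq> j" using assms by (auto simp: in_keys_iff)
  have l: "lkp (swp i j b) i = lkp b j" "\<And>k. k \<in> kys b - {j} \<Longrightarrow> lkp (swp i j b) k = lkp b k"
    using bi ij assms(2) by (auto simp: lkp_swp transpose_def)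
  have k: "kys (swp i j b) - {i} = kys b - {j}"
    using bi ij assms(2) by (auto simp: in_keys_iff lkp_swp transpose_def split: if_splits)
  have f1: "f (swp i j b) = f b" by (rule symmD[OF assms(1)]) simp
  have f2: "f (swp i j b + sgl i r - sgl l r) = f (b + sgl j r - sgl l r)" if "l \<in> kys b - {j}" for l r
  proof -
    have "swp i j (b + sgl j r - sgl l r) = swp i j b + sgl i r - sgl l r"
      using that ij assms(2) by (intro poly_mapping_eqI) (auto simp: lkp_swp lkp_diff_single lkp_add_single transpose_def)
    then show ?thesis by (metis assms(1) parts_swp symmD)
  qed
  show ?thesis unfolding csop_def k l(1) f1
    by (intro arg_cong2[where f = "(+)"] arg_cong[where f = "\<lambda>x. theta * x"] refl sum.cong)
      (auto simp: l(2) f2)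
qed

text \<open>
  The exchange of \<open>x\<^sub>i\<close> and \<open>x\<^sub>j\<close> turns \<open>r\<close> into \<open>b\<^sub>j - r\<close>, so the sum over \<open>r\<close> in the outermost Dunkl
  operator telescopes. What remains is, for every variable that occurs in \<open>b\<close>, the squared Dunkl
  operator minus its part free of the distinguished variable.
\<close>
lemma nsop3:
  assumes "homsym d f"
  shows "nsop 3 f b = theta * (\<Sum>j\<in>kys b. csop f j b - theta * of_nat (psize b) * f b)"
proof -
  define i where "i = fresh b"
  have i: "i \<notin> kys b" unfolding i_def by (rule fresh)
  then have bi: "lkp b i = 0" by (simp add: in_keys_iff)
  have s: "symm f" using assms by (simp add: homsym_def)
  define g where "g = csop f i"
  have "nsop 3 f b = dunkl theta i (\<lambda>b. dunkl theta i (dunkl theta i f) b) b"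
    by (simp add: nsop_def eval_nat_numeral flip: i_def)
  also have "\<dots> = dunkl theta i g b" unfolding dunkl_dunkl_symm[OF s] g_def ..
  also have "\<dots> = theta * (\<Sum>j\<in>kys b. \<Sum>r\<in>{1..lkp b j}. g (b + sgl i r - sgl j r) - g (swp i j (b + sgl i r - sgl j r)))"
    using i bi by (simp add: dunkl_def)
  also have "(\<Sum>j\<in>kys b. \<Sum>r\<in>{1..lkp b j}. g (b + sgl i r - sgl j r) - g (swp i j (b + sgl i r - sgl j r)))
     = (\<Sum>j\<in>kys b. csop f j b - theta * of_nat (psize b) * f b)"
  proof (rule sum.cong[OF refl])
    fix j assume j: "j \<in> kys b"
    let ?q = "lkp b j"
    have ij: "i \<noteq> j" using i j by auto
    define h where "h r = g (b + sgl i r - sgl j r)" for r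
    have "(\<Sum>r\<in>{1..?q}. g (b + sgl i r - sgl j r) - g (swp i j (b + sgl i r - sgl j r)))
       = (\<Sum>r\<in>{1..?q}. h r - h (?q - r))"
      using transfer_swap[OF ij bi] by (intro sum.cong refl) (simp add: h_def)
    also have "\<dots> = (\<Sum>r\<in>{1..?q}. h r) - (\<Sum>r\<in>{1..?q}. h (?q - r))" by (rule sum_subtractf)
    also have "(\<Sum>r\<in>{1..?q}. h (?q - r)) = (\<Sum>r\<in>{0..<?q}. h r)"
      by (rule sum.reindex_bij_witness[of _ "\<lambda>u. ?q - u" "\<lambda>u. ?q - u"]) auto
    also have "(\<Sum>r\<in>{1..?q}. h r) - (\<Sum>r\<in>{0..<?q}. h r) = h ?q - h 0"
    proof -
      have "(\<Sum>r\<in>{0..?q}. h r) = h 0 + (\<Sum>r\<in>{1..?q}. h r)" by (simp add: sum.atLeast_Suc_atMost)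
      moreover have "(\<Sum>r\<in>{0..?q}. h r) = (\<Sum>r\<in>{0..<?q}. h r) + h ?q"
        by (simp add: atLeast0AtMost lessThan_Suc_atMost[symmetric] atLeast0LessThan)
      ultimately show ?thesis by (simp add: algebra_simps)
    qed
    also have "h 0 = theta * of_nat (psize b) * f b"
      using csop_absent[OF s i] by (simp add: h_def g_def)
    also have "h ?q = csop f j b"
    proof -
      have "b + sgl i ?q - sgl j ?q = swp i j b"
        using ij bi by (intro poly_mapping_eqI) (auto simp: lkp_swp lkp_diff_single lkp_add_single transpose_def)
      then show ?thesis using csop_swp[OF s i j] by (simp add: h_def g_def)
    qed
    finally show "(\<Sum>r\<in>{1..?q}. g (b + sgl i r - sgl j r) - g (swp i j (b + sgl i r - sgl j r)))
       = csop f j b - theta * of_nat (psize b) * f b" .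
  qed
  finally show ?thesis .
qed

text \<open>
  Variables not occurring in \<open>b\<close> contribute a multiple of \<open>f b\<close> by \<open>csop_absent\<close>, so in \<open>n\<close> variables the
  correction term of \<open>nsop3\<close> can be absorbed into the eigenvalue.
\<close>
lemma jack_cs_equation:
  assumes "is_partition lam"
  shows "\<exists>E. \<forall>b. kys b \<subseteq> {..<n} \<longrightarrow> (\<Sum>i<n. csop (jack_sf lam) i b) = E * jack_sf lam b"
proof -
  let ?f = "jack_sf lam" and ?d = "psize lam"
  have sd: "homsym ?d ?f" using jack_sf_unitriang[OF assms] by (simp add: unitriang_def)
  then have s: "symm ?f" by (simp add: homsym_def)
  obtain e where e: "\<And>b. nsop 3 ?f b = e * ?f b" using jack_sf_eigen[OF assms, of 3] by blast
  have th: "theta \<noteq> 0" using theta_pos by simp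
  have "(\<Sum>i<n. csop ?f i b) = (e / theta + theta * of_nat (?d * n)) * ?f b" if b: "kys b \<subseteq> {..<n}" for b
  proof -
    let ?c = "theta * of_nat (psize b) * ?f b"
    have "(\<Sum>i<n. csop ?f i b - ?c) = (\<Sum>i\<in>kys b. csop ?f i b - ?c)"
      using b csop_absent[OF s] by (intro sum.mono_neutral_right) auto
    also have "\<dots> = e / theta * ?f b"
      using nsop3[OF sd, of b] e[of b] th by (simp add: field_simps)
    finally have "(\<Sum>i<n. csop ?f i b) = e / theta * ?f b + of_nat n * ?c"
      by (simp add: sum_subtractf algebra_simps)
    also have "of_nat n * ?c = theta * of_nat (?d * n) * ?f b"
      using homsymD(2)[OF sd, of b] by (cases "psize b = ?d") (simp_all add: algebra_simps)
    finally show ?thesis by (simp add: algebra_simps)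
  qed
  then show ?thesis by blast
qed

section \<open>Jack functions in two variables\<close>

text \<open>
  The exponent vector \<open>(p, q, 0, 0, \<dots>)\<close>.
\<close>
definition ex2 :: "nat \<Rightarrow> nat \<Rightarrow> expo" where "ex2 p q = sgl 0 p + sgl 1 q"

lemma lkp_ex2: "lkp (ex2 p q) k = (if k = 0 then p else if k = 1 then q else 0)"
  by (simp add: ex2_def lookup_add lookup_single when_def)

lemma kys_ex2: "kys (ex2 p q) \<subseteq> {..<2}"
  by (auto simp: in_keys_iff lkp_ex2 split: if_splits)

lemma csop_ex2:
  "csop f 0 (ex2 p q) = of_nat p ^ 2 * f (ex2 p q) + theta * (\<Sum>r\<in>{1..q}. (of_nat p - of_nat q + 2 * of_nat r) * f (ex2 (p + r) (q - r)))"
  "csop f (Suc 0) (ex2 p q) = of_nat q ^ 2 * f (ex2 p q) + theta * (\<Sum>r\<in>{1..p}. (of_nat q - of_nat p + 2 * of_nat r) * f (ex2 (p - r) (q + r)))"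
proof -
  have 1: "(\<Sum>j\<in>kys (ex2 p q) - {0}. h j (lkp (ex2 p q) j)) = h 1 q" if "\<And>j. h j 0 = 0" for h :: "nat \<Rightarrow> nat \<Rightarrow> ratfun"
  proof -
    have "(\<Sum>j\<in>kys (ex2 p q) - {0}. h j (lkp (ex2 p q) j)) = (\<Sum>j\<in>{1}. h j (lkp (ex2 p q) j))"
      by (intro sum.mono_neutral_left) (auto simp: in_keys_iff lkp_ex2 that split: if_splits intro!: Nat.gr0I)
    then show ?thesis by (simp add: lkp_ex2)
  qed
  have 2: "(\<Sum>j\<in>kys (ex2 p q) - {1}. h j (lkp (ex2 p q) j)) = h 0 p" if "\<And>j. h j 0 = 0" for h :: "nat \<Rightarrow> nat \<Rightarrow> ratfun"
  proof -
    have "(\<Sum>j\<in>kys (ex2 p q) - {1}. h j (lkp (ex2 p q) j)) = (\<Sum>j\<in>{0}. h j (lkp (ex2 p q) j))"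
      by (intro sum.mono_neutral_left) (auto simp: in_keys_iff lkp_ex2 that split: if_splits intro!: Nat.gr0I)
    then show ?thesis by (simp add: lkp_ex2)
  qed
  have e: "ex2 p q + sgl 0 r - sgl 1 r = ex2 (p + r) (q - r)" "ex2 p q + sgl 1 r - sgl 0 r = ex2 (p - r) (q + r)" for r
    by (intro poly_mapping_eqI, simp add: lkp_ex2 lkp_diff_single lkp_add_single)+
  show "csop f 0 (ex2 p q) = of_nat p ^ 2 * f (ex2 p q) + theta * (\<Sum>r\<in>{1..q}. (of_nat p - of_nat q + 2 * of_nat r) * f (ex2 (p + r) (q - r)))"
    unfolding csop_def using 1[of "\<lambda>j u. \<Sum>r\<in>{1..u}. (of_nat p - of_nat u + 2 * of_nat r) * f (ex2 p q + sgl 0 r - sgl j r)"]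
    by (simp add: lkp_ex2 e flip: One_nat_def)
  show "csop f (Suc 0) (ex2 p q) = of_nat q ^ 2 * f (ex2 p q) + theta * (\<Sum>r\<in>{1..p}. (of_nat q - of_nat p + 2 * of_nat r) * f (ex2 (p - r) (q + r)))"
    unfolding csop_def using 2[of "\<lambda>j u. \<Sum>r\<in>{1..u}. (of_nat q - of_nat u + 2 * of_nat r) * f (ex2 p q + sgl 1 r - sgl j r)"]
    by (simp add: lkp_ex2 e flip: One_nat_def)
qed

lemma ex2_swap: "symm f \<Longrightarrow> f (ex2 p q) = f (ex2 q p)"
proof (rule symmD)
  have "swp 0 1 (ex2 p q) = ex2 q p"
    by (intro poly_mapping_eqI) (auto simp: lkp_swp lkp_ex2 transpose_def)
  then show "parts (ex2 p q) = parts (ex2 q p)" using parts_swp by metis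
qed

text \<open>
  The sum that \<open>\<theta>\<close> multiplies in the first summand of the Calogero-Sutherland operator in two variables.
\<close>
definition gsum :: "(expo \<Rightarrow> ratfun) \<Rightarrow> nat \<Rightarrow> nat \<Rightarrow> ratfun" where
  "gsum f p q = (\<Sum>r\<in>{1..q}. (of_nat p - of_nat q + 2 * of_nat r) * f (ex2 (p + r) (q - r)))"

lemma gsum_step:
  assumes "p > 0"
  shows "gsum f (p - 1) (q + 1) = (of_nat p - of_nat q) * f (ex2 p q) + gsum f p q"
proof -
  let ?h = "\<lambda>r. (of_nat (p - 1) - of_nat (q + 1) + 2 * of_nat r) * f (ex2 (p - 1 + r) (q + 1 - r))"
  have "gsum f (p - 1) (q + 1) = (\<Sum>r\<in>{1..Suc q}. ?h r)" by (simp add: gsum_def)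
  also have "\<dots> = ?h 1 + (\<Sum>r\<in>{Suc 1..Suc q}. ?h r)" by (simp add: sum.atLeast_Suc_atMost)
  also have "(\<Sum>r\<in>{Suc 1..Suc q}. ?h r) = (\<Sum>r\<in>{1..q}. ?h (Suc r))" by (rule sum.shift_bounds_cl_Suc_ivl)
  also have "\<dots> = gsum f p q"
    unfolding gsum_def using assms by (intro sum.cong refl) (auto simp: of_nat_diff algebra_simps)
  also have "?h 1 = (of_nat p - of_nat q) * f (ex2 p q)"
    using assms by (simp add: of_nat_diff)
  finally show ?thesis .
qed

text \<open>
  Both sides are sums over final segments of the same antisymmetric sequence, whose total sum is
  zero.
\<close>
lemma gsum_swap:
  assumes "symm f"
  shows "gsum f q p = (of_nat p - of_nat q) * f (ex2 p q) + gsum f p q"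
proof -
  let ?m = "p + q"
  define h where "h u = (2 * of_nat u - of_nat ?m) * f (ex2 u (?m - u))" for u
  have G: "gsum f a b = (\<Sum>u\<in>{Suc a..?m}. h u)" if "a + b = ?m" for a b
  proof -
    have "gsum f a b = (\<Sum>r\<in>{1..b}. h (a + r))"
      unfolding gsum_def
    proof (intro sum.cong refl)
      fix r assume "r \<in> {1..b}"
      have 1: "?m - (a + r) = b - r" using that by simp
      show "(of_nat a - of_nat b + 2 * of_nat r) * f (ex2 (a + r) (b - r)) = h (a + r)"
        unfolding h_def 1 by (simp add: algebra_simps flip: that)
    qed
    also have "\<dots> = (\<Sum>u\<in>{Suc a..?m}. h u)"
      by (rule sum.reindex_bij_witness[of _ "\<lambda>u. u - a" "\<lambda>r. a + r"]) (use that in auto)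
    finally show ?thesis .
  qed
  have anti: "h (?m - u) = - h u" if "u \<le> ?m" for u
    using that ex2_swap[OF assms, of u "?m - u"] by (simp add: h_def of_nat_diff algebra_simps)
  have "0 = (\<Sum>u\<in>{0..?m}. h u)" using antisym_sum[of ?m h] anti by simp
  also have "\<dots> = (\<Sum>u\<in>{0..<p}. h u) + (\<Sum>u\<in>{p..?m}. h u)"
    by (subst sum.union_disjoint[symmetric]) (auto intro!: sum.cong)
  also have "(\<Sum>u\<in>{0..<p}. h u) = (\<Sum>u\<in>{Suc q..?m}. h (?m - u))"
    by (rule sum.reindex_bij_witness[of _ "\<lambda>u. ?m - u" "\<lambda>u. ?m - u"]) auto
  also have "\<dots> = - gsum f q p" using anti by (simp add: G sum_negf add.commute)
  also have "(\<Sum>u\<in>{p..?m}. h u) = h p + gsum f p q" by (simp add: G sum.atLeast_Suc_atMost)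
  finally show ?thesis by (simp add: h_def algebra_simps)
qed

lemma ex2_partition: "b \<le> a \<Longrightarrow> is_partition (ex2 a b)"
  by (auto simp: is_partition_def antimono_def lkp_ex2)

lemma jack_ex2_vanish:
  assumes "b \<le> a" "p > a" shows "jack_sf (ex2 a b) (ex2 p q) = 0"
proof (rule ccontr)
  assume "jack_sf (ex2 a b) (ex2 p q) \<noteq> 0"
  then have "domin (parts (ex2 p q)) (parts (ex2 a b))"
    using jack_sf_unitriang[OF ex2_partition[OF assms(1)]] by (auto simp: unitriang_def below_def)
  then have "excess a (parts (ex2 p q)) \<le> excess a (parts (ex2 a b))" by (simp add: domin_def)
  moreover have "excess c (parts (ex2 u v)) = (u - c) + (v - c)" for c u v
    using excess_parts_superset[of "{..<2}" "ex2 u v" c] kys_ex2 by (simp add: lkp_ex2 eval_nat_numeral)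
  ultimately show False using assms by simp
qed

text \<open>
  Since \<open>gsum\<close> vanishes at the leading monomial, the eigenvalue is known, and the equation expresses
  \<open>gsum\<close> as a multiple of the coefficient \<open>F j\<close>. Together with \<open>gsum_step\<close> this gives a recurrence.
\<close>
lemma jack_ex2_recurrence:
  fixes a b :: nat
  defines "F j \<equiv> jack_sf (ex2 a b) (ex2 (a - j) (b + j))"
  assumes ab: "b \<le> a" and j: "j < a - b"
  shows "of_nat (j + 1) * (of_nat (a - b - 1 - j) + theta) * F (j + 1)
       = of_nat (a - b - j) * (of_nat j + theta) * F j"
proof -
  let ?f = "jack_sf (ex2 a b)" and ?m = "a - b"
  let ?l = "ex2 a b"
  have P: "is_partition ?l" by (rule ex2_partition[OF ab])
  have s: "symm ?f" and one: "?f ?l = 1" using jack_sf_unitriang[OF P] by (auto simp: unitriang_def homsym_def)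
  obtain E where E: "\<And>b. kys b \<subseteq> {..<2} \<Longrightarrow> (\<Sum>i<2. csop ?f i b) = E * ?f b"
    using jack_cs_equation[OF P, of 2] by blast
  have eq: "(of_nat p ^ 2 + of_nat q ^ 2 + theta * (of_nat p - of_nat q)) * ?f (ex2 p q) + 2 * theta * gsum ?f p q = E * ?f (ex2 p q)" for p q
  proof -
    have "csop ?f 0 (ex2 p q) + csop ?f (Suc 0) (ex2 p q) = E * ?f (ex2 p q)"
      using E[OF kys_ex2, of p q] by (simp add: eval_nat_numeral)
    moreover have "csop ?f 0 (ex2 p q) = of_nat p ^ 2 * ?f (ex2 p q) + theta * gsum ?f p q"
      by (simp only: csop_ex2 gsum_def)
    moreover have "csop ?f (Suc 0) (ex2 p q) = of_nat q ^ 2 * ?f (ex2 p q) + theta * gsum ?f q p"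
    proof -
      have "(\<Sum>r\<in>{1..p}. (of_nat q - of_nat p + 2 * of_nat r) * ?f (ex2 (p - r) (q + r))) = gsum ?f q p"
        unfolding gsum_def by (intro sum.cong refl) (simp add: ex2_swap[OF s])
      then show ?thesis by (simp only: csop_ex2)
    qed
    ultimately show ?thesis by (simp add: gsum_swap[OF s, of q p] algebra_simps)
  qed
  have "gsum ?f a b = 0" unfolding gsum_def using jack_ex2_vanish[OF ab] by (intro sum.neutral) auto
  then have EE: "E = of_nat a ^ 2 + of_nat b ^ 2 + theta * (of_nat a - of_nat b)" using eq[of a b] one by simp
  have G: "theta * gsum ?f (a - j) (b + j) = of_nat j * (of_nat (?m - j) + theta) * F j" if "j \<le> ?m" for j
  proof -
    have n: "of_nat (a - j) = (of_nat a - of_nat j :: ratfun)" "of_nat (?m - j) = (of_nat a - of_nat b - of_nat j :: ratfun)"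
      using that ab by (simp_all add: of_nat_diff)
    have "2 * (theta * gsum ?f (a - j) (b + j)) = (E - (of_nat (a - j) ^ 2 + of_nat (b + j) ^ 2 + theta * (of_nat (a - j) - of_nat (b + j)))) * F j"
      using eq[of "a - j" "b + j"] by (simp add: F_def algebra_simps)
    also have "E - (of_nat (a - j) ^ 2 + of_nat (b + j) ^ 2 + theta * (of_nat (a - j) - of_nat (b + j)))
       = 2 * (of_nat j * (of_nat (?m - j) + theta))"
      unfolding EE n of_nat_add by (simp add: power2_eq_square algebra_simps)
    finally show ?thesis by (simp add: mult.assoc)
  qed
  have j': "j \<le> ?m" "j + 1 \<le> ?m" "a - j > 0" using j by auto
  have st: "gsum ?f (a - (j + 1)) (b + (j + 1)) = (of_nat (a - j) - of_nat (b + j)) * F j + gsum ?f (a - j) (b + j)"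
    using gsum_step[OF j'(3), of ?f "b + j"] by (simp add: F_def)
  have "of_nat (j + 1) * (of_nat (?m - (j + 1)) + theta) * F (j + 1) = theta * gsum ?f (a - (j + 1)) (b + (j + 1))"
    using G[OF j'(2)] by simp
  also have "\<dots> = theta * ((of_nat (a - j) - of_nat (b + j)) * F j) + of_nat j * (of_nat (?m - j) + theta) * F j"
    unfolding st distrib_left G[OF j'(1)] ..
  also have "\<dots> = of_nat (?m - j) * (of_nat j + theta) * F j"
  proof -
    have n: "of_nat (a - j) = (of_nat a - of_nat j :: ratfun)" "of_nat (?m - j) = (of_nat a - of_nat b - of_nat j :: ratfun)"
      using j' ab by (simp_all add: of_nat_diff)
    show ?thesis unfolding n of_nat_add by (simp add: algebra_simps)
  qed
  finally show ?thesis by (simp add: diff_diff_eq)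
qed

section \<open>Moments of the symmetric beta distribution\<close>

text \<open>
  Moments of the symmetric beta distribution, in a homogeneous form of its parameter: the parameter is
  \<open>\<beta> / \<alpha>\<close>, and \<open>\<alpha> = 0\<close> stands for the limit distribution concentrated at \<open>1/2\<close>. Real scalars act on the
  ring through the homomorphism \<open>c\<close>.
\<close>
locale beta_moments =
  fixes c :: "real \<Rightarrow> 'a::idom" and \<alpha> \<beta> :: real
  assumes c1: "c 1 = 1" and cadd: "c (u + v) = c u + c v" and cmult: "c (u * v) = c u * c v"
    and \<alpha>: "\<alpha> \<ge> 0" and \<beta>: "\<beta> > 0"
begin

lemma c0: "c 0 = 0"
proof -
  have "c 0 + c 0 = c 0 + 0" using cadd[of 0 0] by simp
  then show ?thesis by (rule add_left_imp_eq)
qed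
lemma cminus: "c (- u) = - c u" using cadd[of u "- u"] c0 by (simp add: eq_neg_iff_add_eq_0 add.commute)
lemma cnat: "c (of_nat n) = of_nat n" by (induction n) (simp_all add: c0 c1 cadd)
lemma cnum: "c (numeral n) = numeral n" using cnat[of "numeral n"] by simp
lemma ccancel: assumes "r \<noteq> 0" "c r * u = c r * v" shows "u = v"
proof -
  have "c (1 / r) * (c r * u) = c (1 / r) * (c r * v)" using assms(2) by simp
  moreover have "c (1 / r) * (c r * x) = x" for x
    using assms(1) c1 by (simp add: mult.assoc[symmetric] cmult[symmetric])
  ultimately show ?thesis by simp
qed

text \<open>
  The \<open>i\<close>-th moment of the distribution.
\<close>
primrec moment :: "nat \<Rightarrow> real" where
  "moment 0 = 1"
| "moment (Suc i) = (\<alpha> * of_nat i + \<beta>) / (\<alpha> * of_nat i + 2 * \<beta>) * moment i"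

lemma pos: "\<alpha> * of_nat i + \<beta> > 0" "\<alpha> * of_nat i + 2 * \<beta> > 0"
  using \<alpha> \<beta> by (simp_all add: add_nonneg_pos)

lemma moment_rec: "(\<alpha> * of_nat i + 2 * \<beta>) * moment (Suc i) = (\<alpha> * of_nat i + \<beta>) * moment i"
  using pos(2)[of i] by simp

text \<open>
  The mean of a polynomial in the random variable \<open>U\<close>.
\<close>
definition mom :: "'a poly \<Rightarrow> 'a" where
  "mom p = (\<Sum>i\<le>degree p. coeff p i * c (moment i))"

lemma mom_eq: "degree p \<le> n \<Longrightarrow> mom p = (\<Sum>i\<le>n. coeff p i * c (moment i))"
  unfolding mom_def by (intro sum.mono_neutral_left) (auto simp: coeff_eq_0)

lemma mom_add: "mom (p + q) = mom p + mom q"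
proof -
  let ?n = "max (degree p) (degree q)"
  have "mom (p + q) = (\<Sum>i\<le>?n. coeff (p + q) i * c (moment i))" by (rule mom_eq) (rule degree_add_le_max)
  then show ?thesis by (simp add: mom_eq[of p ?n] mom_eq[of q ?n] distrib_right sum.distrib)
qed

lemma mom_smult: "mom (smult a p) = a * mom p"
  using mom_eq[of "smult a p" "degree p"] by (simp add: mom_def sum_distrib_left mult.assoc degree_smult_le)

lemma mom_0: "mom 0 = 0" by (simp add: mom_def)

lemma mom_diff: "mom (p - q) = mom p - mom q"
  using mom_add[of p "smult (- 1) q"] mom_smult[of "- 1" q] by simp

lemma mom_sum: "mom (\<Sum>i\<in>S. f i) = (\<Sum>i\<in>S. mom (f i))"
  by (induction S rule: infinite_finite_induct) (simp_all add: mom_0 mom_add)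

lemma mom_monom: "mom (monom a i) = a * c (moment i)"
proof -
  have "mom (monom a i) = (\<Sum>j\<le>i. coeff (monom a i) j * c (moment j))" by (rule mom_eq) (rule degree_monom_le)
  also have "\<dots> = (\<Sum>j\<in>{i}. coeff (monom a i) j * c (moment j))" by (intro sum.mono_neutral_right) auto
  finally show ?thesis by simp
qed

abbreviation U :: "'a poly" where "U \<equiv> [:0, 1:]"
abbreviation W :: "'a poly" where "W \<equiv> [:1, - 1:]"
abbreviation V :: "'a poly" where "V \<equiv> [:1, - 2:]"

text \<open>
  The mean of \<open>\<alpha> U (1 - U) p'(U) + \<beta> (1 - 2U) p(U)\<close>, which vanishes:
  for \<open>\<alpha> > 0\<close> by integration by parts, as the density is proportional to \<open>(u (1 - u))\<^bsup>\<beta>/\<alpha>-1\<^esup>\<close>, and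
  for \<open>\<alpha> = 0\<close> because \<open>U = 1/2\<close>.
\<close>
definition stein_map :: "'a poly \<Rightarrow> 'a" where
  "stein_map p = c \<alpha> * mom (U * W * pderiv p) + c \<beta> * mom (V * p)"

lemma stein_map_add: "stein_map (p + q) = stein_map p + stein_map q"
  by (simp only: stein_map_def pderiv_add distrib_left mom_add add_ac)

lemma stein_map_monom: "stein_map (monom a i) = 0"
proof -
  have Vm: "V * monom a i = monom a i - monom (2 * a) (Suc i)"
    by (rule poly_eqI) (simp add: coeff_pCons split: nat.split)
  have UW: "U * W * pderiv (monom a i) = monom (of_nat i * a) i - monom (of_nat i * a) (Suc i)"
  proof (cases i)
    case (Suc k)
    show ?thesis unfolding Suc pderiv_monom
      by (rule poly_eqI) (simp add: coeff_pCons split: nat.split)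
  qed (simp add: pderiv_monom)
  have "stein_map (monom a i) = a * (c (\<alpha> * of_nat i + \<beta>) * c (moment i) - c (\<alpha> * of_nat i + 2 * \<beta>) * c (moment (Suc i)))"
    unfolding stein_map_def UW Vm mom_diff mom_monom by (simp add: cadd cmult cnat cnum algebra_simps del: moment.simps)
  also have "c (\<alpha> * of_nat i + 2 * \<beta>) * c (moment (Suc i)) = c (\<alpha> * of_nat i + \<beta>) * c (moment i)"
    unfolding cmult[symmetric] moment_rec ..
  finally show ?thesis by simp
qed

lemma stein: "stein_map p = 0"
proof -
  have "stein_map (\<Sum>i\<le>n. monom (coeff p i) i) = 0" for n
    by (induction n) (simp_all add: stein_map_monom stein_map_add)
  then show ?thesis using poly_as_sum_of_monoms[of p] by metis
qed

text \<open>
  The mean of \<open>U\<^sup>i (1 - U)\<^sup>j\<close>.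
\<close>
definition l :: "nat \<Rightarrow> nat \<Rightarrow> 'a" where "l i j = mom (U ^ i * W ^ j)"

lemma power_pderiv: "p * pderiv (p ^ i) = of_nat i * p ^ i * pderiv (p :: 'a poly)"
proof (cases i)
  case (Suc k)
  show ?thesis unfolding Suc pderiv_power_Suc
    by (simp add: of_nat_poly mult_ac del: of_nat_Suc)
qed simp

lemma U_pderiv: "U * pderiv (U ^ i) = of_nat i * U ^ i"
proof -
  have "pderiv U = 1" by (simp add: pderiv_pCons)
  then show ?thesis unfolding power_pderiv by (simp only: mult_1_right)
qed

lemma W_pderiv: "W * pderiv (W ^ i) = - of_nat i * W ^ i"
proof -
  have "pderiv W = - 1" by (simp add: pderiv_pCons one_pCons)
  then show ?thesis unfolding power_pderiv by (simp only: mult_minus_right mult_minus_left mult_1_right)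
qed

lemma mom_of_nat_mult: "mom (of_nat n * p) = of_nat n * mom p"
  by (simp add: of_nat_poly mom_smult)

lemma l_exchange: "c (\<alpha> * of_nat i + \<beta>) * l i (Suc j) = c (\<alpha> * of_nat j + \<beta>) * l (Suc i) j"
proof -
  have "U * W * pderiv (U ^ i * W ^ j) = W * W ^ j * (U * pderiv (U ^ i)) + U * U ^ i * (W * pderiv (W ^ j))"
    by (simp only: pderiv_mult algebra_simps)
  also have "\<dots> = of_nat i * (U ^ i * W ^ Suc j) - of_nat j * (U ^ Suc i * W ^ j)"
    unfolding U_pderiv W_pderiv by (simp only: power_Suc algebra_simps mult_minus_left mult_minus_right add_uminus_conv_diff)
  finally have 1: "mom (U * W * pderiv (U ^ i * W ^ j)) = of_nat i * l i (Suc j) - of_nat j * l (Suc i) j"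
    by (simp only: mom_diff mom_of_nat_mult l_def)
  have VV: "V = W - U" by simp
  have "V * (U ^ i * W ^ j) = U ^ i * W ^ Suc j - U ^ Suc i * W ^ j"
    unfolding VV by (simp only: power_Suc algebra_simps)
  then have 2: "mom (V * (U ^ i * W ^ j)) = l i (Suc j) - l (Suc i) j" by (simp only: mom_diff l_def)
  have "c \<alpha> * (of_nat i * l i (Suc j) - of_nat j * l (Suc i) j) + c \<beta> * (l i (Suc j) - l (Suc i) j) = 0"
    using stein[of "U ^ i * W ^ j"] unfolding stein_map_def 1 2 .
  then show ?thesis by (simp add: cadd cmult cnat algebra_simps)
qed

lemma l_0: "l 0 m = c (moment m)"
proof (induction m)
  case 0
  have "mom 1 = 1" using mom_monom[of 1 0] by (simp add: c1 monom_0 one_pCons)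
  then show ?case by (simp add: l_def c1)
next
  case (Suc m)
  have "U ^ 0 * W ^ Suc m = U ^ 0 * W ^ m - U ^ Suc 0 * W ^ m"
  proof -
    have "W = 1 - U" by (simp add: one_pCons)
    then have "W ^ Suc m = W ^ m - U * W ^ m" by (metis left_diff_distrib mult_1 power_Suc)
    then show ?thesis by simp
  qed
  then have "l 0 (Suc m) = l 0 m - l (Suc 0) m" by (simp only: l_def mom_diff)
  then have "l (Suc 0) m = l 0 m - l 0 (Suc m)" by simp
  then have "c \<beta> * l 0 (Suc m) = c (\<alpha> * of_nat m + \<beta>) * (l 0 m - l 0 (Suc m))"
    using l_exchange[of 0 m] by simp
  then have "c (\<alpha> * of_nat m + 2 * \<beta>) * l 0 (Suc m) = c (\<alpha> * of_nat m + \<beta>) * l 0 m"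
    by (simp add: cadd cmult cnat cnum algebra_simps)
  also have "\<dots> = c (\<alpha> * of_nat m + 2 * \<beta>) * c (moment (Suc m))"
    unfolding Suc cmult[symmetric] moment_rec ..
  finally show ?case by (rule ccancel[rotated]) (use pos(2)[of m] in simp)
qed

text \<open>
  The quotient of \<open>(m choose j)\<close> times the mean of \<open>U\<^sup>j (1 - U)\<^bsup>m-j\<^esup>\<close> by the \<open>m\<close>-th moment (\<open>l_cj\<close>). Its
  recurrence is the one of the coefficients of the Jack polynomial of \<open>(m, 0)\<close>.
\<close>
primrec cj :: "nat \<Rightarrow> nat \<Rightarrow> real" where
  "cj m 0 = 1"
| "cj m (Suc j) = of_nat (m - j) / of_nat (Suc j) * ((\<alpha> * of_nat j + \<beta>) / (\<alpha> * of_nat (m - 1 - j) + \<beta>)) * cj m j"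

lemma l_cj: "j \<le> m \<Longrightarrow> of_nat (m choose j) * l j (m - j) = c (cj m j * moment m)"
proof (induction j)
  case 0 then show ?case by (simp add: l_0)
next
  case (Suc j)
  let ?n = "m - 1 - j"
  have mj: "m - j = Suc ?n" "m - Suc j = ?n" using Suc.prems by auto
  have bin: "of_nat (Suc j) * of_nat (m choose Suc j) = (of_nat (m - j) * of_nat (m choose j) :: 'a)"
    by (metis binomial_absorb_comp binomial_absorption of_nat_mult)
  have "c (of_nat (Suc j) * (\<alpha> * of_nat ?n + \<beta>)) * (of_nat (m choose Suc j) * l (Suc j) (m - Suc j))
     = (of_nat (Suc j) * of_nat (m choose Suc j)) * (c (\<alpha> * of_nat ?n + \<beta>) * l (Suc j) ?n)"
    by (simp only: cmult cnat mj ac_simps)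
  also have "\<dots> = of_nat (m - j) * of_nat (m choose j) * (c (\<alpha> * of_nat j + \<beta>) * l j (m - j))"
    unfolding bin mj l_exchange ..
  also have "\<dots> = of_nat (m - j) * c (\<alpha> * of_nat j + \<beta>) * c (cj m j * moment m)"
    using Suc by (simp add: mult_ac)
  also have "\<dots> = c (of_nat (m - j) * (\<alpha> * of_nat j + \<beta>) * (cj m j * moment m))"
    by (simp only: cmult cnat)
  also have "of_nat (m - j) * (\<alpha> * of_nat j + \<beta>) * (cj m j * moment m) = of_nat (Suc j) * (\<alpha> * of_nat ?n + \<beta>) * (cj m (Suc j) * moment m)"
  proof -
    have frac: "M * A * (u * v) = S * D * (M / S * (A / D) * u * v)" if "S \<noteq> 0" "D \<noteq> 0" for M A u v S D :: real
      using that by (simp add: field_simps)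
    show ?thesis unfolding cj.simps by (rule frac) (use pos(1)[of ?n] in auto)
  qed
  also have "c \<dots> = c (of_nat (Suc j) * (\<alpha> * of_nat ?n + \<beta>)) * c (cj m (Suc j) * moment m)" by (rule cmult)
  finally show ?case by (rule ccancel[rotated]) (use pos(1)[of ?n] in \<open>simp del: of_nat_Suc\<close>)
qed

text \<open>
  The mean of \<open>(1 - 2U)\<^sup>k\<close>.
\<close>
fun nu :: "nat \<Rightarrow> real" where
  "nu 0 = 1"
| "nu (Suc 0) = 0"
| "nu (Suc (Suc k)) = \<alpha> * of_nat (Suc k) / (\<alpha> * of_nat (Suc k) + 2 * \<beta>) * nu k"

lemma nu_nonneg: "nu k \<ge> 0"
  by (induction k rule: nu.induct) (use \<alpha> \<beta> in \<open>auto intro!: mult_nonneg_nonneg divide_nonneg_nonneg\<close>)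

lemma nu_odd: "odd k \<Longrightarrow> nu k = 0"
  by (induction k rule: nu.induct) auto

lemma mom_V: "mom (V ^ k) = c (nu k)"
proof (induction k rule: nu.induct)
  case 1
  show ?case using l_0[of 0] by (simp add: l_def)
next
  case 2
  have "c \<beta> * mom V = c \<beta> * 0" using stein[of 1] by (simp add: stein_map_def mom_0)
  then show ?case using ccancel[of \<beta> "mom V" 0] \<beta> by (simp add: c0)
next
  case (3 k)
  have pd: "pderiv (V ^ Suc k) = smult (- 2 * of_nat (Suc k)) (V ^ k)"
    by (simp add: pderiv_power_Suc pderiv_pCons del: of_nat_Suc power_Suc)
  have UW: "smult 4 (U * W) = 1 - V * V" by (simp add: one_pCons)
  have "smult 4 (U * W * pderiv (V ^ Suc k)) = smult (- 2 * of_nat (Suc k)) (smult 4 (U * W) * V ^ k)"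
    unfolding pd by (simp only: mult_smult_left mult_smult_right smult_smult mult_ac)
  also have "\<dots> = smult (- 2 * of_nat (Suc k)) (V ^ k - V ^ Suc (Suc k))"
    unfolding UW by (simp only: left_diff_distrib mult_1_left power_Suc mult.assoc)
  finally have "4 * mom (U * W * pderiv (V ^ Suc k)) = - 2 * of_nat (Suc k) * (mom (V ^ k) - mom (V ^ Suc (Suc k)))"
    by (metis mom_smult mom_diff)
  moreover have "4 * (c \<alpha> * mom (U * W * pderiv (V ^ Suc k)) + c \<beta> * mom (V ^ Suc (Suc k))) = 0"
    using stein[of "V ^ Suc k"] by (simp add: stein_map_def)
  ultimately have "c \<alpha> * (- 2 * of_nat (Suc k) * (mom (V ^ k) - mom (V ^ Suc (Suc k)))) + 4 * c \<beta> * mom (V ^ Suc (Suc k)) = 0"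
    by (simp only: distrib_left mult_ac)
  then have "c 2 * (c (\<alpha> * of_nat (Suc k) + 2 * \<beta>) * mom (V ^ Suc (Suc k))) = c 2 * (c (\<alpha> * of_nat (Suc k)) * mom (V ^ k))"
    unfolding cadd cmult cnat cnum by (simp add: algebra_simps del: power_Suc of_nat_Suc)
  then have "c (\<alpha> * of_nat (Suc k) + 2 * \<beta>) * mom (V ^ Suc (Suc k)) = c (\<alpha> * of_nat (Suc k)) * mom (V ^ k)"
    by (rule ccancel[rotated]) simp
  also have "\<dots> = c (\<alpha> * of_nat (Suc k) + 2 * \<beta>) * c (nu (Suc (Suc k)))"
  proof -
    have "\<alpha> * of_nat (Suc k) * nu k = (\<alpha> * of_nat (Suc k) + 2 * \<beta>) * nu (Suc (Suc k))"
      using pos(2)[of "Suc k"] by (simp del: of_nat_Suc)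
    then show ?thesis unfolding 3 cmult[symmetric] by (rule arg_cong)
  qed
  finally show ?case by (rule ccancel[rotated]) (use pos(2)[of "Suc k"] in \<open>simp del: of_nat_Suc\<close>)
qed

text \<open>
  Both sides are the mean of \<open>(U (s - w) + (1 - U) (s + w))\<^sup>m = ((1 - 2U) w + s)\<^sup>m\<close>, expanded by the
  binomial theorem in two ways.
\<close>
lemma moment_identity:
  "(\<Sum>j\<le>m. c (cj m j * moment m) * (s - w) ^ j * (s + w) ^ (m - j)) = (\<Sum>k\<le>m. c (of_nat (m choose k) * nu k) * w ^ k * s ^ (m - k))"
proof -
  let ?x = "s + w" and ?y = "s - w"
  have const_mult: "([:a:] * p) ^ k = smult (a ^ k) (p ^ k)" for a :: 'a and p k
    by (simp add: smult_power)
  have bin: "mom (([:a:] * p + [:b:] * q) ^ m) = (\<Sum>j\<le>m. of_nat (m choose j) * mom (p ^ j * q ^ (m - j)) * a ^ j * b ^ (m - j))"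
    for a b and p q
  proof -
    have "mom (of_nat (m choose j) * ([:a:] * p) ^ j * ([:b:] * q) ^ (m - j))
        = of_nat (m choose j) * mom (p ^ j * q ^ (m - j)) * a ^ j * b ^ (m - j)" for j
    proof -
      have "of_nat (m choose j) * ([:a:] * p) ^ j * ([:b:] * q) ^ (m - j)
          = smult (a ^ j * b ^ (m - j)) (of_nat (m choose j) * (p ^ j * q ^ (m - j)))"
        unfolding const_mult by (simp only: mult_smult_left mult_smult_right smult_smult mult_ac)
      then show ?thesis unfolding mom_smult mom_of_nat_mult by (simp only: mom_smult mom_of_nat_mult) (simp only: mult_ac)
    qed
    then show ?thesis unfolding binomial_ring by (simp only: mom_sum)
  qed
  have "[:?y:] * U + [:?x:] * W = [:w:] * V + [:s:] * 1" by (simp add: one_pCons algebra_simps)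
  then have "(\<Sum>j\<le>m. of_nat (m choose j) * mom (U ^ j * W ^ (m - j)) * ?y ^ j * ?x ^ (m - j))
     = (\<Sum>k\<le>m. of_nat (m choose k) * mom (V ^ k * 1 ^ (m - k)) * w ^ k * s ^ (m - k))"
    unfolding bin[symmetric] by (rule arg_cong)
  moreover have "of_nat (m choose j) * mom (U ^ j * W ^ (m - j)) = c (cj m j * moment m)" if "j \<le> m" for j
    using l_cj[OF that] by (simp only: l_def)
  moreover have "of_nat (m choose k) * mom (V ^ k * 1 ^ (m - k)) = c (of_nat (m choose k) * nu k)" for k
    by (simp only: power_one mult_1_right mom_V cmult cnat)
  ultimately show ?thesis by simp
qed

end

lemma sum_cj:
  assumes "\<alpha> \<ge> 0" "\<beta> > 0"
  shows "(\<Sum>j\<le>m. beta_moments.cj \<alpha> \<beta> m j) * beta_moments.moment \<alpha> \<beta> m = 1"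
proof -
  interpret beta_moments "\<lambda>x. x :: real" \<alpha> \<beta> by unfold_locales (use assms in auto)
  have "(\<Sum>k\<le>m. real (m choose k) * nu k * 0 ^ k * 1 ^ (m - k)) = (\<Sum>k\<in>{0}. real (m choose k) * nu k * 0 ^ k * 1 ^ (m - k))"
    by (intro sum.mono_neutral_right) auto
  then show ?thesis using moment_identity[of m 1 0] by (simp add: sum_distrib_right)
qed

section \<open>Specialization of the parameter\<close>

text \<open>
  Evaluation of a rational polynomial at a real number.
\<close>
definition evalq :: "rat poly \<Rightarrow> real \<Rightarrow> real" where "evalq p t = poly (map_poly of_rat p) t"

lemma evalq_pCons: "evalq (pCons a p) t = of_rat a + t * evalq p t"
  by (simp add: evalq_def map_poly_pCons)

lemma evalq_0: "evalq 0 t = 0" by (simp add: evalq_def)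
lemma evalq_1: "evalq 1 t = 1" by (simp add: one_pCons evalq_pCons evalq_0)

lemma evalq_add: "evalq (p + q) t = evalq p t + evalq q t"
  by (induction p q rule: poly_induct2) (simp_all add: evalq_0 evalq_pCons of_rat_add algebra_simps)

lemma evalq_smult: "evalq (smult a p) t = of_rat a * evalq p t"
  by (induction p) (simp_all add: evalq_0 evalq_pCons of_rat_mult algebra_simps)

lemma evalq_mult: "evalq (p * q) t = evalq p t * evalq q t"
  by (induction p) (simp_all add: evalq_0 evalq_pCons evalq_add evalq_smult algebra_simps)

text \<open>
  The rational function \<open>x\<close> has no pole at \<open>t\<close>, and its value there is \<open>v\<close>.
\<close>
definition hasval :: "ratfun \<Rightarrow> real \<Rightarrow> real \<Rightarrow> bool" where
  "hasval x t v \<longleftrightarrow> (\<exists>p q. x = Fract p q \<and> evalq q t \<noteq> 0 \<and> v = evalq p t / evalq q t)"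

lemma hasval_unique: assumes "hasval x t v" "hasval x t w" shows "v = w"
proof -
  obtain p q where 1: "x = Fract p q" "evalq q t \<noteq> 0" "v = evalq p t / evalq q t" using assms(1) by (auto simp: hasval_def)
  obtain p' q' where 2: "x = Fract p' q'" "evalq q' t \<noteq> 0" "w = evalq p' t / evalq q' t" using assms(2) by (auto simp: hasval_def)
  have "q \<noteq> 0" "q' \<noteq> 0" using 1 2 evalq_0 by auto
  then have "p * q' = p' * q" using 1(1) 2(1) by (simp add: eq_fract)
  then have "evalq p t * evalq q' t = evalq p' t * evalq q t" by (metis evalq_mult)
  then show ?thesis unfolding 1(3) 2(3) using 1(2) 2(2) by (simp add: frac_eq_eq)
qed

lemma ratfun_eval_eq: "hasval x t v \<Longrightarrow> ratfun_eval x t = v"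
  unfolding ratfun_eval_def evalq_def[symmetric] hasval_def[symmetric] using hasval_unique by (intro the_equality) auto

lemma hasval_add: assumes "hasval x t v" "hasval y t w" shows "hasval (x + y) t (v + w)"
proof -
  obtain p q where 1: "x = Fract p q" "evalq q t \<noteq> 0" "v = evalq p t / evalq q t" using assms(1) by (auto simp: hasval_def)
  obtain p' q' where 2: "y = Fract p' q'" "evalq q' t \<noteq> 0" "w = evalq p' t / evalq q' t" using assms(2) by (auto simp: hasval_def)
  have "q \<noteq> 0" "q' \<noteq> 0" using 1 2 evalq_0 by auto
  then have "x + y = Fract (p * q' + p' * q) (q * q')" using 1(1) 2(1) by simp
  moreover have "evalq (q * q') t \<noteq> 0" using 1(2) 2(2) by (simp add: evalq_mult)
  moreover have "v + w = evalq (p * q' + p' * q) t / evalq (q * q') t"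
    unfolding 1(3) 2(3) evalq_mult evalq_add by (rule add_frac_eq[OF 1(2) 2(2)])
  ultimately show ?thesis unfolding hasval_def by blast
qed

lemma hasval_mult: assumes "hasval x t v" "hasval y t w" shows "hasval (x * y) t (v * w)"
proof -
  obtain p q where 1: "x = Fract p q" "evalq q t \<noteq> 0" "v = evalq p t / evalq q t" using assms(1) by (auto simp: hasval_def)
  obtain p' q' where 2: "y = Fract p' q'" "evalq q' t \<noteq> 0" "w = evalq p' t / evalq q' t" using assms(2) by (auto simp: hasval_def)
  have "x * y = Fract (p * p') (q * q')" using 1(1) 2(1) by simp
  moreover have "evalq (q * q') t \<noteq> 0" using 1(2) 2(2) by (simp add: evalq_mult)
  moreover have "v * w = evalq (p * p') t / evalq (q * q') t" unfolding 1(3) 2(3) evalq_mult by simp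
  ultimately show ?thesis unfolding hasval_def by blast
qed

lemma hasval_divide: assumes "hasval x t v" "hasval y t w" "w \<noteq> 0" shows "hasval (x / y) t (v / w)"
proof -
  obtain p q where 1: "x = Fract p q" "evalq q t \<noteq> 0" "v = evalq p t / evalq q t" using assms(1) by (auto simp: hasval_def)
  obtain p' q' where 2: "y = Fract p' q'" "evalq q' t \<noteq> 0" "w = evalq p' t / evalq q' t" using assms(2) by (auto simp: hasval_def)
  have "x / y = Fract (p * q') (q * p')" using 1(1) 2(1) by simp
  moreover have "evalq (q * p') t \<noteq> 0" using 1(2) 2(3) assms(3) by (auto simp: evalq_mult)
  moreover have "v / w = evalq (p * q') t / evalq (q * p') t" unfolding 1(3) 2(3) evalq_mult by simp
  ultimately show ?thesis unfolding hasval_def by blast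
qed

lemma hasval_0: "hasval 0 t 0" unfolding hasval_def by (intro exI[of _ 0] exI[of _ 1]) (simp add: Zero_fract_def evalq_0 evalq_1)
lemma hasval_1: "hasval 1 t 1" unfolding hasval_def by (intro exI[of _ 1]) (simp add: One_fract_def evalq_1)
lemma hasval_of_nat: "hasval (of_nat n) t (of_nat n)"
  by (induction n) (auto intro: hasval_0 hasval_add[OF hasval_1])
lemma hasval_theta: "hasval theta t t"
  unfolding hasval_def theta_def by (intro exI[of _ "[:0, 1:]"] exI[of _ 1]) (simp add: evalq_pCons evalq_0 evalq_1)

text \<open>
  The specialization of \<open>x\<close> at \<open>\<tau>\<close> exists, and its value is \<open>v\<close>.
\<close>
definition spec :: "ereal \<Rightarrow> ratfun \<Rightarrow> real \<Rightarrow> bool" where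
  "spec \<tau> x v \<longleftrightarrow> (if \<tau> = \<infinity> then \<exists>g. (\<forall>\<^sub>F t in at_top. hasval x t (g t)) \<and> (g \<longlongrightarrow> v) at_top
     else hasval x (real_of_ereal \<tau>) v)"

lemma specialize_eq: assumes "spec \<tau> x v" shows "specialize \<tau> x = v"
proof (cases "\<tau> = \<infinity>")
  case True
  then obtain g where g: "\<forall>\<^sub>F t in at_top. hasval x t (g t)" "(g \<longlongrightarrow> v) at_top" using assms by (auto simp: spec_def)
  have "\<forall>\<^sub>F t in at_top. g t = ratfun_eval x t" using g(1) by eventually_elim (simp add: ratfun_eval_eq)
  then have "(ratfun_eval x \<longlongrightarrow> v) at_top" using g(2) by (rule Lim_transform_eventually[rotated])
  then show ?thesis using True by (simp add: specialize_def tendsto_Lim)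
next
  case False then show ?thesis using assms by (simp add: spec_def specialize_def ratfun_eval_eq)
qed

lemma spec_const: assumes "\<And>t. hasval x t v" shows "spec \<tau> x v"
  unfolding spec_def using assms by (auto intro!: exI[of _ "\<lambda>_. v"])

lemma spec_mult: assumes "spec \<tau> x v" "spec \<tau> y w" shows "spec \<tau> (x * y) (v * w)"
proof (cases "\<tau> = \<infinity>")
  case True
  obtain g where g: "\<forall>\<^sub>F t in at_top. hasval x t (g t)" "(g \<longlongrightarrow> v) at_top" using assms True by (auto simp: spec_def)
  obtain h where h: "\<forall>\<^sub>F t in at_top. hasval y t (h t)" "(h \<longlongrightarrow> w) at_top" using assms True by (auto simp: spec_def)
  have "\<forall>\<^sub>F t in at_top. hasval (x * y) t (g t * h t)" using g(1) h(1) by eventually_elim (rule hasval_mult)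
  moreover have "((\<lambda>t. g t * h t) \<longlongrightarrow> v * w) at_top" by (intro tendsto_mult g h)
  ultimately show ?thesis using True by (auto simp: spec_def)
next
  case False then show ?thesis using assms by (simp add: spec_def hasval_mult)
qed

text \<open>
  Homogeneous coordinates of the parameter: \<open>par2 \<tau> / par1 \<tau> = \<tau>\<close>, where \<open>\<tau> = \<infinity>\<close> has the coordinates
  \<open>(0, 1)\<close>.
\<close>
definition par1 :: "ereal \<Rightarrow> real" where "par1 \<tau> = (if \<tau> = \<infinity> then 0 else 1)"
definition par2 :: "ereal \<Rightarrow> real" where "par2 \<tau> = (if \<tau> = \<infinity> then 1 else real_of_ereal \<tau>)"

lemma spec_moebius:
  assumes "0 \<le> \<tau>" "real w * par1 \<tau> + real z * par2 \<tau> > 0"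
  shows "spec \<tau> ((of_nat u + of_nat v * theta) / (of_nat w + of_nat z * theta))
    ((real u * par1 \<tau> + real v * par2 \<tau>) / (real w * par1 \<tau> + real z * par2 \<tau>))"
proof -
  have e: "hasval ((of_nat u + of_nat v * theta) / (of_nat w + of_nat z * theta)) t ((real u + real v * t) / (real w + real z * t))"
    if "real w + real z * t \<noteq> 0" for t
    by (intro hasval_divide hasval_add hasval_mult hasval_of_nat hasval_theta that)
  show ?thesis
  proof (cases "\<tau> = \<infinity>")
    case False
    then show ?thesis using assms e[of "real_of_ereal \<tau>"] by (simp add: spec_def par1_def par2_def)
  next
    case True
    then have z: "real z > 0" using assms by (simp add: par1_def par2_def)
    let ?g = "\<lambda>t. (real u + real v * t) / (real w + real z * t)"
    have "\<forall>\<^sub>F t in at_top. hasval ((of_nat u + of_nat v * theta) / (of_nat w + of_nat z * theta)) t (?g t)"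
      using eventually_gt_at_top[of "0::real"]
    proof eventually_elim
      case (elim t)
      then have "real w + real z * t > 0" using z by (simp add: add_nonneg_pos)
      then show ?case by (intro e) simp
    qed
    moreover have "(?g \<longlongrightarrow> real v / real z) at_top"
    proof -
      have inv: "((\<lambda>t. a / t) \<longlongrightarrow> 0) at_top" for a :: real
        by (intro tendsto_divide_0[OF tendsto_const] filterlim_at_top_imp_at_infinity filterlim_ident)
      have "((\<lambda>t. (real u / t + real v) / (real w / t + real z)) \<longlongrightarrow> (0 + real v) / (0 + real z)) at_top"
        using z by (intro tendsto_intros inv) auto
      moreover have "\<forall>\<^sub>F t in at_top. (real u / t + real v) / (real w / t + real z) = ?g t"
        using eventually_gt_at_top[of "0::real"]
      proof eventually_elim
        case (elim t)
        then have "real u / t + real v = (real u + real v * t) / t" "real w / t + real z = (real w + real z * t) / t"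
          by (simp_all add: field_simps)
        then show ?case using elim by simp
      qed
      ultimately show ?thesis by (simp add: tendsto_cong)
    qed
    ultimately show ?thesis using True by (auto simp: spec_def par1_def par2_def)
  qed
qed

lemma spec_quot: "w > 0 \<Longrightarrow> spec \<tau> (of_nat u / of_nat w) (real u / real w)"
  by (intro spec_const hasval_divide hasval_of_nat) simp

lemma par: assumes "0 \<le> \<tau>" shows "par1 \<tau> \<ge> 0" "par2 \<tau> \<ge> 0" "par1 \<tau> > 0 \<or> par2 \<tau> > 0"
  using assms by (auto simp: par1_def par2_def real_of_ereal_pos)

section \<open>Normalized Jack polynomials in two variables\<close>

lemma const_poly_hom: "const_poly 1 = 1" "const_poly (u + v) = const_poly u + const_poly v"
  "const_poly (u * v) = const_poly u * const_poly v" "const_poly 0 = 0"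
  by (simp_all add: const_poly_def single_add mult_single)

text \<open>
  The two variables.
\<close>
definition XX :: rpoly where "XX = Poly_Mapping.single (sgl 0 1) 1"
definition YY :: rpoly where "YY = Poly_Mapping.single (sgl 1 1) 1"

lemma single_power: "Poly_Mapping.single (sgl i 1) (1 :: real) ^ n = Poly_Mapping.single (sgl i n) 1"
  by (induction n) (simp_all add: mult_single flip: single_add)

lemma single_ex2: "Poly_Mapping.single (ex2 p q) v = const_poly v * XX ^ p * YY ^ q"
  unfolding XX_def YY_def single_power const_poly_def mult_single ex2_def by simp

text \<open>
  The value of a polynomial at \<open>(1, 1, \<dots>)\<close>.
\<close>
definition sumcoef :: "rpoly \<Rightarrow> real" where "sumcoef p = (\<Sum>a\<in>Poly_Mapping.keys p. Poly_Mapping.lookup p a)"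

lemma eval_one: "eval_poly p (\<lambda>_. 1) = sumcoef p"
  by (simp add: eval_poly_def sumcoef_def)

lemma sumcoef_superset: "finite S \<Longrightarrow> Poly_Mapping.keys p \<subseteq> S \<Longrightarrow> sumcoef p = (\<Sum>a\<in>S. Poly_Mapping.lookup p a)"
  unfolding sumcoef_def by (intro sum.mono_neutral_left) (auto simp: in_keys_iff)

lemma sumcoef_add: "sumcoef (p + q) = sumcoef p + sumcoef q"
proof -
  let ?S = "Poly_Mapping.keys p \<union> Poly_Mapping.keys q"
  have "Poly_Mapping.keys (p + q) \<subseteq> ?S" by (rule keys_add)
  then show ?thesis
    using sumcoef_superset[of ?S "p + q"] sumcoef_superset[of ?S p] sumcoef_superset[of ?S q]
    by (simp add: lookup_add sum.distrib)
qed

lemma sumcoef_single: "sumcoef (Poly_Mapping.single a v) = v"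
  by (cases "v = 0") (simp_all add: sumcoef_def)

lemma sumcoef_sum: "sumcoef (\<Sum>i\<in>S. f i) = (\<Sum>i\<in>S. sumcoef (f i))"
  by (induction S rule: infinite_finite_induct) (simp_all add: sumcoef_add, simp_all add: sumcoef_def)

lemma kys_subset_2: "kys x \<subseteq> {..<2} \<Longrightarrow> x = ex2 (lkp x 0) (lkp x 1)"
proof (rule poly_mapping_eqI)
  fix k assume "kys x \<subseteq> {..<2}"
  then have "k \<notin> {..<2} \<Longrightarrow> lkp x k = 0" by (metis in_keys_iff subsetD)
  then show "lkp x k = lkp (ex2 (lkp x 0) (lkp x 1)) k" by (auto simp: lkp_ex2)
qed

lemma ex2_inject: "ex2 p q = ex2 p' q' \<longleftrightarrow> p = p' \<and> q = q'"
  by (metis lkp_ex2 one_neq_zero)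

lemma psize_ex2: "psize (ex2 p q) = p + q"
  using psize_superset[OF _ kys_ex2, of p q] by (simp add: lkp_ex2 eval_nat_numeral)

lemma jack_poly_ex2:
  assumes ab: "b \<le> a" and f: "\<And>j. j \<le> a - b \<Longrightarrow> spec \<tau> (jack_sf (ex2 a b) (ex2 (a - j) (b + j))) (f j)"
  shows "jack_poly 2 \<tau> (ex2 a b) = (\<Sum>j\<le>a - b. Poly_Mapping.single (ex2 (a - j) (b + j)) (f j))"
proof -
  let ?R = "\<Sum>j\<le>a - b. Poly_Mapping.single (ex2 (a - j) (b + j)) (f j)"
  have "homsym (psize (ex2 a b)) (jack_sf (ex2 a b))" using jack_sf_unitriang[OF ex2_partition[OF ab]] by (simp add: unitriang_def)
  then have sd: "homsym (a + b) (jack_sf (ex2 a b))" by (simp add: psize_ex2)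
  have s: "symm (jack_sf (ex2 a b))" using sd by (simp add: homsym_def)
  have "(if kys x \<subseteq> {..<2} then specialize \<tau> (jack_sf (ex2 a b) x) else 0) = Poly_Mapping.lookup ?R x" for x
  proof -
    have R: "Poly_Mapping.lookup ?R x = (\<Sum>j\<le>a - b. if ex2 (a - j) (b + j) = x then f j else 0)"
      by (simp add: lookup_sum lookup_single when_def)
    show ?thesis
    proof (cases "\<exists>j\<le>a - b. x = ex2 (a - j) (b + j)")
      case True
      then obtain j where j: "j \<le> a - b" "x = ex2 (a - j) (b + j)" by blast
      have "(\<Sum>i\<le>a - b. if ex2 (a - i) (b + i) = x then f i else 0) = (\<Sum>i\<in>{j}. if ex2 (a - i) (b + i) = x then f i else 0)"
        using j by (intro sum.mono_neutral_right) (auto simp: ex2_inject)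
      then show ?thesis using R j kys_ex2[of "a - j" "b + j"] specialize_eq[OF f[OF j(1)]] by simp
    next
      case False
      then have 0: "Poly_Mapping.lookup ?R x = 0" unfolding R by (intro sum.neutral) auto
      show ?thesis
      proof (cases "kys x \<subseteq> {..<2}")
        case True
        define p q where "p = lkp x 0" and "q = lkp x 1"
        have x: "x = ex2 p q" using kys_subset_2[OF True] by (simp add: p_def q_def)
        have "jack_sf (ex2 a b) x = 0"
        proof (cases "p + q = a + b")
          case False then show ?thesis using homsymD(2)[OF sd, of x] by (simp add: x psize_ex2)
        next
          case pq: True
          have "p > a \<or> q > a"
          proof (rule ccontr)
            assume "\<not> (p > a \<or> q > a)"
            then have "a - p \<le> a - b" "p = a - (a - p)" "q = b + (a - p)" using pq ab by auto
            then have "a - p \<le> a - b" "x = ex2 (a - (a - p)) (b + (a - p))" by (simp_all add: x)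
            then show False using False by blast
          qed
          then show ?thesis
            using jack_ex2_vanish[OF ab, of p q] jack_ex2_vanish[OF ab, of q p] ex2_swap[OF s, of p q] by (auto simp: x)
        qed
        moreover have "specialize \<tau> 0 = 0" by (rule specialize_eq) (rule spec_const, rule hasval_0)
        ultimately show ?thesis using 0 by simp
      next
        case F: False then show ?thesis using 0 by simp
      qed
    qed
  qed
  then show ?thesis unfolding jack_poly_def by (simp add: lookup_inverse)
qed

text \<open>
  Half the sum and half the difference of the two variables.
\<close>
definition sv :: rpoly where "sv = const_poly (1 / 2) * (XX + YY)"
definition wv :: rpoly where "wv = const_poly (1 / 2) * (XX - YY)"

lemma half: "const_poly (1 / 2) * p + const_poly (1 / 2) * p = p"
proof -
  have "const_poly (1 / 2) + const_poly (1 / 2) = 1" unfolding const_poly_hom(2)[symmetric] by (simp add: const_poly_hom)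
  then show ?thesis by (metis distrib_right mult_1)
qed

lemma sv_wv: "sv + wv = XX" "sv - wv = YY"
proof -
  have "sv + wv = const_poly (1 / 2) * XX + const_poly (1 / 2) * XX" by (simp add: sv_def wv_def algebra_simps)
  then show "sv + wv = XX" by (simp only: half)
  have "sv - wv = const_poly (1 / 2) * YY + const_poly (1 / 2) * YY" by (simp add: sv_def wv_def algebra_simps)
  then show "sv - wv = YY" by (simp only: half)
qed

text \<open>
  The mean of \<open>(s + V w)\<^sup>m\<close> for a random variable \<open>V\<close> with moments \<open>N\<close>, where \<open>s\<close> and \<open>w\<close> are \<open>sv\<close> and
  \<open>wv\<close>.
\<close>
definition Phi :: "(nat \<Rightarrow> real) \<Rightarrow> nat \<Rightarrow> rpoly" where
  "Phi N m = (\<Sum>k\<le>m. const_poly (real (m choose k) * N k) * wv ^ k * sv ^ (m - k))"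

lemma jack_normalized_ex2_sum:
  assumes ab: "b \<le> a" and f: "\<And>j. j \<le> a - b \<Longrightarrow> spec \<tau> (jack_sf (ex2 a b) (ex2 (a - j) (b + j))) (f j)"
    and N: "(\<Sum>j\<le>a - b. const_poly (f j) * YY ^ j * XX ^ (a - b - j)) * const_poly (1 / (\<Sum>j\<le>a - b. f j)) = Phi N (a - b)"
  shows "jack_normalized 2 \<tau> (ex2 a b) = (XX * YY) ^ b * Phi N (a - b)"
proof -
  have J: "jack_poly 2 \<tau> (ex2 a b) = (\<Sum>j\<le>a - b. Poly_Mapping.single (ex2 (a - j) (b + j)) (f j))"
    by (rule jack_poly_ex2[OF ab]) (rule f)
  have "eval_poly (jack_poly 2 \<tau> (ex2 a b)) (\<lambda>_. 1) = (\<Sum>j\<le>a - b. f j)"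
    unfolding J eval_one sumcoef_sum sumcoef_single ..
  moreover have "jack_poly 2 \<tau> (ex2 a b) = (XX * YY) ^ b * (\<Sum>j\<le>a - b. const_poly (f j) * YY ^ j * XX ^ (a - b - j))"
  proof -
    have "Poly_Mapping.single (ex2 (a - j) (b + j)) (f j) = (XX * YY) ^ b * (const_poly (f j) * YY ^ j * XX ^ (a - b - j))"
      if "j \<le> a - b" for j
    proof -
      have e: "a - j = b + (a - b - j)" using that ab by simp
      show ?thesis unfolding single_ex2 e power_add power_mult_distrib by (simp only: mult_ac add_diff_cancel_left')
    qed
    then show ?thesis unfolding J sum_distrib_left by (intro sum.cong) auto
  qed
  ultimately show ?thesis unfolding jack_normalized_def N[symmetric] by (simp add: mult_ac)
qed

lemma jack_ex2_lead: assumes "b \<le> a" shows "spec \<tau> (jack_sf (ex2 a b) (ex2 a b)) 1"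
  using jack_sf_unitriang[OF ex2_partition[OF assms]] spec_const[OF hasval_1] by (simp add: unitriang_def)

lemma spec_jack_step:
  assumes ab: "b \<le> a" and j: "j < a - b" and t: "0 \<le> \<tau>"
    and pos: "par1 \<tau> * real (a - b - 1 - j) + par2 \<tau> > 0"
    and IH: "spec \<tau> (jack_sf (ex2 a b) (ex2 (a - j) (b + j))) v"
  shows "spec \<tau> (jack_sf (ex2 a b) (ex2 (a - Suc j) (b + Suc j)))
    (real (a - b - j) / real (Suc j) * ((par1 \<tau> * real j + par2 \<tau>) / (par1 \<tau> * real (a - b - 1 - j) + par2 \<tau>)) * v)"
proof -
  let ?F = "\<lambda>j. jack_sf (ex2 a b) (ex2 (a - j) (b + j))" and ?n = "a - b - 1 - j"
  have nz: "of_nat ?n + theta \<noteq> 0" using theta_pos by (metis add_nonneg_pos less_irrefl of_nat_0_le_iff)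
  have "of_nat (j + 1) * (of_nat ?n + theta) * ?F (j + 1) = of_nat (a - b - j) * (of_nat j + theta) * ?F j"
    by (rule jack_ex2_recurrence[OF ab j])
  moreover have "of_nat (j + 1) \<noteq> (0 :: ratfun)" by (simp only: of_nat_eq_0_iff)
  ultimately have "?F (j + 1) = of_nat (a - b - j) / of_nat (j + 1) * ((of_nat j + theta) / (of_nat ?n + theta)) * ?F j"
  proof -
    have *: "y = M / S * (A / D) * x" if "S * D * y = M * A * x" "S \<noteq> 0" "D \<noteq> 0" for S D M A x y :: ratfun
      using that by (simp add: field_simps)
    assume "of_nat (j + 1) * (of_nat ?n + theta) * ?F (j + 1) = of_nat (a - b - j) * (of_nat j + theta) * ?F j" "of_nat (j + 1) \<noteq> (0 :: ratfun)"
    then show ?thesis using nz by (rule *)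
  qed
  then have F: "?F (Suc j) = of_nat (a - b - j) / of_nat (Suc j) * ((of_nat j + of_nat 1 * theta) / (of_nat ?n + of_nat 1 * theta)) * ?F j"
    by simp
  have "spec \<tau> ((of_nat j + of_nat 1 * theta) / (of_nat ?n + of_nat 1 * theta))
     ((par1 \<tau> * real j + par2 \<tau>) / (par1 \<tau> * real ?n + par2 \<tau>))"
    using spec_moebius[of \<tau> ?n 1 j 1] t pos by (simp add: mult.commute)
  then show ?thesis unfolding F by (intro spec_mult spec_quot IH) simp_all
qed

text \<open>
  The sequence \<open>N\<close> consists of the moments of \<open>1 - 2U\<close>. For \<open>\<tau> = 0\<close> the variable \<open>1 - 2U\<close> takes the values
  \<open>1\<close> and \<open>- 1\<close> with equal probability.
\<close>
lemma jack_normalized_ex2: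
  assumes t: "0 \<le> \<tau>"
  shows "\<exists>N. N 0 = 1 \<and> (\<forall>k. 0 \<le> N k) \<and> (\<forall>k. odd k \<longrightarrow> N k = 0) \<and>
    (\<forall>a b. b \<le> a \<longrightarrow> jack_normalized 2 \<tau> (ex2 a b) = (XX * YY) ^ b * Phi N (a - b))"
proof (cases "par2 \<tau> > 0")
  case True
  interpret beta_moments const_poly "par1 \<tau>" "par2 \<tau>"
    by unfold_locales (use const_poly_hom par[OF t] True in auto)
  have "jack_normalized 2 \<tau> (ex2 a b) = (XX * YY) ^ b * Phi nu (a - b)" if ab: "b \<le> a" for a b
  proof (rule jack_normalized_ex2_sum[OF ab])
    fix j assume "j \<le> a - b"
    then show "spec \<tau> (jack_sf (ex2 a b) (ex2 (a - j) (b + j))) (cj (a - b) j)"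
    proof (induction j)
      case 0 then show ?case using jack_ex2_lead[OF ab] by simp
    next
      case (Suc j)
      then show ?case unfolding cj.simps
        by (intro spec_jack_step ab t pos) auto
    qed
  next
    let ?m = "a - b"
    \<comment> \<open>Normalization: the moment is the reciprocal of the value of the polynomial at \<open>(1, 1)\<close>.\<close>
    have "(\<Sum>j\<le>?m. cj ?m j) * moment ?m = 1" by (rule sum_cj) (use par[OF t] True in auto)
    then have moment: "1 / (\<Sum>j\<le>?m. cj ?m j) = moment ?m" by (metis mult_zero_left nonzero_eq_divide_eq one_neq_zero mult.commute)
    have "(\<Sum>j\<le>?m. const_poly (cj ?m j) * YY ^ j * XX ^ (?m - j)) * const_poly (1 / (\<Sum>j\<le>?m. cj ?m j))
      = (\<Sum>j\<le>?m. const_poly (cj ?m j * moment ?m) * (sv - wv) ^ j * (sv + wv) ^ (?m - j))"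
      unfolding moment sv_wv sum_distrib_right const_poly_hom by (simp only: mult_ac)
    also have "\<dots> = Phi nu ?m" unfolding moment_identity Phi_def ..
    finally show "(\<Sum>j\<le>?m. const_poly (cj ?m j) * YY ^ j * XX ^ (?m - j)) * const_poly (1 / (\<Sum>j\<le>?m. cj ?m j)) = Phi nu ?m" .
  qed
  then show ?thesis using nu_nonneg nu_odd by (intro exI[of _ nu]) auto
next
  case False
  then have p: "par2 \<tau> = 0" "par1 \<tau> = 1" using par[OF t] by (auto simp: par1_def par2_def split: if_splits)
  define N where "N k = (if even k then 1 else 0 :: real)" for k :: nat
  have "jack_normalized 2 \<tau> (ex2 a b) = (XX * YY) ^ b * Phi N (a - b)" if ab: "b \<le> a" for a b
  proof -
    let ?m = "a - b"
    define f where "f j = (if j = 0 \<or> j = ?m then 1 else 0 :: real)" for j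
    have small: "spec \<tau> (jack_sf (ex2 a b) (ex2 (a - j) (b + j))) (f j)" if "j < ?m" for j
      using that
    proof (induction j)
      case 0 then show ?case using jack_ex2_lead[OF ab] by (simp add: f_def)
    next
      case (Suc j)
      have "spec \<tau> (jack_sf (ex2 a b) (ex2 (a - Suc j) (b + Suc j)))
        (real (?m - j) / real (Suc j) * ((par1 \<tau> * real j + par2 \<tau>) / (par1 \<tau> * real (?m - 1 - j) + par2 \<tau>)) * f j)"
        using Suc by (intro spec_jack_step ab t) (auto simp: p)
      moreover have "real j * f j = 0" "f (Suc j) = 0" using Suc.prems by (auto simp: f_def)
      ultimately show ?case by (auto simp: p)
    qed
    have s: "symm (jack_sf (ex2 a b))" using jack_sf_unitriang[OF ex2_partition[OF ab]] by (simp add: unitriang_def homsym_def)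
    have spec: "spec \<tau> (jack_sf (ex2 a b) (ex2 (a - j) (b + j))) (f j)" if "j \<le> ?m" for j
    proof (cases "j = ?m")
      case True
      then have "jack_sf (ex2 a b) (ex2 (a - j) (b + j)) = jack_sf (ex2 a b) (ex2 a b)"
        using ex2_swap[OF s, of b a] ab by simp
      then show ?thesis using jack_ex2_lead[OF ab] True by (simp add: f_def)
    next
      case False then show ?thesis using small that by simp
    qed
    have bin: "(sv + w) ^ ?m = (\<Sum>k\<le>?m. of_nat (?m choose k) * w ^ k * sv ^ (?m - k))" for w :: rpoly
      unfolding add.commute[of sv w] binomial_ring ..
    have of_nat: "const_poly (real n) = of_nat n" for n by (induction n) (simp_all add: const_poly_hom)
    have two: "XX ^ ?m + YY ^ ?m = const_poly 2 * Phi N ?m"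
    proof -
      have "XX ^ ?m + YY ^ ?m = (sv + wv) ^ ?m + (sv + (- wv)) ^ ?m" using sv_wv by simp
      also have "\<dots> = (\<Sum>k\<le>?m. of_nat (?m choose k) * wv ^ k * sv ^ (?m - k) + of_nat (?m choose k) * (- wv) ^ k * sv ^ (?m - k))"
        unfolding bin sum.distrib ..
      also have "\<dots> = (\<Sum>k\<le>?m. const_poly 2 * (const_poly (real (?m choose k) * N k) * wv ^ k * sv ^ (?m - k)))"
      proof (intro sum.cong refl)
        fix k
        have "const_poly 2 = 2" using of_nat[of 2] by simp
        then show "of_nat (?m choose k) * wv ^ k * sv ^ (?m - k) + of_nat (?m choose k) * (- wv) ^ k * sv ^ (?m - k)
          = const_poly 2 * (const_poly (real (?m choose k) * N k) * wv ^ k * sv ^ (?m - k))"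
          by (cases "even k") (simp_all add: N_def of_nat const_poly_hom power_minus_odd)
      qed
      finally show ?thesis by (simp only: Phi_def sum_distrib_left)
    qed
    show ?thesis
    proof (rule jack_normalized_ex2_sum[OF ab spec])
      show "(\<Sum>j\<le>?m. const_poly (f j) * YY ^ j * XX ^ (?m - j)) * const_poly (1 / (\<Sum>j\<le>?m. f j)) = Phi N ?m"
      proof (cases "?m = 0")
        case True
        then show ?thesis by (simp add: f_def Phi_def N_def const_poly_hom)
      next
        case m: False
        have "(\<Sum>j\<le>?m. const_poly (f j) * YY ^ j * XX ^ (?m - j)) = (\<Sum>j\<in>{0, ?m}. const_poly (f j) * YY ^ j * XX ^ (?m - j))"
          by (intro sum.mono_neutral_right) (auto simp: f_def const_poly_hom)
        also have "\<dots> = XX ^ ?m + YY ^ ?m" using m by (simp add: f_def const_poly_hom)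
        finally have 1: "(\<Sum>j\<le>?m. const_poly (f j) * YY ^ j * XX ^ (?m - j)) = const_poly 2 * Phi N ?m" using two by simp
        have "(\<Sum>j\<le>?m. f j) = (\<Sum>j\<in>{0, ?m}. f j)"
          by (intro sum.mono_neutral_right) (auto simp: f_def)
        also have "\<dots> = 2" using m by (simp add: f_def)
        finally have 2: "(\<Sum>j\<le>?m. f j) = 2" .
        have "const_poly 2 * const_poly (1 / 2) = 1" unfolding const_poly_hom(3)[symmetric] by (simp add: const_poly_hom)
        then show ?thesis unfolding 1 2 by (metis mult.assoc mult.commute mult_1)
      qed
    qed
  qed
  then show ?thesis by (intro exI[of _ N]) (auto simp: N_def)
qed

section \<open>Closure properties of the Jack semiring\<close>

lemma semiring_gen: assumes "g \<in> jack_generators n \<sigma>" shows "g \<in> jack_semiring n \<sigma>"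
  unfolding jack_semiring_def using assms
  by (intro CollectI exI[of _ "1 :: nat"] exI[of _ "\<lambda>_. 1 :: real"] exI[of _ "\<lambda>_. [g]"]) (simp add: const_poly_hom)

lemma semiring_const: assumes "0 \<le> c" shows "const_poly c \<in> jack_semiring n \<sigma>"
  unfolding jack_semiring_def using assms
  by (intro CollectI exI[of _ "1 :: nat"] exI[of _ "\<lambda>_. c"] exI[of _ "\<lambda>_. []"]) simp

lemma semiring_add:
  assumes "p \<in> jack_semiring n \<sigma>" "q \<in> jack_semiring n \<sigma>" shows "p + q \<in> jack_semiring n \<sigma>"
proof -
  obtain N :: nat and c gs where 1: "p = (\<Sum>i<N. const_poly (c i) * prod_list (gs i))"
    "\<And>i. i < N \<Longrightarrow> 0 \<le> c i \<and> set (gs i) \<subseteq> jack_generators n \<sigma>"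
    using assms(1) by (auto simp: jack_semiring_def)
  obtain M :: nat and d hs where 2: "q = (\<Sum>i<M. const_poly (d i) * prod_list (hs i))"
    "\<And>i. i < M \<Longrightarrow> 0 \<le> d i \<and> set (hs i) \<subseteq> jack_generators n \<sigma>"
    using assms(2) by (auto simp: jack_semiring_def)
  define e where "e i = (if i < N then c i else d (i - N))" for i
  define ks where "ks i = (if i < N then gs i else hs (i - N))" for i
  have split: "(\<Sum>i<N + M. h i) = (\<Sum>i<N. h i) + (\<Sum>i<M. h (N + i))" for h :: "nat \<Rightarrow> rpoly"
    by (induction M) (simp_all add: add.assoc)
  have "(\<Sum>i<N + M. const_poly (e i) * prod_list (ks i)) = (\<Sum>i<N. const_poly (e i) * prod_list (ks i)) + (\<Sum>i<M. const_poly (e (N + i)) * prod_list (ks (N + i)))"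
    by (rule split)
  also have "\<dots> = p + q" by (simp add: 1(1) 2(1) e_def ks_def)
  finally have "p + q = (\<Sum>i<N + M. const_poly (e i) * prod_list (ks i))" ..
  moreover have "\<forall>i<N + M. 0 \<le> e i \<and> set (ks i) \<subseteq> jack_generators n \<sigma>"
    using 1(2) 2(2) by (auto simp: e_def ks_def)
  ultimately show ?thesis unfolding jack_semiring_def by blast
qed

lemma semiring_zero: "0 \<in> jack_semiring n \<sigma>"
  using semiring_const[of 0] by (simp add: const_poly_hom)

lemma semiring_sum:
  "(\<And>i. i \<in> S \<Longrightarrow> f i \<in> jack_semiring n \<sigma>) \<Longrightarrow> (\<Sum>i\<in>S. f i) \<in> jack_semiring n \<sigma>"
  by (induction S rule: infinite_finite_induct) (auto intro: semiring_zero semiring_add)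

lemma semiring_mult:
  assumes "p \<in> jack_semiring n \<sigma>" "q \<in> jack_semiring n \<sigma>" shows "p * q \<in> jack_semiring n \<sigma>"
proof -
  obtain N :: nat and c gs where 1: "p = (\<Sum>i<N. const_poly (c i) * prod_list (gs i))"
    "\<And>i. i < N \<Longrightarrow> 0 \<le> c i \<and> set (gs i) \<subseteq> jack_generators n \<sigma>"
    using assms(1) by (auto simp: jack_semiring_def)
  obtain M :: nat and d hs where 2: "q = (\<Sum>i<M. const_poly (d i) * prod_list (hs i))"
    "\<And>i. i < M \<Longrightarrow> 0 \<le> d i \<and> set (hs i) \<subseteq> jack_generators n \<sigma>"
    using assms(2) by (auto simp: jack_semiring_def)
  have "const_poly (c i) * prod_list (gs i) * (const_poly (d j) * prod_list (hs j)) \<in> jack_semiring n \<sigma>"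
    if "i < N" "j < M" for i j
    unfolding jack_semiring_def
    by (intro CollectI exI[of _ "1 :: nat"] exI[of _ "\<lambda>_. c i * d j"] exI[of _ "\<lambda>_. gs i @ hs j"])
      (use 1(2)[OF that(1)] 2(2)[OF that(2)] in \<open>simp add: const_poly_hom mult_ac\<close>)
  then show ?thesis unfolding 1(1) 2(1) sum_product by (intro semiring_sum) simp
qed

lemma semiring_power: "p \<in> jack_semiring n \<sigma> \<Longrightarrow> p ^ k \<in> jack_semiring n \<sigma>"
  by (induction k) (use semiring_const[of 1] in \<open>auto intro: semiring_mult simp: const_poly_hom\<close>)

section \<open>Differences in two variables\<close>

lemma Phi_1: "N 0 = 1 \<Longrightarrow> N 1 = 0 \<Longrightarrow> Phi N 1 = sv"
  by (simp add: Phi_def const_poly_hom)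

lemma XY: "XX * YY = sv ^ 2 - wv ^ 2"
  by (simp add: sv_wv[symmetric] power2_eq_square algebra_simps)

text \<open>
  Since \<open>x y = s\<^sup>2 - w\<^sup>2\<close>, the coefficients are \<open>((m+2 choose k) - (m choose k)) N\<^sub>k + (m choose k-2) N\<^bsub>k-2\<^esub>\<close>,
  which are nonnegative for nonnegative even moments.
\<close>
lemma Phi_step_coeff:
  "Phi N (m + 2) - XX * YY * Phi N m = (\<Sum>k\<le>m + 2. const_poly (real (m + 2 choose k) * N k - real (m choose k) * N k
      + (if 2 \<le> k then real (m choose (k - 2)) * N (k - 2) else 0)) * wv ^ k * sv ^ (m + 2 - k))"
proof -
  have 1: "sv ^ 2 * Phi N m = (\<Sum>k\<le>m + 2. const_poly (real (m choose k) * N k) * wv ^ k * sv ^ (m + 2 - k))"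
  proof -
    have "sv ^ 2 * Phi N m = (\<Sum>k\<le>m. const_poly (real (m choose k) * N k) * wv ^ k * sv ^ (m + 2 - k))"
      unfolding Phi_def sum_distrib_left
    proof (intro sum.cong refl)
      fix k assume "k \<in> {..m}"
      then have "m + 2 - k = 2 + (m - k)" by simp
      then show "sv ^ 2 * (const_poly (real (m choose k) * N k) * wv ^ k * sv ^ (m - k)) = const_poly (real (m choose k) * N k) * wv ^ k * sv ^ (m + 2 - k)"
        by (simp only: power_add mult_ac)
    qed
    also have "\<dots> = (\<Sum>k\<le>m + 2. const_poly (real (m choose k) * N k) * wv ^ k * sv ^ (m + 2 - k))"
    proof (intro sum.mono_neutral_left ballI)
      fix k assume "k \<in> {..m + 2} - {..m}"
      then have z: "m choose k = 0" by (intro binomial_eq_0) simp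
      show "const_poly (real (m choose k) * N k) * wv ^ k * sv ^ (m + 2 - k) = 0"
        by (simp only: z of_nat_0 mult_zero_left const_poly_hom(4))
    qed auto
    finally show ?thesis .
  qed
  have 2: "wv ^ 2 * Phi N m = (\<Sum>k\<le>m + 2. const_poly (if 2 \<le> k then real (m choose (k - 2)) * N (k - 2) else 0) * wv ^ k * sv ^ (m + 2 - k))"
  proof -
    have "wv ^ 2 * Phi N m = (\<Sum>k\<le>m. const_poly (real (m choose k) * N k) * wv ^ (k + 2) * sv ^ (m - k))"
      unfolding Phi_def sum_distrib_left by (simp only: power_add mult_ac)
    also have "\<dots> = (\<Sum>k\<in>{2..m + 2}. const_poly (real (m choose (k - 2)) * N (k - 2)) * wv ^ k * sv ^ (m + 2 - k))"
      by (rule sum.reindex_bij_witness[of _ "\<lambda>k. k - 2" "\<lambda>k. k + 2"]) auto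
    also have "\<dots> = (\<Sum>k\<le>m + 2. const_poly (if 2 \<le> k then real (m choose (k - 2)) * N (k - 2) else 0) * wv ^ k * sv ^ (m + 2 - k))"
      by (intro sum.mono_neutral_cong_left) (auto simp: const_poly_hom)
    finally show ?thesis .
  qed
  have cd: "const_poly (u - v) = const_poly u - const_poly v" for u v
    by (simp add: const_poly_def single_diff)
  have "Phi N (m + 2) - XX * YY * Phi N m = Phi N (m + 2) - sv ^ 2 * Phi N m + wv ^ 2 * Phi N m"
    unfolding XY by (simp add: algebra_simps)
  also have "\<dots> = (\<Sum>k\<le>m + 2. const_poly (real (m + 2 choose k) * N k) * wv ^ k * sv ^ (m + 2 - k)
     - const_poly (real (m choose k) * N k) * wv ^ k * sv ^ (m + 2 - k)
     + const_poly (if 2 \<le> k then real (m choose (k - 2)) * N (k - 2) else 0) * wv ^ k * sv ^ (m + 2 - k))"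
    unfolding 1 2 by (simp only: Phi_def sum.distrib sum_subtractf)
  finally show ?thesis by (simp only: cd const_poly_hom(2) distrib_right left_diff_distrib)
qed

lemma Parts_2: "Parts 2 = {ex2 a b | a b. b \<le> a}"
proof (intro equalityI subsetI)
  fix x assume x: "x \<in> Parts 2"
  then have "x = ex2 (lkp x 0) (lkp x 1)" using kys_subset_2 by (simp add: Parts_def)
  moreover have "lkp x 1 \<le> lkp x 0" using x partition_mono[of x 0 1] by (simp add: Parts_def)
  ultimately show "x \<in> {ex2 a b | a b. b \<le> a}" by blast
next
  fix x assume "x \<in> {ex2 a b | a b. b \<le> a}"
  then show "x \<in> Parts 2" by (auto simp: Parts_def ex2_partition dest: subsetD[OF kys_ex2])
qed

context
  fixes \<sigma> :: ereal
  assumes \<sigma>: "0 \<le> \<sigma>" "\<sigma> < \<infinity>"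
begin

lemma sv_in: "sv \<in> jack_semiring 2 \<sigma>"
proof -
  obtain N where N: "N 0 = 1" "\<And>k. odd k \<Longrightarrow> N k = 0"
    "\<And>a b. b \<le> a \<Longrightarrow> jack_normalized 2 \<sigma> (ex2 a b) = (XX * YY) ^ b * Phi N (a - b)"
    using jack_normalized_ex2[OF \<sigma>(1)] by blast
  have "sv = jack_normalized 2 \<sigma> (ex2 1 0)" using N(3)[of 0 1] Phi_1[of N] N(1,2) by simp
  moreover have "jack_normalized 2 \<sigma> (ex2 1 0) \<in> jack_generators 2 \<sigma>"
    unfolding jack_generators_def Parts_2 by blast
  ultimately show ?thesis by (simp add: semiring_gen)
qed

lemma XY_in: "XX * YY \<in> jack_semiring 2 \<sigma>"
proof -
  obtain N where N: "N 0 = 1"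
    "\<And>a b. b \<le> a \<Longrightarrow> jack_normalized 2 \<sigma> (ex2 a b) = (XX * YY) ^ b * Phi N (a - b)"
    using jack_normalized_ex2[OF \<sigma>(1)] by blast
  have "XX * YY = jack_normalized 2 \<sigma> (ex2 1 1)" using N(2)[of 1 1] N(1) by (simp add: Phi_def const_poly_hom)
  moreover have "jack_normalized 2 \<sigma> (ex2 1 1) \<in> jack_generators 2 \<sigma>"
    unfolding jack_generators_def Parts_2 by blast
  ultimately show ?thesis by (simp add: semiring_gen)
qed

lemma wv2_in: "wv ^ 2 \<in> jack_semiring 2 \<sigma>"
proof -
  obtain N where N: "N 0 = 1" "\<And>k. odd k \<Longrightarrow> N k = 0" "\<And>k. 0 \<le> N k"
    "\<And>a b. b \<le> a \<Longrightarrow> jack_normalized 2 \<sigma> (ex2 a b) = (XX * YY) ^ b * Phi N (a - b)"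
    using jack_normalized_ex2[OF \<sigma>(1)] by blast
  let ?g = "jack_normalized 2 \<sigma> (ex2 2 0) - jack_normalized 2 \<sigma> (ex2 1 1)"
  have "ex2 2 0 \<succcurlyeq> ex2 1 1"
  proof -
    have "(\<Sum>i<k. lkp (ex2 1 1) i) \<le> (\<Sum>i<k. lkp (ex2 2 0) i)" for k
    proof -
      consider "k = 0" | "k = 1" | n where "k = Suc (Suc n)" by (metis One_nat_def not0_implies_Suc)
      then show ?thesis
      proof cases
        case 3
        have "(\<Sum>i<Suc (Suc n). lkp (ex2 p q) i) = p + q" for p q
          unfolding sum.lessThan_Suc_shift by (simp add: lkp_ex2)
        then show ?thesis unfolding 3 by simp
      qed (simp_all add: lkp_ex2)
    qed
    then show ?thesis by (simp add: majorizes_def psize_ex2)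
  qed
  then have "?g \<in> jack_generators 2 \<sigma>" unfolding jack_generators_def Parts_2 by fastforce
  then have g: "?g \<in> jack_semiring 2 \<sigma>" by (rule semiring_gen)
  have "?g = Phi N 2 - XX * YY * Phi N 0"
    using N(4)[of 0 2] N(4)[of 1 1] by simp
  also have "\<dots> = Phi N (0 + 2) - XX * YY * Phi N 0" by (simp only: add_0)
  also have "\<dots> = const_poly (1 + N 2) * wv ^ 2"
    unfolding Phi_step_coeff using N(1) N(2)[of 1] by (simp add: eval_nat_numeral const_poly_hom)
  finally have e: "?g = const_poly (1 + N 2) * wv ^ 2" .
  have n: "1 + N 2 > 0" using N(3)[of 2] by simp
  have "const_poly (1 / (1 + N 2)) * ?g = wv ^ 2"
    unfolding e mult.assoc[symmetric] const_poly_hom(3)[symmetric] using n by (simp add: const_poly_hom)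
  moreover have "const_poly (1 / (1 + N 2)) * ?g \<in> jack_semiring 2 \<sigma>"
    using n by (intro semiring_mult semiring_const g) simp
  ultimately show ?thesis by simp
qed

lemma Phi_step_in:
  assumes "\<And>k. 0 \<le> N k" "\<And>k. odd k \<Longrightarrow> N k = 0"
  shows "Phi N (m + 2) - XX * YY * Phi N m \<in> jack_semiring 2 \<sigma>"
  unfolding Phi_step_coeff
proof (rule semiring_sum)
  fix k assume "k \<in> {..m + 2}"
  let ?c = "real (m + 2 choose k) * N k - real (m choose k) * N k + (if 2 \<le> k then real (m choose (k - 2)) * N (k - 2) else 0)"
  show "const_poly ?c * wv ^ k * sv ^ (m + 2 - k) \<in> jack_semiring 2 \<sigma>"
  proof (cases "even k")
    case True
    have "(m choose k) \<le> (m + 2 choose k)" by (rule binomial_right_mono) simp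
    then have "real (m choose k) * N k \<le> real (m + 2 choose k) * N k" using assms(1) by (intro mult_right_mono) auto
    then have "0 \<le> ?c" using assms(1)[of "k - 2"] by auto
    moreover have "wv ^ k = (wv ^ 2) ^ (k div 2)" using True by (simp flip: power_mult)
    ultimately show ?thesis
      by (simp only:) (intro semiring_mult semiring_const semiring_power sv_in wv2_in)
  next
    case False
    then have "N k = 0" "2 \<le> k \<Longrightarrow> N (k - 2) = 0" using assms(2) by auto
    then have "?c = 0" by auto
    then show ?thesis by (simp only: const_poly_hom mult_zero_left semiring_zero)
  qed
qed

lemma two_variables:
  assumes \<tau>: "0 \<le> \<tau>" and "lam \<in> Parts 2" "mu \<in> Parts 2" "lam \<succcurlyeq> mu"
  shows "jack_normalized 2 \<tau> lam - jack_normalized 2 \<tau> mu \<in> jack_semiring 2 \<sigma>"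
proof -
  obtain N where N: "\<And>k. 0 \<le> N k" "\<And>k. odd k \<Longrightarrow> N k = 0"
    "\<And>a b. b \<le> a \<Longrightarrow> jack_normalized 2 \<tau> (ex2 a b) = (XX * YY) ^ b * Phi N (a - b)"
    using jack_normalized_ex2[OF \<tau>] by blast
  obtain a b where lam: "lam = ex2 a b" "b \<le> a" using assms(2) by (auto simp: Parts_2)
  obtain a' b' where mu: "mu = ex2 a' b'" "b' \<le> a'" using assms(3) by (auto simp: Parts_2)
  have s: "a + b = a' + b'" using assms(4) by (simp add: majorizes_def lam mu psize_ex2)
  have "(\<Sum>i<1. lkp mu i) \<le> (\<Sum>i<1. lkp lam i)" using assms(4) unfolding majorizes_def by blast
  then have "a' \<le> a" by (simp add: lam mu lkp_ex2)
  define t where "t = a - a'"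
  have mu': "mu = ex2 (a - t) (b + t)" "2 * t \<le> a - b"
    using s \<open>a' \<le> a\<close> mu lam by (auto simp: t_def ex2_inject)
  have "jack_normalized 2 \<tau> (ex2 a b) - jack_normalized 2 \<tau> (ex2 (a - t) (b + t)) \<in> jack_semiring 2 \<sigma>"
    using mu'(2)
  proof (induction t)
    case 0 then show ?case by (simp add: semiring_zero)
  next
    case (Suc t)
    let ?m = "a - b - 2 * Suc t"
    have "jack_normalized 2 \<tau> (ex2 (a - t) (b + t)) - jack_normalized 2 \<tau> (ex2 (a - Suc t) (b + Suc t))
       = (XX * YY) ^ (b + t) * (Phi N (?m + 2) - XX * YY * Phi N ?m)"
    proof -
      have "a - t - (b + t) = ?m + 2" "a - Suc t - (b + Suc t) = ?m" using Suc.prems by auto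
      then show ?thesis using N(3)[of "b + t" "a - t"] N(3)[of "b + Suc t" "a - Suc t"] Suc.prems
        by (simp add: algebra_simps)
    qed
    also have "\<dots> \<in> jack_semiring 2 \<sigma>"
      by (intro semiring_mult semiring_power XY_in Phi_step_in N)
    finally have 1: "jack_normalized 2 \<tau> (ex2 (a - t) (b + t)) - jack_normalized 2 \<tau> (ex2 (a - Suc t) (b + Suc t)) \<in> jack_semiring 2 \<sigma>" .
    have "jack_normalized 2 \<tau> (ex2 a b) - jack_normalized 2 \<tau> (ex2 (a - t) (b + t)) \<in> jack_semiring 2 \<sigma>"
      using Suc by simp
    from semiring_add[OF this 1] show ?case by simp
  qed
  then show ?thesis by (simp add: lam mu')
qed

end

section \<open>The partitions next to a column\<close>

text \<open>
  The partitions \<open>(1\<^sup>n)\<close> and \<open>(2, 1\<^bsup>n-2\<^esup>)\<close>.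
\<close>
definition colpart :: "nat \<Rightarrow> expo" where "colpart n = Poly_Mapping.nth (replicate n 1)"
definition hookpart :: "nat \<Rightarrow> expo" where "hookpart n = Poly_Mapping.nth (2 # replicate (n - 2) 1 @ [0])"

lemma lkp_col: "lkp (colpart n) k = (if k < n then 1 else 0)"
  by (simp add: colpart_def nth_default_def)

lemma lkp_hook: "lkp (hookpart n) k = (if k = 0 then 2 else if k < n - 1 then 1 else 0)"
  by (auto simp: hookpart_def nth_default_def nth_append nth_Cons split: nat.split)

lemma kys_col: "kys (colpart n) = {..<n}"
  by (auto simp: in_keys_iff lkp_col split: if_splits)

lemma kys_hook: "2 \<le> n \<Longrightarrow> kys (hookpart n) = {..<n - 1}"
  by (auto simp: in_keys_iff lkp_hook split: if_splits)

lemma partition_col: "is_partition (colpart n)"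
  by (auto simp: is_partition_def antimono_def lkp_col)

lemma partition_hook: "is_partition (hookpart n)"
  by (auto simp: is_partition_def antimono_def lkp_hook)

lemma hook_from_col:
  assumes "i < n" "j < n" "i \<noteq> j"
  shows "parts (colpart n + sgl i 1 - sgl j 1) = parts (hookpart n)"
proof -
  let ?c = "colpart n + sgl i 1 - sgl j 1"
  have lc: "lkp ?c k = (if k = i then 2 else if k = j then 0 else if k < n then 1 else 0)" for k
    using assms by (simp add: lkp_col lkp_diff_single lkp_add_single)
  define j' where "j' = transpose 0 i j"
  define \<pi> where "\<pi> = transpose 0 i \<circ> transpose (n - 1) j'"
  have bij: "bij \<pi>" unfolding \<pi>_def by (intro bij_comp) simp_all
  have j': "j' \<noteq> 0" "j' < n" using assms by (auto simp: j'_def transpose_def)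
  have p0: "\<pi> 0 = i" using j' assms by (simp add: \<pi>_def transpose_def)
  have pn: "\<pi> (n - 1) = j" using assms by (simp add: \<pi>_def j'_def)
  have lt: "transpose x y k < n \<longleftrightarrow> k < n" if "x < n" "y < n" for x y k
    using that by (auto simp: transpose_def)
  have "\<pi> k < n \<longleftrightarrow> k < n" for k using assms j' by (simp add: \<pi>_def lt)
  moreover have "\<pi> k = i \<longleftrightarrow> k = 0" "\<pi> k = j \<longleftrightarrow> k = n - 1" for k
    using bij p0 pn by (metis bij_is_inj inj_eq)+
  moreover have "n - 1 \<noteq> 0" using assms by auto
  ultimately have "lkp (hookpart n) k = lkp ?c (\<pi> k)" for k
    unfolding lc lkp_hook by auto
  with bij have "parts (hookpart n) = parts ?c" by (rule parts_eq_bij)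
  then show ?thesis ..
qed

lemma psize_col: "psize (colpart n) = n" 
  by (simp add: psize_def kys_col lkp_col)

lemma psize_hook: assumes "2 \<le> n" shows "psize (hookpart n) = n"
proof -
  have "psize (hookpart n) = (\<Sum>k<n - 1. lkp (hookpart n) k)" using assms by (simp add: psize_def kys_hook)
  also have "n - 1 = Suc (n - 2)" using assms by simp
  also have "(\<Sum>k<Suc (n - 2). lkp (hookpart n) k) = 2 + (\<Sum>k<n - 2. 1)"
    unfolding sum.lessThan_Suc_shift by (intro arg_cong2[where f = "(+)"] sum.cong) (auto simp: lkp_hook)
  finally show ?thesis using assms by simp
qed

lemma excess_hook:
  assumes "2 \<le> n" shows "excess 1 (parts (hookpart n)) = 1" "excess 2 (parts (hookpart n)) = 0"
proof -
  have "excess 1 (parts (hookpart n)) = (\<Sum>k\<in>{0}. lkp (hookpart n) k - 1)"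
    unfolding excess_parts using assms by (intro sum.mono_neutral_right) (auto simp: kys_hook lkp_hook)
  then show "excess 1 (parts (hookpart n)) = 1" by (simp add: lkp_hook)
  show "excess 2 (parts (hookpart n)) = 0" unfolding excess_parts by (intro sum.neutral) (auto simp: lkp_hook)
qed

lemma below_hook:
  assumes n: "2 \<le> n" and m: "domin (parts a) (parts (hookpart n))"
  shows "lkp a i \<le> 2" "i \<noteq> j \<Longrightarrow> lkp a i = 2 \<Longrightarrow> lkp a j \<le> 1"
proof -
  have e: "excess 2 (parts a) = 0" "excess 1 (parts a) \<le> 1"
    using m excess_hook[OF n] by (auto simp: domin_def dest: spec[of _ 2] spec[of _ 1])
  have "\<forall>k\<in>kys a. lkp a k - 2 = 0" using e(1) by (simp add: excess_parts)
  then show "lkp a i \<le> 2" by (cases "i \<in> kys a") (auto simp: in_keys_iff)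
  show "lkp a j \<le> 1" if "i \<noteq> j" "lkp a i = 2"
  proof -
    have "(lkp a i - 1) + (lkp a j - 1) = (\<Sum>k\<in>{i, j}. lkp a k - 1)" using that by simp
    also have "\<dots> \<le> (\<Sum>k\<in>insert i (insert j (kys a)). lkp a k - 1)" by (intro sum_mono2) auto
    also have "\<dots> = excess 1 (parts a)" by (rule excess_parts_superset[symmetric]) auto
    finally show ?thesis using e(2) that by simp
  qed
qed

lemma below_hook_cases:
  assumes n: "2 \<le> n" and m: "domin (parts a) (parts (hookpart n))"
  shows "parts a = parts (hookpart n) \<or> parts a = parts (colpart n)"
proof -
  note B = below_hook[OF n m]
  have ps: "psize a = n" using m n by (simp add: domin_def psize_hook)
  obtain b where b: "is_partition b" "parts b = parts a" using ex_partition[of "parts a"] by auto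
  have B': "lkp b i \<le> 2" "i \<noteq> j \<Longrightarrow> lkp b i = 2 \<Longrightarrow> lkp b j \<le> 1" for i j
    using below_hook[OF n, of b] m b by auto
  have psb: "psize b = n" using b ps by (metis sum_mset_parts)
  define d where "d = card (kys b)"
  have kb: "kys b = {..<d}" using partition_keys[OF b(1)] by (simp add: d_def)
  show ?thesis
  proof (cases "lkp b 0 = 2")
    case True
    have one: "lkp b k = 1" if "0 < k" "k < d" for k
      using B'(2)[of 0 k] True that kb by (metis bot_nat_0.not_eq_extremum in_keys_iff lessThan_iff le_antisym less_one linorder_not_le)
    have d0: "d > 0" using True kb by (metis in_keys_iff lessThan_iff zero_neq_numeral)
    have "psize b = (\<Sum>k<Suc (d - 1). lkp b k)" using d0 by (simp add: psize_def kb)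
    also have "\<dots> = 2 + (\<Sum>k<d - 1. 1)"
      unfolding sum.lessThan_Suc_shift using True one by (intro arg_cong2[where f = "(+)"] sum.cong) auto
    finally have "d = n - 1" using psb d0 by simp
    then have "b = hookpart n" using True one kb n
      by (intro poly_mapping_eqI) (auto simp: lkp_hook in_keys_iff simp flip: kb dest: arg_cong[where f = "\<lambda>S. _ \<in> S"])
    then show ?thesis using b by simp
  next
    case False
    have "lkp b k \<le> lkp b 0" for k by (rule partition_mono[OF b(1)]) simp
    then have le: "lkp b k \<le> 1" for k using False B'(1)[of 0] by (metis One_nat_def Suc_1 le_SucE le_trans)
    have one: "lkp b k = 1" if "k < d" for k
      using le[of k] that kb by (metis in_keys_iff lessThan_iff le_antisym less_one linorder_not_le)
    then have "psize b = d" by (simp add: psize_def kb)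
    then have "b = colpart n" using one kb psb
      by (intro poly_mapping_eqI) (metis in_keys_iff lessThan_iff lkp_col)
    then show ?thesis using b by simp
  qed
qed

lemma csop_col:
  assumes i: "i < n" and n: "2 \<le> n" and f: "symm f"
  shows "csop f i (colpart n) = f (colpart n) + 2 * of_nat (n - 1) * theta * f (hookpart n)"
proof -
  have "(\<Sum>j\<in>{..<n} - {i}. \<Sum>r\<in>{1..lkp (colpart n) j}. (of_nat (lkp (colpart n) i) - of_nat (lkp (colpart n) j) + 2 * of_nat r) * f (colpart n + sgl i r - sgl j r))
     = (\<Sum>j\<in>{..<n} - {i}. 2 * f (hookpart n))"
  proof (intro sum.cong refl)
    fix j assume j: "j \<in> {..<n} - {i}"
    then have "parts (colpart n + sgl i 1 - sgl j 1) = parts (hookpart n)" using i by (intro hook_from_col) auto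
    then have "f (colpart n + sgl i 1 - sgl j 1) = f (hookpart n)" by (rule symmD[OF f])
    then show "(\<Sum>r\<in>{1..lkp (colpart n) j}. (of_nat (lkp (colpart n) i) - of_nat (lkp (colpart n) j) + 2 * of_nat r) * f (colpart n + sgl i r - sgl j r))
      = 2 * f (hookpart n)" using i j by (simp add: lkp_col)
  qed
  also have "\<dots> = 2 * of_nat (n - 1) * f (hookpart n)" using i by simp
  finally have eq: "(\<Sum>j\<in>{..<n} - {i}. \<Sum>r\<in>{1..lkp (colpart n) j}. (of_nat (lkp (colpart n) i) - of_nat (lkp (colpart n) j) + 2 * of_nat r) * f (colpart n + sgl i r - sgl j r))
     = 2 * of_nat (n - 1) * f (hookpart n)" .
  show ?thesis unfolding csop_def kys_col eq using i by (simp add: lkp_col mult_ac)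
qed

text \<open>
  The Calogero-Sutherland equation at \<open>(2, 1\<^bsup>n-2\<^esup>)\<close> gives the eigenvalue, and then at \<open>(1\<^sup>n)\<close> it gives the
  only other coefficient.
\<close>
lemma hook_coefficient:
  assumes n: "2 \<le> n"
  shows "(1 + of_nat (n - 1) * theta) * jack_sf (hookpart n) (colpart n) = of_nat (n * (n - 1)) * theta"
proof -
  let ?h = "hookpart n" and ?c = "colpart n"
  let ?f = "jack_sf ?h"
  have u: "unitriang (parts ?h) ?f" by (rule jack_sf_unitriang[OF partition_hook])
  then have s: "symm ?f" and one: "?f ?h = 1" and bel: "\<And>b. ?f b \<noteq> 0 \<Longrightarrow> domin (parts b) (parts ?h)"
    by (auto simp: unitriang_def homsym_def below_def)
  have zero3: "?f b = 0" if "lkp b k \<ge> 3" for b k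
    using below_hook(1)[OF n bel, of b k] that by (cases "?f b = 0") auto
  have zero2: "?f b = 0" if "i \<noteq> j" "lkp b i = 2" "lkp b j = 2" for b i j
    using below_hook(2)[OF n bel, of b i j] that by (cases "?f b = 0") auto
  obtain E where E: "\<And>b. kys b \<subseteq> {..<n} \<Longrightarrow> (\<Sum>i<n. csop ?f i b) = E * ?f b"
    using jack_cs_equation[OF partition_hook, of n] by blast
  have c0: "csop ?f 0 ?h = 4"
  proof -
    have "(\<Sum>j\<in>kys ?h - {0}. \<Sum>r\<in>{1..lkp ?h j}. (of_nat (lkp ?h 0) - of_nat (lkp ?h j) + 2 * of_nat r) * ?f (?h + sgl 0 r - sgl j r)) = 0"
    proof (intro sum.neutral ballI)
      fix j r assume j: "j \<in> kys ?h - {0}" and r: "r \<in> {1..lkp ?h j}"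
      have "?f (?h + sgl 0 r - sgl j r) = 0"
        by (rule zero3[of _ 0]) (use j r in \<open>auto simp: lkp_hook lkp_diff_single lkp_add_single\<close>)
      then show "(of_nat (lkp ?h 0) - of_nat (lkp ?h j) + 2 * of_nat r) * ?f (?h + sgl 0 r - sgl j r) = 0" by simp
    qed
    then show ?thesis unfolding csop_def using one by (simp add: lkp_hook)
  qed
  have ci: "csop ?f i ?h = 1 + theta" if i: "0 < i" "i < n - 1" for i
  proof -
    have hi: "lkp ?h i = 1" "lkp ?h 0 = 2" using i by (simp_all add: lkp_hook)
    have "(\<Sum>j\<in>kys ?h - {i}. \<Sum>r\<in>{1..lkp ?h j}. (of_nat (lkp ?h i) - of_nat (lkp ?h j) + 2 * of_nat r) * ?f (?h + sgl i r - sgl j r))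
      = (\<Sum>j\<in>{0}. \<Sum>r\<in>{1..lkp ?h j}. (of_nat (lkp ?h i) - of_nat (lkp ?h j) + 2 * of_nat r) * ?f (?h + sgl i r - sgl j r))"
    proof (intro sum.mono_neutral_right ballI)
      show "{0} \<subseteq> kys ?h - {i}" using i n by (auto simp: kys_hook)
      fix j assume j: "j \<in> kys ?h - {i} - {0}"
      then have hj: "lkp ?h j = 1" using n by (auto simp: kys_hook lkp_hook)
      have "?f (?h + sgl i 1 - sgl j 1) = 0"
        by (rule zero2[of i 0]) (use i j hi in \<open>auto simp: lkp_diff_single lkp_add_single\<close>)
      then show "(\<Sum>r\<in>{1..lkp ?h j}. (of_nat (lkp ?h i) - of_nat (lkp ?h j) + 2 * of_nat r) * ?f (?h + sgl i r - sgl j r)) = 0"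
        by (simp add: hj)
    qed simp
    also have "\<dots> = ?f (?h + sgl i 1 - sgl 0 1) + 3 * ?f (?h + sgl i 2 - sgl 0 2)"
      by (simp add: hi numeral_2_eq_2)
    also have "?f (?h + sgl i 1 - sgl 0 1) = 1"
    proof -
      have "?h + sgl i 1 - sgl 0 1 = swp 0 i ?h"
        using i by (intro poly_mapping_eqI) (auto simp: lkp_swp lkp_hook lkp_diff_single lkp_add_single transpose_def)
      then show ?thesis using symmD[OF s, of "swp 0 i ?h" ?h] one by simp
    qed
    also have "?f (?h + sgl i 2 - sgl 0 2) = 0"
      by (rule zero3[of _ i]) (use i in \<open>auto simp: lkp_hook lkp_diff_single lkp_add_single simp del: single_numeral\<close>)
    finally show ?thesis unfolding csop_def using one hi by simp
  qed
  have cn: "csop ?f (n - 1) ?h = of_nat n * theta"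
    using csop_absent[OF s, of "n - 1" ?h] n one by (simp add: kys_hook psize_hook mult.commute)
  have "(\<Sum>i<n. csop ?f i ?h) = E * ?f ?h" using n by (intro E) (auto simp: kys_hook)
  moreover have "(\<Sum>i<n. csop ?f i ?h) = 4 + of_nat (n - 2) * (1 + theta) + of_nat n * theta"
  proof -
    have nn: "Suc (Suc (n - 2)) = n" "Suc (n - 2) = n - 1" using n by simp_all
    have "(\<Sum>i<n. csop ?f i ?h) = (\<Sum>i<Suc (Suc (n - 2)). csop ?f i ?h)" by (simp only: nn(1))
    also have "\<dots> = (\<Sum>i<Suc (n - 2). csop ?f i ?h) + csop ?f (Suc (n - 2)) ?h" by simp
    also have "csop ?f (Suc (n - 2)) ?h = of_nat n * theta" using cn by (simp only: nn(2))
    also have "(\<Sum>i<Suc (n - 2). csop ?f i ?h) = 4 + (\<Sum>i<n - 2. 1 + theta)"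
      unfolding sum.lessThan_Suc_shift c0 using ci by (intro arg_cong2[where f = "(+)"] sum.cong refl) auto
    finally show ?thesis by simp
  qed
  ultimately have EE: "E = 4 + of_nat (n - 2) * (1 + theta) + of_nat n * theta" using one by simp
  have "(\<Sum>i<n. csop ?f i ?c) = of_nat n * (?f ?c + 2 * of_nat (n - 1) * theta)"
  proof -
    have "(\<Sum>i<n. csop ?f i ?c) = (\<Sum>i<n. ?f ?c + 2 * of_nat (n - 1) * theta)"
      using csop_col[OF _ n s] by (intro sum.cong refl) (simp only: lessThan_iff one mult_1_right)
    then show ?thesis by (simp only: sum_constant card_lessThan)
  qed
  moreover have "(\<Sum>i<n. csop ?f i ?c) = E * ?f ?c" by (rule E) (simp add: kys_col)
  ultimately have eq: "E * ?f ?c = of_nat n * (?f ?c + 2 * of_nat (n - 1) * theta)" by simp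
  obtain m where m: "n = m + 2" using n by (metis add.commute le_Suc_ex)
  have "2 * ((1 + of_nat (n - 1) * theta) * ?f ?c) = 2 * (of_nat (n * (n - 1)) * theta)"
    using eq unfolding EE m by (simp add: algebra_simps)
  then show ?thesis by simp
qed

lemma hook_coefficient_spec:
  assumes "2 \<le> n" "0 \<le> \<tau>"
  shows "\<exists>v\<ge>0. spec \<tau> (jack_sf (hookpart n) (colpart n)) v"
proof -
  have "1 + of_nat (n - 1) * theta > 0" using theta_pos by (intro add_pos_nonneg) (simp_all add: less_imp_le)
  then have "jack_sf (hookpart n) (colpart n) = of_nat (n * (n - 1)) * theta / (1 + of_nat (n - 1) * theta)"
    using hook_coefficient[OF assms(1)] by (simp add: field_simps)
  then have eq: "jack_sf (hookpart n) (colpart n) = (of_nat 0 + of_nat (n * (n - 1)) * theta) / (of_nat 1 + of_nat (n - 1) * theta)"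
    by simp
  have pos: "real 1 * par1 \<tau> + real (n - 1) * par2 \<tau> > 0"
    using par[OF assms(2)] assms(1) by (auto intro: add_pos_nonneg add_nonneg_pos)
  have "spec \<tau> (jack_sf (hookpart n) (colpart n))
     ((real 0 * par1 \<tau> + real (n * (n - 1)) * par2 \<tau>) / (real 1 * par1 \<tau> + real (n - 1) * par2 \<tau>))"
    unfolding eq by (rule spec_moebius[OF assms(2) pos])
  moreover have "(real 0 * par1 \<tau> + real (n * (n - 1)) * par2 \<tau>) / (real 1 * par1 \<tau> + real (n - 1) * par2 \<tau>) \<ge> 0"
    using par[OF assms(2)] by (intro divide_nonneg_nonneg) auto
  ultimately show ?thesis by blast
qed

text \<open>
  The monomial symmetric polynomial in \<open>n\<close> variables.
\<close>
definition msym_poly :: "nat \<Rightarrow> nat multiset \<Rightarrow> rpoly" where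
  "msym_poly n M = Abs_poly_mapping (\<lambda>a. if kys a \<subseteq> {..<n} \<and> parts a = M then 1 else 0)"

lemma finite_bounded_expo: "finite {a. kys a \<subseteq> {..<n} \<and> psize a = d}"
proof -
  have "finite {f. \<forall>x. (x \<in> {..<n} \<longrightarrow> f x \<in> {..d}) \<and> (x \<notin> {..<n} \<longrightarrow> f x = (0::nat))}"
    by (rule finite_set_of_finite_funs) auto
  moreover have "lkp ` {a. kys a \<subseteq> {..<n} \<and> psize a = d} \<subseteq> {f. \<forall>x. (x \<in> {..<n} \<longrightarrow> f x \<in> {..d}) \<and> (x \<notin> {..<n} \<longrightarrow> f x = (0::nat))}"
  proof (intro image_subsetI CollectI allI conjI impI)
    fix a x assume a: "a \<in> {a. kys a \<subseteq> {..<n} \<and> psize a = d}"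
    show "lkp a x \<in> {..d}"
    proof (cases "x \<in> kys a")
      case True
      then have "lkp a x \<le> psize a" unfolding psize_def by (intro member_le_sum) auto
      then show ?thesis using a by simp
    qed (simp add: in_keys_iff)
    assume "x \<notin> {..<n}"
    then have "x \<notin> kys a" using a by blast
    then show "lkp a x = 0" by (simp add: in_keys_iff)
  qed
  ultimately have "finite (lkp ` {a. kys a \<subseteq> {..<n} \<and> psize a = d})" by (rule rev_finite_subset)
  then show ?thesis by (rule finite_imageD) (simp add: inj_on_def lookup_inject)
qed

lemma lookup_msym_poly: "Poly_Mapping.lookup (msym_poly n M) a = (if kys a \<subseteq> {..<n} \<and> parts a = M then 1 else 0)"
proof -
  have "{a. (if kys a \<subseteq> {..<n} \<and> parts a = M then 1 else (0 :: real)) \<noteq> 0} \<subseteq> {a. kys a \<subseteq> {..<n} \<and> psize a = \<Sum>\<^sub># M}"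
    by auto
  then have "finite {a. (if kys a \<subseteq> {..<n} \<and> parts a = M then 1 else (0 :: real)) \<noteq> 0}"
    by (rule finite_subset) (rule finite_bounded_expo)
  then show ?thesis unfolding msym_poly_def by (simp add: Abs_poly_mapping_inverse)
qed

lemma sumcoef_msym_poly_pos: assumes "kys a \<subseteq> {..<n}" shows "sumcoef (msym_poly n (parts a)) > 0"
proof -
  have "a \<in> Poly_Mapping.keys (msym_poly n (parts a))" using assms by (simp add: in_keys_iff lookup_msym_poly)
  then show ?thesis unfolding sumcoef_def
    by (intro sum_pos2[of _ a]) (auto simp: lookup_msym_poly assms)
qed

lemma lookup_const_mult: "Poly_Mapping.lookup (const_poly c * p) a = c * Poly_Mapping.lookup p a"
  unfolding const_poly_def mult_map_scale_conv_mult[symmetric] by (simp add: map.rep_eq when_def)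

lemma sumcoef_const_mult: "sumcoef (const_poly c * p) = c * sumcoef p"
proof -
  have "Poly_Mapping.keys (const_poly c * p) \<subseteq> Poly_Mapping.keys p" by (auto simp: in_keys_iff lookup_const_mult)
  then show ?thesis using sumcoef_superset[of "Poly_Mapping.keys p" "const_poly c * p"]
    by (simp add: lookup_const_mult sumcoef_def sum_distrib_left)
qed

lemma jack_poly_col: "jack_poly n \<tau> (colpart n) = msym_poly n (parts (colpart n))"
proof -
  let ?c = "colpart n"
  have u: "unitriang (parts ?c) (jack_sf ?c)" by (rule jack_sf_unitriang[OF partition_col])
  have "jack_sf ?c a = msym (parts ?c) a" for a
  proof (cases "jack_sf ?c a = 0")
    case True
    then show ?thesis using u by (auto simp: unitriang_def msym_def)
  next
    case False
    then have m: "domin (parts a) (parts ?c)" using u by (simp add: unitriang_def below_def)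
    then have p: "psize a = n" by (simp add: domin_def psize_col)
    have "excess 1 (parts ?c) = 0" unfolding excess_parts by (intro sum.neutral) (simp add: lkp_col)
    then have "excess 1 (parts a) = 0" using m unfolding domin_def by (metis le_zero_eq)
    then have one: "lkp a k = 1" if "k \<in> kys a" for k
      using that by (auto simp: excess_parts in_keys_iff le_antisym Suc_le_eq)
    then have "psize a = card (kys a)" by (simp add: psize_def)
    then have "parts a = replicate_mset n 1"
    proof -
      have "parts a = image_mset (\<lambda>_. 1) (mset_set (kys a))"
        unfolding parts_def using one by (intro image_mset_cong) auto
      then show ?thesis using p \<open>psize a = card (kys a)\<close> by (simp add: image_mset_const_eq)
    qed
    moreover have "parts ?c = replicate_mset n 1"
    proof -
      have "parts ?c = image_mset (\<lambda>_. 1) (mset_set (kys ?c))"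
        unfolding parts_def by (intro image_mset_cong) (auto simp: kys_col lkp_col)
      then show ?thesis by (simp add: image_mset_const_eq kys_col)
    qed
    ultimately have "parts a = parts ?c" by simp
    then show ?thesis using u by (simp add: unitriang_def msym_def)
  qed
  moreover have "specialize \<tau> 0 = 0" "specialize \<tau> 1 = 1"
    by (rule specialize_eq, rule spec_const, rule hasval_0) (rule specialize_eq, rule spec_const, rule hasval_1)
  ultimately have "(\<lambda>a. if kys a \<subseteq> {..<n} then specialize \<tau> (jack_sf ?c a) else 0)
     = (\<lambda>a. if kys a \<subseteq> {..<n} \<and> parts a = parts ?c then 1 else 0)"
    by (auto simp: msym_def fun_eq_iff)
  then show ?thesis by (simp add: jack_poly_def msym_poly_def)
qed

lemma jack_poly_hook:
  assumes n: "2 \<le> n" and v: "spec \<tau> (jack_sf (hookpart n) (colpart n)) v"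
  shows "jack_poly n \<tau> (hookpart n) = msym_poly n (parts (hookpart n)) + const_poly v * msym_poly n (parts (colpart n))"
proof -
  let ?c = "colpart n" and ?h = "hookpart n"
  have u: "unitriang (parts ?h) (jack_sf ?h)" by (rule jack_sf_unitriang[OF partition_hook])
  have s: "symm (jack_sf ?h)" using u by (simp add: unitriang_def homsym_def)
  have ne: "parts ?h \<noteq> parts ?c"
    using parts_inj_partition[OF partition_hook partition_col, of n n] lkp_hook[of n 0] lkp_col[of n 0] by (auto split: if_splits)
  have z: "specialize \<tau> 0 = 0" "specialize \<tau> 1 = 1"
    by (rule specialize_eq, rule spec_const, rule hasval_0) (rule specialize_eq, rule spec_const, rule hasval_1)
  have "specialize \<tau> (jack_sf ?h a) = (if parts a = parts ?h then 1 else 0) + v * (if parts a = parts ?c then 1 else 0)" for a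
  proof -
    consider "parts a = parts ?h" | "parts a = parts ?c" | "parts a \<noteq> parts ?h" "parts a \<noteq> parts ?c" by blast
    then show ?thesis
    proof cases
      case 1
      then show ?thesis using u ne z by (simp add: unitriang_def)
    next
      case 2
      then have "jack_sf ?h a = jack_sf ?h ?c" by (rule symmD[OF s])
      then show ?thesis using 2 ne specialize_eq[OF v] by simp
    next
      case 3
      then have "jack_sf ?h a = 0" using below_hook_cases[OF n, of a] u by (auto simp: unitriang_def below_def)
      then show ?thesis using 3 z by simp
    qed
  qed
  then have "(\<lambda>a. if kys a \<subseteq> {..<n} then specialize \<tau> (jack_sf ?h a) else 0)
     = Poly_Mapping.lookup (msym_poly n (parts ?h) + const_poly v * msym_poly n (parts ?c))"
    by (auto simp: fun_eq_iff lookup_add lookup_const_mult lookup_msym_poly)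
  then show ?thesis unfolding jack_poly_def by (simp add: lookup_inverse)
qed

text \<open>
  If \<open>P = A + v B\<close> with monomial symmetric polynomials \<open>A\<close>, \<open>B\<close>, then the coefficient \<open>v\<close> enters the
  difference of the normalized polynomials only through a positive scalar.
\<close>
lemma hook_difference:
  assumes n: "2 \<le> n" and t: "0 \<le> \<tau>"
  defines "A \<equiv> msym_poly n (parts (hookpart n))" and "B \<equiv> msym_poly n (parts (colpart n))"
  shows "\<exists>r>0. jack_normalized n \<tau> (hookpart n) - jack_normalized n \<tau> (colpart n)
    = const_poly r * (const_poly (sumcoef B) * A - const_poly (sumcoef A) * B)"
proof -
  obtain v where v: "v \<ge> 0" "spec \<tau> (jack_sf (hookpart n) (colpart n)) v"
    using hook_coefficient_spec[OF n t] by blast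
  have a: "sumcoef A > 0" unfolding A_def using n by (intro sumcoef_msym_poly_pos) (auto simp: kys_hook)
  have b: "sumcoef B > 0" unfolding B_def by (intro sumcoef_msym_poly_pos) (simp add: kys_col)
  let ?D = "sumcoef A + v * sumcoef B"
  have D: "?D > 0" using a b v(1) by (simp add: add_pos_nonneg)
  have h: "jack_normalized n \<tau> (hookpart n) = const_poly (1 / ?D) * (A + const_poly v * B)"
    unfolding jack_normalized_def eval_one jack_poly_hook[OF n v(2)] A_def[symmetric] B_def[symmetric] sumcoef_add sumcoef_const_mult ..
  have c: "jack_normalized n \<tau> (colpart n) = const_poly (1 / sumcoef B) * B"
    unfolding jack_normalized_def eval_one jack_poly_col B_def[symmetric] ..
  let ?r = "1 / (?D * sumcoef B)"
  have "jack_normalized n \<tau> (hookpart n) - jack_normalized n \<tau> (colpart n)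
     = const_poly ?r * (const_poly (sumcoef B) * A - const_poly (sumcoef A) * B)"
  proof (rule poly_mapping_eqI)
    fix x
    have "1 / ?D * (p + v * q) - 1 / sumcoef B * q = ?r * (sumcoef B * p - sumcoef A * q)" for p q
      using a b D by (simp add: field_simps)
    then show "Poly_Mapping.lookup (jack_normalized n \<tau> (hookpart n) - jack_normalized n \<tau> (colpart n)) x
      = Poly_Mapping.lookup (const_poly ?r * (const_poly (sumcoef B) * A - const_poly (sumcoef A) * B)) x"
      unfolding h c by (simp only: lookup_minus lookup_add lookup_const_mult)
  qed
  then show ?thesis using D b by (intro exI[of _ ?r]) simp
qed

lemma hook_in_semiring:
  assumes n: "2 \<le> n" and t: "0 \<le> \<sigma>" "0 \<le> \<tau>"
  shows "jack_normalized n \<tau> (hookpart n) - jack_normalized n \<tau> (colpart n) \<in> jack_semiring n \<sigma>"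
proof -
  let ?D = "\<lambda>\<tau>. jack_normalized n \<tau> (hookpart n) - jack_normalized n \<tau> (colpart n)"
  define g where "g = const_poly (sumcoef (msym_poly n (parts (colpart n)))) * msym_poly n (parts (hookpart n))
    - const_poly (sumcoef (msym_poly n (parts (hookpart n)))) * msym_poly n (parts (colpart n))"
  obtain r where r: "r > 0" "?D \<tau> = const_poly r * g" unfolding g_def using hook_difference[OF n t(2)] by blast
  obtain q where q: "q > 0" "?D \<sigma> = const_poly q * g" unfolding g_def using hook_difference[OF n t(1)] by blast
  have eq: "?D \<tau> = const_poly (r / q) * ?D \<sigma>"
    unfolding r(2) q(2) mult.assoc[symmetric] const_poly_hom(3)[symmetric] using q(1) by simp
  have "hookpart n \<succcurlyeq> colpart n"
  proof -
    have "(\<Sum>i<k. lkp (colpart n) i) \<le> (\<Sum>i<k. lkp (hookpart n) i)" for k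
    proof (cases "k < n")
      case True
      show ?thesis by (intro sum_mono) (use True n in \<open>auto simp: lkp_col lkp_hook\<close>)
    next
      case False
      have "(\<Sum>i<k. lkp (colpart n) i) = psize (colpart n)" using False by (intro psize_superset[symmetric]) (auto simp: kys_col)
      also have "\<dots> = psize (hookpart n)" using n by (simp add: psize_col psize_hook)
      also have "\<dots> = (\<Sum>i<k. lkp (hookpart n) i)" using False n by (intro psize_superset) (auto simp: kys_hook)
      finally show ?thesis by simp
    qed
    then show ?thesis using n by (simp add: majorizes_def psize_col psize_hook)
  qed
  then have gen: "?D \<sigma> \<in> jack_generators n \<sigma>"
    unfolding jack_generators_def using n partition_hook partition_col
    by (intro UnI1 CollectI exI[of _ "hookpart n"] exI[of _ "colpart n"]) (auto simp: Parts_def kys_col kys_hook)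
  show ?thesis by (subst eq, intro semiring_mult semiring_const semiring_gen gen) (use r(1) q(1) in simp)
qed

section \<open>The semiring property for both families\<close>

theorem theorem4p9:
  fixes \<sigma> \<tau> :: ereal
  assumes "0 \<le> \<sigma>" and "\<sigma> < \<tau>" and "\<tau> \<le> \<infinity>"
  shows "(\<forall>lam\<in>Parts 2. \<forall>mu\<in>Parts 2. lam \<succcurlyeq> mu \<longrightarrow>
            jack_normalized 2 \<tau> lam - jack_normalized 2 \<tau> mu \<in> jack_semiring 2 \<sigma>) \<and>
         (\<forall>n\<ge>3. \<forall>lam mu.
            lam = Poly_Mapping.nth (2 # replicate (n - 2) 1 @ [0]) \<longrightarrow>
            mu = Poly_Mapping.nth (replicate n 1) \<longrightarrow>
            jack_normalized n \<tau> lam - jack_normalized n \<tau> mu \<in> jack_semiring n \<sigma>)"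
proof (intro conjI ballI impI allI)
  have \<tau>: "0 \<le> \<tau>" and \<sigma>: "\<sigma> < \<infinity>" using assms by auto
  show "jack_normalized 2 \<tau> lam - jack_normalized 2 \<tau> mu \<in> jack_semiring 2 \<sigma>"
    if "lam \<in> Parts 2" "mu \<in> Parts 2" "lam \<succcurlyeq> mu" for lam mu
    by (rule two_variables[OF assms(1) \<sigma> \<tau> that])
  fix n :: nat and lam mu :: expo
  assume n: "3 \<le> n" and "lam = Poly_Mapping.nth (2 # replicate (n - 2) 1 @ [0])" "mu = Poly_Mapping.nth (replicate n 1)"
  then have "lam = hookpart n" "mu = colpart n" by (simp_all add: hookpart_def colpart_def)
  then show "jack_normalized n \<tau> lam - jack_normalized n \<tau> mu \<in> jack_semiring n \<sigma>"
    using hook_in_semiring[OF _ assms(1) \<tau>, of n] n by simp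
qed

end
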